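(* Let $K$ be a field complete with respect to a nontrivial non-archimedean absolute value, let $\mathcal{A}$ be an affinoid algebra over $K$, and let $X=\operatorname{Max}(\mathcal{A})$. Let $\mathcal{C}_L$ be the collection of all coverings of $X$ that are refined by some finite covering of $X$ by open Laurent domains. Then $\mathcal{C}_L$ is a uniform structure on $X$, and the uniform topology it induces on $X$ is the canonical topology of $X$.
   Context: An affinoid algebra over $K$ is a quotient ring of the ring $T_n$ of restricted power series over $K$ in $n$ variables (coefficients tending to zero) for some $n\ge 1$. $\operatorname{Max}(\mathcal{A})$ is the set of maximal ideals of $\mathcal{A}$. For $x\in X$ corresponding to the maximal ideal $\mathfrak{m}$ and $f\in\mathcal{A}$, $f(x)$ is the image of $f$ in $\mathcal{A}/\mathfrak{m}$, a finite extension of $K$, and $|f(x)|$ is its absolute value under the unique extension of the absolute value of $K$. Put $\sqrt{|K^*|}=\{\alpha>0 : \alpha^n=|z| \text{ for some } z\in K \text{ and some integer } n\ge 1\}$. An open Laurent domain in $X$ is a set of the form $\{x\in X : |f_i(x)|<\alpha_i\ (1\le i\le s),\ |g_j(x)|>\beta_j\ (1\le j\le t)\}$ with $f_i,g_j\in\mathcal{A}$ and $\alpha_i,\beta_j\in\sqrt{|K^*|}$. The canonical topology on $X$ is the topology having the open Laurent domains as a base. A covering of a set $X$ is a collection of subsets of $X$ with union $X$. A covering $C$ refines a covering $D$ (written $C<D$) if every element of $C$ is contained in some element of $D$; $C$ star-refines $D$ if for every $U\in C$ the union of all elements of $C$ meeting $U$ is contained in some element of $D$. A uniform structure on $X$ is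 a collection $\mathcal{C}$ of coverings of $X$ such that (C1) if $C\in\mathcal{C}$ and $C<D$ then $D\in\mathcal{C}$; (C2) for all $D_1,D_2\in\mathcal{C}$ there is $C\in\mathcal{C}$ star-refining both $D_1$ and $D_2$. In the uniform topology of $(X,\mathcal{C})$, $U\subseteq X$ is open iff for each $x\in U$ there is $C\in\mathcal{C}$ such that the union of all elements of $C$ containing $x$ lies in $U$. *)

theory Defs
  imports "HOL-Algebra.QuotRing" "HOL-Analysis.Abstract_Topology"
begin

section \<open>Complete non-archimedean fields\<close>

locale complete_nonarch_field =
  fixes v :: "'k::field \<Rightarrow> real"
  assumes nonneg: "0 \<le> v x"
    and zero_iff: "v x = 0 \<longleftrightarrow> x = 0"
    and mult: "v (x * y) = v x * v y"
    and ultrametric: "v (x + y) \<le> max (v x) (v y)"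
    and nontrivial: "\<exists>x. x \<noteq> 0 \<and> v x \<noteq> 1"
    and complete:
      "(\<forall>e>0. \<exists>N. \<forall>i\<ge>N. \<forall>j\<ge>N. v (X i - X j) < e) \<Longrightarrow>
        \<exists>L. (\<lambda>i. v (X i - L)) \<longlonglongrightarrow> 0"

definition sqrt_value_group :: "('k::field \<Rightarrow> real) \<Rightarrow> real set" where
  "sqrt_value_group v = {\<alpha>. \<alpha> > 0 \<and> (\<exists>z n. n \<ge> (1::nat) \<and> \<alpha> ^ n = v z)}"

section \<open>Affinoid algebras\<close>

text \<open>
  A multi-index in \<open>n\<close> variables is a function \<open>nat \<Rightarrow> nat\<close> vanishing outside \<open>{..<n}\<close>; a power
  series is the function mapping a multi-index to its coefficient, extended by \<open>0\<close> to all of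
  \<open>nat \<Rightarrow> nat\<close>.  In the product, \<open>p \<le> m\<close> and \<open>m - p\<close> are pointwise; the index set is finite
  whenever \<open>m\<close> is a multi-index, and all terms are \<open>0\<close> otherwise.
\<close>

definition multi_indices :: "nat \<Rightarrow> (nat \<Rightarrow> nat) set" where
  "multi_indices n = {m. \<forall>i\<ge>n. m i = 0}"

definition const_series :: "'k::field \<Rightarrow> (nat \<Rightarrow> nat) \<Rightarrow> 'k" where
  "const_series c = (\<lambda>m. if m = (\<lambda>_. 0) then c else 0)"

definition tate_algebra :: "('k::field \<Rightarrow> real) \<Rightarrow> nat \<Rightarrow> ((nat \<Rightarrow> nat) \<Rightarrow> 'k) ring" where
  "tate_algebra v n =
    \<lparr>carrier = {f. (\<forall>m. m \<notin> multi_indices n \<longrightarrow> f m = 0) \<and>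
                   (\<forall>\<epsilon>>0. finite {m \<in> multi_indices n. v (f m) \<ge> \<epsilon>})},
     mult = (\<lambda>f g m. \<Sum>p | p \<le> m. f p * g (m - p)),
     one = const_series 1,
     zero = const_series 0,
     add = (\<lambda>f g m. f m + g m)\<rparr>"

text \<open>
  \<open>A\<close>, with structure map \<open>\<iota>\<close> from the base field, is isomorphic over the base field to a
  quotient of some \<open>T\<^sub>n\<close>.  The zero ring is allowed.
\<close>

definition affinoid_algebra ::
    "('k::field \<Rightarrow> real) \<Rightarrow> ('a, 'b) ring_scheme \<Rightarrow> ('k \<Rightarrow> 'a) \<Rightarrow> bool" where
  "affinoid_algebra v A \<iota> \<longleftrightarrow> cring A \<and>
    (\<exists>n\<ge>1. \<exists>I. ideal I (tate_algebra v n) \<and>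
      (\<exists>\<phi> \<in> ring_iso (tate_algebra v n Quot I) A.
        \<forall>c. \<phi> (I +>\<^bsub>tate_algebra v n\<^esub> const_series c) = \<iota> c))"

definition Max_spec :: "('a, 'b) ring_scheme \<Rightarrow> 'a set set" where
  "Max_spec A = {M. maximalideal M A}"

section \<open>Absolute values of functions at points\<close>

definition nonarch_abs :: "('a, 'b) ring_scheme \<Rightarrow> ('a \<Rightarrow> real) \<Rightarrow> bool" where
  "nonarch_abs R w \<longleftrightarrow>
    (\<forall>a\<in>carrier R. 0 \<le> w a \<and> (w a = 0 \<longleftrightarrow> a = \<zero>\<^bsub>R\<^esub>)) \<and>
    (\<forall>a\<in>carrier R. \<forall>b\<in>carrier R.
      w (a \<otimes>\<^bsub>R\<^esub> b) = w a * w b \<and> w (a \<oplus>\<^bsub>R\<^esub> b) \<le> max (w a) (w b))"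

text \<open>
  The absolute value of the residue field \<open>A Quot M\<close> extending \<open>v\<close>; extensionality makes it
  unique as a HOL function.
\<close>

definition residue_abs ::
    "('k::field \<Rightarrow> real) \<Rightarrow> ('a, 'b) ring_scheme \<Rightarrow> ('k \<Rightarrow> 'a) \<Rightarrow> 'a set \<Rightarrow> 'a set \<Rightarrow> real" where
  "residue_abs v A \<iota> M =
    (THE w. w \<in> extensional (carrier (A Quot M)) \<and> nonarch_abs (A Quot M) w \<and>
      (\<forall>c. w (M +>\<^bsub>A\<^esub> \<iota> c) = v c))"

definition abs_at ::
    "('k::field \<Rightarrow> real) \<Rightarrow> ('a, 'b) ring_scheme \<Rightarrow> ('k \<Rightarrow> 'a) \<Rightarrow> 'a \<Rightarrow> 'a set \<Rightarrow> real" where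
  "abs_at v A \<iota> f M = residue_abs v A \<iota> M (M +>\<^bsub>A\<^esub> f)"

section \<open>Open Laurent domains and the canonical topology\<close>

definition open_laurent_domain ::
    "('k::field \<Rightarrow> real) \<Rightarrow> ('a, 'b) ring_scheme \<Rightarrow> ('k \<Rightarrow> 'a) \<Rightarrow> 'a set set \<Rightarrow> bool" where
  "open_laurent_domain v A \<iota> U \<longleftrightarrow>
    (\<exists>(s::nat) (t::nat) f g \<alpha> \<beta>.
      (\<forall>i\<in>{1..s}. f i \<in> carrier A \<and> \<alpha> i \<in> sqrt_value_group v) \<and>
      (\<forall>j\<in>{1..t}. g j \<in> carrier A \<and> \<beta> j \<in> sqrt_value_group v) \<and>
      U = {x \<in> Max_spec A. (\<forall>i\<in>{1..s}. abs_at v A \<iota> (f i) x < \<alpha> i) \<and>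
                           (\<forall>j\<in>{1..t}. abs_at v A \<iota> (g j) x > \<beta> j)})"

definition canonical_topology ::
    "('k::field \<Rightarrow> real) \<Rightarrow> ('a, 'b) ring_scheme \<Rightarrow> ('k \<Rightarrow> 'a) \<Rightarrow> 'a set topology" where
  "canonical_topology v A \<iota> = topology (arbitrary union_of open_laurent_domain v A \<iota>)"

lemma ball_append:
  fixes m m' :: nat and h h' :: "nat \<Rightarrow> 'a" and k k' :: "nat \<Rightarrow> 'b"
  shows "(\<forall>i\<in>{1..m + m'}. P (if i \<le> m then h i else h' (i - m))
                            (if i \<le> m then k i else k' (i - m))) \<longleftrightarrow>
    (\<forall>i\<in>{1..m}. P (h i) (k i)) \<and> (\<forall>i\<in>{1..m'}. P (h' i) (k' i))"
    (is "?L \<longleftrightarrow> ?R")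
proof
  assume L: ?L
  have "P (h i) (k i)" if "i \<in> {1..m}" for i
    using bspec[OF L, of i] that by simp
  moreover have "P (h' i) (k' i)" if "i \<in> {1..m'}" for i
    using bspec[OF L, of "m + i"] that by simp
  ultimately show ?R by blast
next
  assume R: ?R
  show ?L
  proof
    fix i assume i: "i \<in> {1..m + m'}"
    then show "P (if i \<le> m then h i else h' (i - m)) (if i \<le> m then k i else k' (i - m))"
    proof (cases "i \<le> m")
      case True
      then show ?thesis using R i by simp
    next
      case False
      then have "i - m \<in> {1..m'}" using i by auto
      then show ?thesis using R False by simp
    qed
  qed
qed

lemma open_laurent_domain_Int:
  assumes "open_laurent_domain v A \<iota> U" "open_laurent_domain v A \<iota> V"
  shows "open_laurent_domain v A \<iota> (U \<inter> V)"
proof -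
  obtain s t :: nat and f g \<alpha> \<beta> where
    1: "\<forall>i\<in>{1..s}. f i \<in> carrier A \<and> \<alpha> i \<in> sqrt_value_group v"
       "\<forall>j\<in>{1..t}. g j \<in> carrier A \<and> \<beta> j \<in> sqrt_value_group v"
       "U = {x \<in> Max_spec A. (\<forall>i\<in>{1..s}. abs_at v A \<iota> (f i) x < \<alpha> i) \<and>
                             (\<forall>j\<in>{1..t}. abs_at v A \<iota> (g j) x > \<beta> j)}"
    using assms(1) unfolding open_laurent_domain_def
    by (elim exE conjE) (rule that)
  obtain s' t' :: nat and f' g' \<alpha>' \<beta>' where
    2: "\<forall>i\<in>{1..s'}. f' i \<in> carrier A \<and> \<alpha>' i \<in> sqrt_value_group v"
       "\<forall>j\<in>{1..t'}. g' j \<in> carrier A \<and> \<beta>' j \<in> sqrt_value_group v"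
       "V = {x \<in> Max_spec A. (\<forall>i\<in>{1..s'}. abs_at v A \<iota> (f' i) x < \<alpha>' i) \<and>
                             (\<forall>j\<in>{1..t'}. abs_at v A \<iota> (g' j) x > \<beta>' j)}"
    using assms(2) unfolding open_laurent_domain_def
    by (elim exE conjE) (rule that)
  show ?thesis
    unfolding open_laurent_domain_def
  proof (intro exI conjI)
    let ?f = "\<lambda>i. if i \<le> s then f i else f' (i - s)" and ?\<alpha> = "\<lambda>i. if i \<le> s then \<alpha> i else \<alpha>' (i - s)"
    let ?g = "\<lambda>j. if j \<le> t then g j else g' (j - t)" and ?\<beta> = "\<lambda>j. if j \<le> t then \<beta> j else \<beta>' (j - t)"
    show "\<forall>i\<in>{1..s + s'}. ?f i \<in> carrier A \<and> ?\<alpha> i \<in> sqrt_value_group v"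
      using ball_append[where P = "\<lambda>a b. a \<in> carrier A \<and> b \<in> sqrt_value_group v"] 1(1) 2(1) by blast
    show "\<forall>j\<in>{1..t + t'}. ?g j \<in> carrier A \<and> ?\<beta> j \<in> sqrt_value_group v"
      using ball_append[where P = "\<lambda>a b. a \<in> carrier A \<and> b \<in> sqrt_value_group v"] 1(2) 2(2) by blast
    have "(\<forall>i\<in>{1..s + s'}. abs_at v A \<iota> (?f i) x < ?\<alpha> i) \<longleftrightarrow>
        (\<forall>i\<in>{1..s}. abs_at v A \<iota> (f i) x < \<alpha> i) \<and> (\<forall>i\<in>{1..s'}. abs_at v A \<iota> (f' i) x < \<alpha>' i)"
      for x by (rule ball_append[where P = "\<lambda>a b. abs_at v A \<iota> a x < b"])
    moreover have "(\<forall>j\<in>{1..t + t'}. abs_at v A \<iota> (?g j) x > ?\<beta> j) \<longleftrightarrow>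
        (\<forall>j\<in>{1..t}. abs_at v A \<iota> (g j) x > \<beta> j) \<and> (\<forall>j\<in>{1..t'}. abs_at v A \<iota> (g' j) x > \<beta>' j)"
      for x by (rule ball_append[where P = "\<lambda>a b. abs_at v A \<iota> a x > b"])
    ultimately show "U \<inter> V = {x \<in> Max_spec A.
        (\<forall>i\<in>{1..s + s'}. abs_at v A \<iota> (?f i) x < ?\<alpha> i) \<and>
        (\<forall>j\<in>{1..t + t'}. abs_at v A \<iota> (?g j) x > ?\<beta> j)}"
      unfolding 1(3) 2(3) by blast
  qed
qed

lemma openin_canonical_topology:
  "openin (canonical_topology v A \<iota>) U \<longleftrightarrow>
    (\<exists>\<B>. (\<forall>B\<in>\<B>. open_laurent_domain v A \<iota> B) \<and> U = \<Union>\<B>)"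
proof -
  have "istopology (arbitrary union_of open_laurent_domain v A \<iota>)"
    by (rule istopology_base) (rule open_laurent_domain_Int)
  then show ?thesis
    by (auto simp: canonical_topology_def union_of_def arbitrary_def)
qed

section \<open>Uniform structures given by coverings\<close>

definition covering :: "'a set \<Rightarrow> 'a set set \<Rightarrow> bool" where
  "covering X C \<longleftrightarrow> \<Union>C = X"

definition cover_refines :: "'a set set \<Rightarrow> 'a set set \<Rightarrow> bool" where
  "cover_refines C D \<longleftrightarrow> (\<forall>U\<in>C. \<exists>V\<in>D. U \<subseteq> V)"

definition star_refines :: "'a set set \<Rightarrow> 'a set set \<Rightarrow> bool" where
  "star_refines C D \<longleftrightarrow> (\<forall>U\<in>C. \<exists>V\<in>D. \<Union>{W\<in>C. W \<inter> U \<noteq> {}} \<subseteq> V)"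

definition uniform_structure :: "'a set \<Rightarrow> 'a set set set \<Rightarrow> bool" where
  "uniform_structure X \<C> \<longleftrightarrow>
    (\<forall>C\<in>\<C>. covering X C) \<and>
    (\<forall>C\<in>\<C>. \<forall>D. covering X D \<and> cover_refines C D \<longrightarrow> D \<in> \<C>) \<and>
    (\<forall>D1\<in>\<C>. \<forall>D2\<in>\<C>. \<exists>C\<in>\<C>. star_refines C D1 \<and> star_refines C D2)"

definition uniform_topology :: "'a set \<Rightarrow> 'a set set set \<Rightarrow> 'a topology" where
  "uniform_topology X \<C> =
    topology (\<lambda>U. U \<subseteq> X \<and> (\<forall>x\<in>U. \<exists>C\<in>\<C>. \<Union>{V\<in>C. x \<in> V} \<subseteq> U))"

lemma openin_uniform_topology:
  assumes "uniform_structure X \<C>"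
  shows "openin (uniform_topology X \<C>) U \<longleftrightarrow>
    U \<subseteq> X \<and> (\<forall>x\<in>U. \<exists>C\<in>\<C>. \<Union>{V\<in>C. x \<in> V} \<subseteq> U)"
proof -
  have "istopology (\<lambda>U. U \<subseteq> X \<and> (\<forall>x\<in>U. \<exists>C\<in>\<C>. \<Union>{V\<in>C. x \<in> V} \<subseteq> U))"
    unfolding istopology_def
  proof (intro conjI allI impI ballI)
    fix S T x
    assume S: "S \<subseteq> X \<and> (\<forall>x\<in>S. \<exists>C\<in>\<C>. \<Union>{V\<in>C. x \<in> V} \<subseteq> S)"
      and T: "T \<subseteq> X \<and> (\<forall>x\<in>T. \<exists>C\<in>\<C>. \<Union>{V\<in>C. x \<in> V} \<subseteq> T)"
    show "S \<inter> T \<subseteq> X" using S by blast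
    assume x: "x \<in> S \<inter> T"
    obtain C1 C2 where C1: "C1 \<in> \<C>" "\<Union>{V\<in>C1. x \<in> V} \<subseteq> S"
      and C2: "C2 \<in> \<C>" "\<Union>{V\<in>C2. x \<in> V} \<subseteq> T"
      using S T x by blast
    obtain C where C: "C \<in> \<C>" "star_refines C C1" "star_refines C C2"
      using assms C1(1) C2(1) unfolding uniform_structure_def by blast
    have "W \<subseteq> S \<inter> T" if W: "W \<in> C" "x \<in> W" for W
    proof -
      obtain V1 V2 where V: "V1 \<in> C1" "\<Union>{W'\<in>C. W' \<inter> W \<noteq> {}} \<subseteq> V1"
        "V2 \<in> C2" "\<Union>{W'\<in>C. W' \<inter> W \<noteq> {}} \<subseteq> V2"
        using C(2,3) W(1) unfolding star_refines_def by meson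
      have "W \<subseteq> V1" "W \<subseteq> V2" using V W by blast+
      then show ?thesis using V W C1 C2 by blast
    qed
    then show "\<exists>C\<in>\<C>. \<Union>{V\<in>C. x \<in> V} \<subseteq> S \<inter> T" using C(1) by blast
  next
    fix \<K>
    assume K: "\<forall>K\<in>\<K>. K \<subseteq> X \<and> (\<forall>x\<in>K. \<exists>C\<in>\<C>. \<Union>{V\<in>C. x \<in> V} \<subseteq> K)"
    then show "\<Union>\<K> \<subseteq> X" by blast
    fix x assume "x \<in> \<Union>\<K>"
    then obtain L where L: "L \<in> \<K>" "x \<in> L" by blast
    then obtain C where "C \<in> \<C>" "\<Union>{V\<in>C. x \<in> V} \<subseteq> L" using K by blast
    then show "\<exists>C\<in>\<C>. \<Union>{V\<in>C. x \<in> V} \<subseteq> \<Union>\<K>" using L by blast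
  qed
  then show ?thesis by (simp add: uniform_topology_def)
qed

definition laurent_coverings ::
    "('k::field \<Rightarrow> real) \<Rightarrow> ('a, 'b) ring_scheme \<Rightarrow> ('k \<Rightarrow> 'a) \<Rightarrow> 'a set set set set" where
  "laurent_coverings v A \<iota> =
    {D. covering (Max_spec A) D \<and>
        (\<exists>C. finite C \<and> covering (Max_spec A) C \<and>
             (\<forall>U\<in>C. open_laurent_domain v A \<iota> U) \<and> cover_refines C D)}"

end

theory Submission
  imports Defs "HOL-Library.Function_Algebras"
begin

text \<open>
  A finite covering by open Laurent domains has a finite star-refinement of the same kind as soon as
  all the inequalities defining its members can be sharpened by a factor \<open>q > 1\<close> without losing the
  covering property.  By distributivity this is a statement about one system of inequalities
  \<open>|f\<^sub>i| \<ge> \<alpha>\<^sub>i\<close>, \<open>|g\<^sub>j| \<le> \<beta>\<^sub>j\<close>: if it has no solution in \<open>Max A\<close>, then neither has a slightly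
  relaxed system.  Writing \<open>\<alpha>\<^sub>i\<close> and \<open>\<beta>\<^sub>j\<close> as roots of values of \<open>K\<close>, the system is encoded by
  equations in a Tate algebra with additional variables (Rabinowitsch).  If these equations generated a
  proper ideal, a maximal ideal above it would restrict to a solution; so \<open>1\<close> lies in the ideal, and
  evaluating a polynomial approximation of this fact at a solution of the relaxed system bounds the
  relaxation from below.

  This needs the Nullstellensatz (residue fields of Tate algebras are finite over \<open>K\<close>), proved by
  shearing the variables and dividing with remainder up to a small error, and the unique extension of
  the absolute value to these residue fields.  Uniqueness follows from the equivalence of norms on
  finite-dimensional spaces; applied to power-multiplicative norms, it also shows that the spectral
  seminorm of the residue norm is multiplicative.
\<close>

section \<open>Formal power series in finitely many of countably many variables\<close>

text \<open>The obstacle is uniformity: insolubility at each of infinitely many points must yield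
  one factor \<open>q\<close> valid for all of them. The additional variables supply it. A variable
  has Gauss norm 1, so at a maximal ideal its absolute value is at most 1, and the equations then
  force the unrelaxed inequalities. At a solution of the system relaxed by \<open>q\<close> the same
  variables take values of size at most a power of \<open>q\<close>. If \<open>x\<close> is a
  polynomial in them that vanishes at all solutions, and \<open>1 - x\<close> has norm at most 1/2,
  then evaluation gives \<open>1 \<le> 1/2 * q ^ m\<close> with \<open>m\<close> depending on
  \<open>x\<close> alone, which is false for \<open>q\<close> close to 1.

  All Tate algebras are subsets \<open>T n\<close> of one type, because the Nullstellensatz is an
  induction on the number of variables and ideals are restricted along the inclusion of
  \<open>T n\<close> in \<open>T N\<close>.

  Division leaves an error smaller by a factor \<epsilon> < 1 each time; iterating it, with
  completeness of \<open>T n\<close> and closedness of maximal ideals, takes the place of the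
  Weierstrass division theorem.\<close>

text \<open>Coefficients at indices of infinite support are required to be \<open>0\<close>: the sum in the definition
  of \<^const>\<open>tate_algebra\<close>'s product is over an infinite set there.\<close>

typedef (overloaded) 'k mps = "{f :: (nat \<Rightarrow> nat) \<Rightarrow> 'k::zero. \<forall>m. infinite {i. m i \<noteq> 0} \<longrightarrow> f m = 0}"
  morphisms coef Mps
  by (rule exI[of _ "\<lambda>_. 0"]) simp

lemma coef_infinite: "infinite {i. m i \<noteq> 0} \<Longrightarrow> coef f m = 0"
  using coef[of f] by simp

lemma coef_Mps: "(\<And>m. infinite {i. m i \<noteq> 0} \<Longrightarrow> f m = 0) \<Longrightarrow> coef (Mps f) = f"
  by (simp add: Mps_inverse)

lemma mps_eqI: "(\<And>m. coef f m = coef g m) \<Longrightarrow> f = g"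
  using coef_inject[of f g] by blast

lemma finite_below:
  assumes "finite {i. m i \<noteq> 0}"
  shows "finite {p :: nat \<Rightarrow> nat. p \<le> m}"
proof -
  let ?A = "{i. m i \<noteq> 0}"
  have "finite {p. \<forall>i. (i \<in> ?A \<longrightarrow> p i \<in> {..Max (m ` ?A)}) \<and> (i \<notin> ?A \<longrightarrow> p i = 0)}"
    using assms by (intro finite_set_of_finite_funs) auto
  moreover have "{p. p \<le> m} \<subseteq> {p. \<forall>i. (i \<in> ?A \<longrightarrow> p i \<in> {..Max (m ` ?A)}) \<and> (i \<notin> ?A \<longrightarrow> p i = 0)}"
  proof (intro subsetI CollectI allI conjI impI)
    fix p i assume p: "p \<in> {p. p \<le> m}" and i: "i \<in> {i. m i \<noteq> 0}"
    have "p i \<le> m i" using p by (simp add: le_fun_def)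
    also have "m i \<le> Max (m ` ?A)" using assms i by (intro Max_ge) auto
    finally show "p i \<in> {..Max (m ` ?A)}" by simp
  next
    fix p i assume p: "p \<in> {p. p \<le> m}" and i: "i \<notin> {i. m i \<noteq> 0}"
    have "p i \<le> m i" using p by (simp add: le_fun_def)
    then show "p i = 0" using i by simp
  qed
  ultimately show ?thesis by (rule rev_finite_subset)
qed

lemma infinite_supp_split:
  fixes p m :: "nat \<Rightarrow> nat"
  assumes "infinite {i. m i \<noteq> 0}" "p \<le> m"
  shows "infinite {i. p i \<noteq> 0} \<or> infinite {i. (m - p) i \<noteq> 0}"
proof (rule ccontr)
  assume "\<not> ?thesis"
  then have "finite ({i. p i \<noteq> 0} \<union> {i. (m - p) i \<noteq> 0})" by simp
  moreover have "{i. m i \<noteq> 0} \<subseteq> {i. p i \<noteq> 0} \<union> {i. (m - p) i \<noteq> 0}" by (auto simp: fun_diff_def)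
  ultimately show False using assms finite_subset by blast
qed

lemma fun_le_add_diff: "p \<le> m \<Longrightarrow> p + (m - p) = (m :: nat \<Rightarrow> nat)"
  by (auto simp: fun_eq_iff le_fun_def)

lemma fun_le_add [simp]: "p \<le> p + (q :: nat \<Rightarrow> nat)" "q \<le> p + (q :: nat \<Rightarrow> nat)"
  by (auto simp: le_fun_def)

instantiation mps :: (comm_ring_1) comm_ring_1
begin

definition zero_mps :: "'a mps" where "0 = Mps (\<lambda>_. 0)"
definition one_mps :: "'a mps" where "1 = Mps (\<lambda>m. if m = 0 then 1 else 0)"
definition plus_mps :: "'a mps \<Rightarrow> 'a mps \<Rightarrow> 'a mps" where
  "f + g = Mps (\<lambda>m. coef f m + coef g m)"
definition uminus_mps :: "'a mps \<Rightarrow> 'a mps" where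
  "- f = Mps (\<lambda>m. - coef f m)"
definition minus_mps :: "'a mps \<Rightarrow> 'a mps \<Rightarrow> 'a mps" where
  "f - g = Mps (\<lambda>m. coef f m - coef g m)"
definition times_mps :: "'a mps \<Rightarrow> 'a mps \<Rightarrow> 'a mps" where
  "f * g = Mps (\<lambda>m. \<Sum>p | p \<le> m. coef f p * coef g (m - p))"

lemma coef_zero [simp]: "coef (0 :: 'a mps) m = 0"
  by (simp add: zero_mps_def coef_Mps)

lemma coef_one: "coef (1 :: 'a mps) m = (if m = 0 then 1 else 0)"
proof -
  have "coef (1 :: 'a mps) = (\<lambda>m. if m = 0 then 1 else 0)"
    unfolding one_mps_def by (rule coef_Mps) (auto simp: zero_fun_def)
  then show ?thesis by simp
qed

lemma coef_add [simp]: "coef (f + g :: 'a mps) m = coef f m + coef g m"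
  by (simp add: plus_mps_def coef_Mps coef_infinite del: neq0_conv)

lemma coef_uminus [simp]: "coef (- f :: 'a mps) m = - coef f m"
  by (simp add: uminus_mps_def coef_Mps coef_infinite del: neq0_conv)

lemma coef_minus [simp]: "coef (f - g :: 'a mps) m = coef f m - coef g m"
  by (simp add: minus_mps_def coef_Mps coef_infinite del: neq0_conv)

lemma coef_mult: "coef (f * g :: 'a mps) m = (\<Sum>p | p \<le> m. coef f p * coef g (m - p))"
proof -
  have "(\<Sum>p | p \<le> m. coef f p * coef g (m - p)) = 0" if "infinite {i. m i \<noteq> 0}" for m
  proof (rule sum.neutral, safe)
    fix p assume "p \<le> m"
    then show "coef f p * coef g (m - p) = 0"
      using infinite_supp_split[OF that] coef_infinite by (metis mult_zero_left mult_zero_right)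
  qed
  then show ?thesis by (simp add: times_mps_def coef_Mps del: neq0_conv)
qed

instance
proof
  fix a b c :: "'a mps"
  show "a + b + c = a + (b + c)" "a + b = b + a" "0 + a = a" "- a + a = 0" "a - b = a + - b"
    by (auto intro!: mps_eqI simp: add_ac)
  show "(a + b) * c = a * c + b * c"
    by (rule mps_eqI) (simp add: coef_mult sum.distrib algebra_simps)
  show "(0 :: 'a mps) \<noteq> 1"
    using coef_zero[of 0] coef_one[of 0] by (metis zero_neq_one)
  show "a * b = b * a"
  proof (rule mps_eqI)
    fix m
    have "(\<Sum>p | p \<le> m. coef a p * coef b (m - p)) = (\<Sum>p | p \<le> m. coef b p * coef a (m - p))"
      by (rule sum.reindex_bij_witness[of _ "\<lambda>p. m - p" "\<lambda>p. m - p"])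
        (auto simp: le_fun_def fun_diff_def fun_eq_iff mult.commute)
    then show "coef (a * b) m = coef (b * a) m" by (simp add: coef_mult)
  qed
  show "1 * a = a"
  proof (rule mps_eqI)
    fix m
    show "coef (1 * a) m = coef a m"
    proof (cases "finite {i. m i \<noteq> 0}")
      case True
      have "coef (1 * a) m = (\<Sum>p | p \<le> m. if p = 0 then coef a m else 0)"
        by (auto simp: coef_mult coef_one intro!: sum.cong arg_cong[where f = "coef a"])
      also have "\<dots> = coef a m" using finite_below[OF True] by (simp add: le_fun_def)
      finally show ?thesis .
    qed (simp add: coef_infinite)
  qed
  show "a * b * c = a * (b * c)"
  proof (rule mps_eqI)
    fix m
    show "coef (a * b * c) m = coef (a * (b * c)) m"
    proof (cases "finite {i. m i \<noteq> 0}")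
      case True
      have fin: "finite {p. p \<le> q}" if "q \<le> m" for q
        by (rule finite_subset[OF _ finite_below[OF True]]) (use that in auto)
      have "coef (a * b * c) m =
          (\<Sum>(p, q) \<in> Sigma {p. p \<le> m} (\<lambda>p. {q. q \<le> p}). coef a q * coef b (p - q) * coef c (m - p))"
        by (simp add: coef_mult sum_distrib_right fin sum.Sigma[symmetric])
      also have "\<dots> = (\<Sum>(q, r) \<in> Sigma {q. q \<le> m} (\<lambda>q. {r. r \<le> m - q}).
          coef a q * (coef b r * coef c (m - q - r)))"
        by (rule sum.reindex_bij_witness[of _ "\<lambda>(q, r). (q + r, q)" "\<lambda>(p, q). (q, p - q)"])
          (auto simp: le_fun_def fun_diff_def fun_eq_iff mult.assoc
            intro!: diff_le_mono arg_cong2[where f = "(*)"] arg_cong[where f = "coef c"] intro: order_trans,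
            (metis Nat.le_diff_conv2 add.commute order_trans)+)
      also have "\<dots> = coef (a * (b * c)) m"
      proof -
        have "m - q \<le> m" for q by (simp add: le_fun_def)
        then show ?thesis
          by (subst sum.Sigma[symmetric]) (simp_all add: coef_mult sum_distrib_left fin)
      qed
      finally show ?thesis .
    qed (simp add: coef_infinite)
  qed
qed

end

section \<open>Monomials, constants and variables\<close>

definition mmon :: "'k::comm_ring_1 \<Rightarrow> (nat \<Rightarrow> nat) \<Rightarrow> 'k mps" where
  "mmon c m = Mps (\<lambda>p. if p = m \<and> finite {i. m i \<noteq> 0} then c else 0)"

definition const :: "'k::comm_ring_1 \<Rightarrow> 'k mps" where
  "const c = mmon c 0"

definition unit_idx :: "nat \<Rightarrow> nat \<Rightarrow> nat" where
  "unit_idx i = (\<lambda>j. if j = i then 1 else 0)"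

definition var :: "nat \<Rightarrow> 'k::comm_ring_1 mps" where
  "var i = mmon 1 (unit_idx i)"

lemma multi_indices_finite: "m \<in> multi_indices n \<Longrightarrow> finite {i. m i \<noteq> 0}"
  by (rule finite_subset[of _ "{..<n}"]) (auto simp: multi_indices_def intro: leI)

lemma coef_mmon: "finite {i. m i \<noteq> 0} \<Longrightarrow> coef (mmon c m) p = (if p = m then c else 0)"
  unfolding mmon_def by (subst coef_Mps) auto

lemma coef_mmon': "m \<in> multi_indices n \<Longrightarrow> coef (mmon c m) p = (if p = m then c else 0)"
  using coef_mmon multi_indices_finite by blast

lemma coef_mmon_mult:
  assumes "finite {i. m i \<noteq> 0}"
  shows "coef (mmon c m * f) p = (if m \<le> p then c * coef f (p - m) else 0)"
proof (cases "finite {i. p i \<noteq> 0}")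
  case True
  have "coef (mmon c m * f) p = (\<Sum>q | q \<le> p. if q = m then c * coef f (p - m) else 0)"
    unfolding coef_mult by (rule sum.cong) (simp_all add: coef_mmon[OF assms] del: neq0_conv)
  then show ?thesis using finite_below[OF True] by simp
next
  case False
  then have "infinite {i. (p - m) i \<noteq> 0}" if "m \<le> p"
    using infinite_supp_split[OF False that] assms by blast
  then show ?thesis using False by (simp add: coef_infinite del: neq0_conv)
qed

lemma coef_const: "coef (const c) p = (if p = 0 then c else 0)"
  unfolding const_def by (rule coef_mmon) simp

lemma coef_const_mult [simp]: "coef (const c * f) p = c * coef f p"
proof -
  have "p - 0 = p" by (auto simp: fun_eq_iff)
  then show ?thesis unfolding const_def by (subst coef_mmon_mult) (auto simp: le_fun_def)
qed

lemma mmon_mult: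
  assumes "finite {i. m i \<noteq> 0}" "finite {i. k i \<noteq> 0}"
  shows "mmon a m * mmon b k = mmon (a * b) (m + k)"
proof (rule mps_eqI)
  fix p
  have "finite {i. (m + k) i \<noteq> 0}"
    by (rule finite_subset[OF _ finite_UnI[OF assms]]) auto
  moreover have "m \<le> p \<and> p - m = k \<longleftrightarrow> p = m + k"
    using fun_le_add_diff[of m p] by auto
  ultimately show "coef (mmon a m * mmon b k) p = coef (mmon (a * b) (m + k)) p"
    by (auto simp: coef_mmon_mult[OF assms(1)] coef_mmon assms simp del: neq0_conv)
qed

lemma const_mult: "const a * const b = const (a * b)"
  unfolding const_def by (subst mmon_mult) auto

lemma const_add: "const a + const b = const (a + b)"
  by (rule mps_eqI) (simp add: coef_const)

lemma const_diff: "const a - const b = const (a - b)"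
  by (rule mps_eqI) (simp add: coef_const)

lemma const_uminus: "- const a = const (- a)"
  by (rule mps_eqI) (simp add: coef_const)

lemma const_0 [simp]: "const 0 = 0"
  by (rule mps_eqI) (simp add: coef_const)

lemma const_1 [simp]: "const 1 = 1"
  by (rule mps_eqI) (simp add: coef_const coef_one)

lemma coef_sum: "coef (\<Sum>i\<in>S. f i) m = (\<Sum>i\<in>S. coef (f i :: 'k::comm_ring_1 mps) m)"
  by (induction S rule: infinite_finite_induct) auto

lemma unit_idx_finite: "finite {j. unit_idx i j \<noteq> 0}"
  by (simp add: unit_idx_def)

context complete_nonarch_field
begin

subsection \<open>The absolute value of the base field\<close>

lemma v_zero [simp]: "v 0 = 0"
  by (simp add: zero_iff)

lemma v_one [simp]: "v 1 = 1"
  using mult[of 1 1] zero_iff[of 1] by simp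

lemma v_power: "v (x ^ n) = v x ^ n"
  by (induction n) (simp_all add: mult)

lemma v_minus [simp]: "v (- x) = v x"
proof -
  have "v (- 1) ^ 2 = 1" using v_power[of "- 1" 2] by simp
  then have "v (- 1) = 1" using nonneg[of "- 1"] by (simp add: power2_eq_1_iff)
  then show ?thesis using mult[of "- 1" x] by simp
qed

lemma v_diff_commute: "v (x - y) = v (y - x)"
  using v_minus[of "x - y"] by simp

lemma v_inverse: "v (inverse x) = inverse (v x)"
proof (cases "x = 0")
  case False
  then have "v x * v (inverse x) = 1" by (simp flip: mult)
  then show ?thesis by (metis inverse_unique)
qed simp

lemma v_divide: "v (x / y) = v x / v y"
  by (simp add: divide_inverse mult v_inverse)

lemma v_pos: "x \<noteq> 0 \<Longrightarrow> 0 < v x"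
  using nonneg[of x] zero_iff[of x] by simp

lemma v_sum_le:
  assumes "\<And>i. i \<in> S \<Longrightarrow> v (f i) \<le> B" "0 \<le> B"
  shows "v (\<Sum>i\<in>S. f i) \<le> B"
  using assms
proof (induction S rule: infinite_finite_induct)
  case (insert x S)
  have "v (f x + (\<Sum>i\<in>S. f i)) \<le> max (v (f x)) (v (\<Sum>i\<in>S. f i))" by (rule ultrametric)
  also have "\<dots> \<le> B" using insert by simp
  finally show ?case using insert by simp
qed auto

subsection \<open>Restricted power series and the Gauss norm\<close>

definition T :: "nat \<Rightarrow> 'k mps set" where
  "T n = {f. (\<forall>m. m \<notin> multi_indices n \<longrightarrow> coef f m = 0) \<and> (\<forall>e>0. finite {m. v (coef f m) \<ge> e})}"

definition nm :: "'k mps \<Rightarrow> real" where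
  "nm f = (SUP m. v (coef f m))"

lemma T_coef: "f \<in> T n \<Longrightarrow> m \<notin> multi_indices n \<Longrightarrow> coef f m = 0"
  by (simp add: T_def)

lemma T_fin: "f \<in> T n \<Longrightarrow> 0 < e \<Longrightarrow> finite {m. v (coef f m) \<ge> e}"
  by (simp add: T_def)

lemma T_mono: "n \<le> N \<Longrightarrow> f \<in> T n \<Longrightarrow> f \<in> T N"
  unfolding T_def multi_indices_def mem_Collect_eq by (meson order_trans)

text \<open>Only finitely many coefficients are at least as large as a given nonzero one, so the
  supremum is a maximum. Hence the Gauss norm is a value of \<open>v\<close>, which allows
  normalising a series by a scalar in \<open>T_scale\<close>.\<close>

lemma T_max:
  assumes "f \<in> T n"
  shows "\<exists>m. \<forall>p. v (coef f p) \<le> v (coef f m)"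
proof (cases "\<exists>m. coef f m \<noteq> 0")
  case True
  then obtain m0 where m0: "coef f m0 \<noteq> 0" by blast
  let ?S = "{m. v (coef f m) \<ge> v (coef f m0)}"
  have fin: "finite ?S" by (rule T_fin[OF assms]) (simp add: v_pos m0)
  have "m0 \<in> ?S" by simp
  then obtain m where m: "m \<in> ?S" "v (coef f m) = Max ((\<lambda>m. v (coef f m)) ` ?S)"
    using Max_in[of "(\<lambda>m. v (coef f m)) ` ?S"] fin by (metis (no_types, lifting) empty_iff finite_imageI imageE imageI)
  have "v (coef f p) \<le> v (coef f m)" for p
  proof (cases "p \<in> ?S")
    case True
    then show ?thesis unfolding m(2) using fin by (intro Max_ge) auto
  next
    case False
    then show ?thesis using m(1) by simp
  qed
  then show ?thesis by blast
qed (auto simp: nonneg)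

lemma nm_attained:
  assumes "f \<in> T n"
  obtains m where "nm f = v (coef f m)" "\<And>p. v (coef f p) \<le> nm f"
proof -
  obtain m where m: "\<And>p. v (coef f p) \<le> v (coef f m)" using T_max[OF assms] by blast
  have "nm f = v (coef f m)" unfolding nm_def by (rule cSup_eq_maximum) (auto simp: m)
  then show ?thesis using that m by metis
qed

lemma coef_le_nm: "f \<in> T n \<Longrightarrow> v (coef f p) \<le> nm f"
  by (metis nm_attained)

lemma nm_leI: "(\<And>p. v (coef f p) \<le> B) \<Longrightarrow> nm f \<le> B"
  unfolding nm_def by (rule cSUP_least) auto

lemma nm_nonneg: "f \<in> T n \<Longrightarrow> 0 \<le> nm f"
  by (metis nm_attained nonneg)

lemma nm_zero [simp]: "nm 0 = 0"
  by (simp add: nm_def)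

lemma nm_eq_0: "f \<in> T n \<Longrightarrow> nm f = 0 \<Longrightarrow> f = 0"
  by (rule mps_eqI) (metis coef_le_nm coef_zero nonneg order_antisym zero_iff)

lemma T_mmon [simp, intro]: "m \<in> multi_indices n \<Longrightarrow> mmon c m \<in> T n"
proof -
  assume m: "m \<in> multi_indices n"
  have "finite {p. v (coef (mmon c m) p) \<ge> e}" if "e > 0" for e
    by (rule finite_subset[of _ "{m}"]) (use that in \<open>auto simp: coef_mmon'[OF m] split: if_splits\<close>)
  then show ?thesis using m by (auto simp: T_def coef_mmon'[OF m])
qed

lemma zero_multi [simp]: "0 \<in> multi_indices n"
  by (simp add: multi_indices_def)

lemma unit_multi [simp]: "unit_idx i \<in> multi_indices n \<longleftrightarrow> i < n"
  by (auto simp: multi_indices_def unit_idx_def not_le[symmetric])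

lemma add_multi [simp]: "m + k \<in> multi_indices n \<longleftrightarrow> m \<in> multi_indices n \<and> k \<in> multi_indices n"
  by (auto simp: multi_indices_def)

lemma T_const [simp, intro]: "const c \<in> T n"
  by (simp add: const_def T_mmon)

lemma T_zero [simp, intro]: "0 \<in> T n"
  using T_const[of 0 n] by simp

lemma T_one [simp, intro]: "1 \<in> T n"
  using T_const[of 1 n] by simp

lemma T_var [simp, intro]: "i < n \<Longrightarrow> var i \<in> T n"
  by (simp add: var_def T_mmon)

lemma T_add [simp, intro]:
  assumes "f \<in> T n" "g \<in> T n" shows "f + g \<in> T n"
proof -
  have "finite {m. v (coef (f + g) m) \<ge> e}" if e: "e > 0" for e
  proof (rule finite_subset)
    show "{m. v (coef (f + g) m) \<ge> e} \<subseteq> {m. v (coef f m) \<ge> e} \<union> {m. v (coef g m) \<ge> e}"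
    proof
      fix m assume "m \<in> {m. v (coef (f + g) m) \<ge> e}"
      then have "e \<le> max (v (coef f m)) (v (coef g m))"
        using ultrametric[of "coef f m" "coef g m"] by simp
      then show "m \<in> {m. v (coef f m) \<ge> e} \<union> {m. v (coef g m) \<ge> e}" by (simp add: le_max_iff_disj)
    qed
  qed (use assms e T_fin in auto)
  then show ?thesis using assms by (auto simp: T_def)
qed

lemma T_uminus [simp, intro]: "f \<in> T n \<Longrightarrow> - f \<in> T n"
  by (simp add: T_def)

lemma T_diff [simp, intro]: "f \<in> T n \<Longrightarrow> g \<in> T n \<Longrightarrow> f - g \<in> T n"
  using T_add[of f n "- g"] by simp

lemma T_sum [intro]: "(\<And>i. i \<in> S \<Longrightarrow> f i \<in> T n) \<Longrightarrow> (\<Sum>i\<in>S. f i) \<in> T n"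
  by (induction S rule: infinite_finite_induct) auto

lemma nm_uminus [simp]: "nm (- f) = nm f"
  by (simp add: nm_def)

lemma nm_diff_commute: "nm (f - g) = nm (g - f)"
  by (simp add: nm_def v_diff_commute)

lemma nm_add: "f \<in> T n \<Longrightarrow> g \<in> T n \<Longrightarrow> nm (f + g) \<le> max (nm f) (nm g)"
  by (rule nm_leI) (simp, meson coef_le_nm max.mono order_trans ultrametric)

lemma nm_diff: "f \<in> T n \<Longrightarrow> g \<in> T n \<Longrightarrow> nm (f - g) \<le> max (nm f) (nm g)"
  using nm_add[of f n "- g"] by simp

lemma nm_add_le: "f \<in> T n \<Longrightarrow> g \<in> T n \<Longrightarrow> nm f \<le> B \<Longrightarrow> nm g \<le> B \<Longrightarrow> nm (f + g) \<le> B"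
  using nm_add[of f n g] by simp

lemma nm_diff_le: "f \<in> T n \<Longrightarrow> g \<in> T n \<Longrightarrow> nm f \<le> B \<Longrightarrow> nm g \<le> B \<Longrightarrow> nm (f - g) \<le> B"
  using nm_diff[of f n g] by simp

lemma nm_sum_le:
  assumes "\<And>i. i \<in> S \<Longrightarrow> f i \<in> T n" "\<And>i. i \<in> S \<Longrightarrow> nm (f i) \<le> B" "0 \<le> B"
  shows "nm (\<Sum>i\<in>S. f i) \<le> B"
  using assms
  by (induction S rule: infinite_finite_induct) (auto intro!: nm_add_le T_sum)

lemma coef_mult_le:
  assumes "f \<in> T n" "g \<in> T n"
  shows "v (coef (f * g) m) \<le> nm f * nm g"
  unfolding coef_mult
  by (rule v_sum_le) (use assms in \<open>auto simp: mult intro!: mult_mono coef_le_nm nonneg nm_nonneg mult_nonneg_nonneg\<close>)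

lemma nm_mult: "f \<in> T n \<Longrightarrow> g \<in> T n \<Longrightarrow> nm (f * g) \<le> nm f * nm g"
  by (rule nm_leI) (rule coef_mult_le)

lemma T_mult [simp, intro]:
  assumes "f \<in> T n" "g \<in> T n" shows "f * g \<in> T n"
proof -
  have "finite {m. v (coef (f * g) m) \<ge> e}" if e: "e > 0" for e
  proof (rule finite_subset)
    \<comment> \<open>By the ultrametric inequality a coefficient of the product of size at least
      \<open>e\<close> has a summand of that size, and then neither factor of the summand can be
      small. Adding 1 keeps the denominators positive.\<close>
    let ?F = "{p. v (coef f p) \<ge> e / (nm g + 1)}" and ?G = "{q. v (coef g q) \<ge> e / (nm f + 1)}"
    have pos: "0 < nm f + 1" "0 < nm g + 1" using assms nm_nonneg by (smt (verit))+
    show "{m. v (coef (f * g) m) \<ge> e} \<subseteq> (\<lambda>(p, q). p + q) ` (?F \<times> ?G)"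
    proof
      fix m assume "m \<in> {m. v (coef (f * g) m) \<ge> e}"
      then have m: "v (coef (f * g) m) \<ge> e" by simp
      have "\<exists>p\<le>m. v (coef f p) * v (coef g (m - p)) \<ge> e"
      proof (rule ccontr)
        assume "\<not> ?thesis"
        then have less: "v (coef f p * coef g (m - p)) < e" if "p \<le> m" for p
          using that by (auto simp: mult not_le)
        have fin: "finite {p. p \<le> m}"
          using m e coef_infinite finite_below by (metis v_zero not_le)
        let ?B = "Max (insert 0 ((\<lambda>p. v (coef f p * coef g (m - p))) ` {p. p \<le> m}))"
        have "v (coef (f * g) m) \<le> ?B"
          unfolding coef_mult by (rule v_sum_le) (use fin in \<open>auto intro!: Max_ge\<close>)
        also have "?B < e" using fin less e by (subst Max_less_iff) auto
        finally show False using m by simp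
      qed
      then obtain p where p: "p \<le> m" "v (coef f p) * v (coef g (m - p)) \<ge> e" by blast
      have "e \<le> v (coef f p) * (nm g + 1)"
        using p(2) coef_le_nm[OF assms(2), of "m - p"] nonneg[of "coef f p"]
          mult_left_mono[of "v (coef g (m - p))" "nm g + 1" "v (coef f p)"] by linarith
      then have "p \<in> ?F" using pos by (simp add: divide_le_eq)
      moreover have "e \<le> (nm f + 1) * v (coef g (m - p))"
        using p(2) coef_le_nm[OF assms(1), of p] nonneg[of "coef g (m - p)"]
          mult_right_mono[of "v (coef f p)" "nm f + 1" "v (coef g (m - p))"] by linarith
      then have "m - p \<in> ?G" using pos by (simp add: divide_le_eq mult.commute)
      ultimately show "m \<in> (\<lambda>(p, q). p + q) ` (?F \<times> ?G)"
        using fun_le_add_diff[OF p(1)] by (force intro!: image_eqI[of _ _ "(p, m - p)"])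
    qed
    show "finite ((\<lambda>(p, q). p + q) ` (?F \<times> ?G))"
      using assms e pos by (intro finite_imageI finite_cartesian_product T_fin) auto
  qed
  moreover have "coef (f * g) m = 0" if "m \<notin> multi_indices n" for m
    unfolding coef_mult
  proof (rule sum.neutral, safe)
    fix p assume "p \<le> m"
    then have "p \<notin> multi_indices n \<or> m - p \<notin> multi_indices n"
      using that add_multi[of p "m - p" n] fun_le_add_diff by metis
    then show "coef f p * coef g (m - p) = 0" using assms T_coef by fastforce
  qed
  ultimately show ?thesis by (simp add: T_def)
qed

lemma T_power [simp, intro]: "f \<in> T n \<Longrightarrow> f ^ k \<in> T n"
  by (induction k) auto

lemma T_prod [intro]: "(\<And>i. i \<in> S \<Longrightarrow> f i \<in> T n) \<Longrightarrow> (\<Prod>i\<in>S. f i) \<in> T n"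
  by (induction S rule: infinite_finite_induct) auto

lemma nm_const_mult: "f \<in> T n \<Longrightarrow> nm (const c * f) = v c * nm f"
proof -
  assume f: "f \<in> T n"
  obtain m where m: "nm f = v (coef f m)" using nm_attained[OF f] by blast
  show ?thesis
  proof (rule order_antisym)
    show "nm (const c * f) \<le> v c * nm f"
      by (rule nm_leI) (simp add: mult mult_left_mono nonneg coef_le_nm[OF f])
    have "v c * nm f = v (coef (const c * f) m)" using m by (simp add: mult)
    also have "\<dots> \<le> nm (const c * f)" by (rule coef_le_nm[of _ n]) (use f in auto)
    finally show "v c * nm f \<le> nm (const c * f)" .
  qed
qed

lemma nm_mmon: "m \<in> multi_indices n \<Longrightarrow> nm (mmon c m) = v c"
  unfolding nm_def by (rule cSup_eq_maximum) (auto simp: coef_mmon' nonneg intro!: image_eqI[of _ _ m])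

lemma nm_const: "nm (const c) = v c"
  unfolding const_def by (rule nm_mmon[of _ 0]) simp

lemma nm_one [simp]: "nm 1 = 1"
  using nm_const[of 1] by simp

lemma nm_var [simp]: "nm (var i) = 1"
  unfolding var_def by (subst nm_mmon[of _ "Suc i"]) auto

lemma nm_mult_le:
  "f \<in> T n \<Longrightarrow> g \<in> T n \<Longrightarrow> nm f \<le> a \<Longrightarrow> nm g \<le> b \<Longrightarrow> nm (f * g) \<le> a * b"
  by (rule order_trans[OF nm_mult]) (auto intro!: mult_mono nm_nonneg intro: order_trans[OF nm_nonneg])

lemma nm_power_le: "f \<in> T n \<Longrightarrow> nm (f ^ k) \<le> nm f ^ k"
  by (induction k) (auto intro!: nm_mult_le)

lemma nm_prod_le_1:
  "(\<And>i. i \<in> S \<Longrightarrow> f i \<in> T n) \<Longrightarrow> (\<And>i. i \<in> S \<Longrightarrow> nm (f i) \<le> 1) \<Longrightarrow> nm (\<Prod>i\<in>S. f i) \<le> 1"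
  by (induction S rule: infinite_finite_induct) (auto intro!: nm_mult_le[of _ n _ 1 1, simplified])

lemma T_scale:
  assumes "f \<in> T n" "f \<noteq> 0"
  obtains c where "c \<noteq> 0" "v c = nm f" "nm (const (inverse c) * f) = 1"
proof -
  obtain m where m: "nm f = v (coef f m)" using nm_attained[OF assms(1)] by blast
  have "nm f \<noteq> 0" using nm_eq_0 assms by blast
  then have "coef f m \<noteq> 0" using m zero_iff by simp
  moreover have "nm (const (inverse (coef f m)) * f) = 1"
    using assms m \<open>nm f \<noteq> 0\<close> by (simp add: nm_const_mult v_inverse)
  ultimately show ?thesis using that m by metis
qed

section \<open>Completeness, geometric series and units\<close>

lemma T_complete:
  fixes F :: "nat \<Rightarrow> 'k mps"
  assumes F: "\<And>k. F k \<in> T n"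
    and cauchy: "\<And>e. e > 0 \<Longrightarrow> \<exists>K. \<forall>i\<ge>K. \<forall>j\<ge>K. nm (F i - F j) \<le> e"
  obtains G where "G \<in> T n" "\<And>e. e > 0 \<Longrightarrow> \<exists>K. \<forall>i\<ge>K. nm (F i - G) \<le> e"
proof -
  have "\<exists>L. (\<lambda>i. v (coef (F i) m - L)) \<longlonglongrightarrow> 0" for m
  proof (rule complete, intro allI impI)
    fix e :: real assume "e > 0"
    then obtain K where K: "\<forall>i\<ge>K. \<forall>j\<ge>K. nm (F i - F j) \<le> e / 2" using cauchy[of "e / 2"] by auto
    have "v (coef (F i) m - coef (F j) m) < e" if "i \<ge> K" "j \<ge> K" for i j
      using coef_le_nm[OF T_diff[OF F F], of i j m] K that \<open>e > 0\<close> by fastforce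
    then show "\<exists>N. \<forall>i\<ge>N. \<forall>j\<ge>N. v (coef (F i) m - coef (F j) m) < e" by blast
  qed
  then obtain L where L: "\<And>m. (\<lambda>i. v (coef (F i) m - L m)) \<longlonglongrightarrow> 0" by metis
  have L0: "L m = 0" if "\<And>i. coef (F i) m = 0" for m
  proof -
    have "(\<lambda>i. v (L m)) \<longlonglongrightarrow> 0" using L[of m] that by simp
    then show ?thesis by (simp add: LIMSEQ_const_iff zero_iff)
  qed
  define G where "G = Mps L"
  have G: "coef G = L" unfolding G_def by (rule coef_Mps) (rule L0, rule coef_infinite)
  have lim: "\<exists>K. \<forall>i\<ge>K. \<forall>m. v (coef (F i) m - L m) \<le> e" if e: "e > 0" for e
  proof -
    obtain K where K: "\<forall>i\<ge>K. \<forall>j\<ge>K. nm (F i - F j) \<le> e" using cauchy[OF e] by auto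
    have "v (coef (F i) m - L m) \<le> e" if i: "i \<ge> K" for i m
    proof -
      obtain K' where K': "\<forall>j\<ge>K'. v (coef (F j) m - L m) < e"
        using LIMSEQ_D[OF L[of m] e] nonneg by auto
      let ?j = "max K K'"
      have "v ((coef (F i) m - coef (F ?j) m) + (coef (F ?j) m - L m))
          \<le> max (v (coef (F i) m - coef (F ?j) m)) (v (coef (F ?j) m - L m))" by (rule ultrametric)
      also have "\<dots> \<le> e"
        using coef_le_nm[OF T_diff[OF F F], of i ?j m] K i K' by (smt (verit, best) coef_minus max.cobounded1 max.cobounded2)
      finally show ?thesis by simp
    qed
    then show ?thesis by blast
  qed
  have "finite {m. v (coef G m) \<ge> e}" if e: "e > 0" for e
  proof -
    obtain K where K: "\<forall>i\<ge>K. \<forall>m. v (coef (F i) m - L m) \<le> e / 2" using lim[of "e / 2"] e by auto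
    have "v (coef (F K) m) \<ge> e" if "v (L m) \<ge> e" for m
    proof -
      have "v (L m) \<le> max (v (coef (F K) m)) (v (L m - coef (F K) m))"
        using ultrametric[of "coef (F K) m" "L m - coef (F K) m"] by simp
      moreover have "v (L m - coef (F K) m) \<le> e / 2" using K v_diff_commute[of "L m"] by simp
      ultimately show ?thesis using that e by (simp add: le_max_iff_disj)
    qed
    then have "{m. v (coef G m) \<ge> e} \<subseteq> {m. v (coef (F K) m) \<ge> e}" using G by auto
    then show ?thesis using T_fin[OF F e] finite_subset by blast
  qed
  moreover have "coef G m = 0" if "m \<notin> multi_indices n" for m
    using L0[of m] T_coef[OF F that] G by simp
  ultimately have "G \<in> T n" by (simp add: T_def)
  moreover have "\<exists>K. \<forall>i\<ge>K. nm (F i - G) \<le> e" if e: "e > 0" for e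
  proof -
    obtain K where "\<forall>i\<ge>K. \<forall>m. v (coef (F i) m - L m) \<le> e" using lim[OF e] by blast
    then show ?thesis using G by (intro exI[of _ K]) (auto intro!: nm_leI)
  qed
  ultimately show ?thesis using that by blast
qed

text \<open>In the ultrametric setting a tail is no larger than the bound on its first term, so the
  error estimate carries no factor \<open>1 / (1 - e)\<close>.\<close>

lemma T_geometric_series:
  fixes G :: "nat \<Rightarrow> 'k mps"
  assumes G: "\<And>k. G k \<in> T n" and le: "\<And>k. nm (G k) \<le> C * e ^ k" and e: "0 \<le> e" "e < 1"
  obtains F where "F \<in> T n" "\<And>K. nm ((\<Sum>k<K. G k) - F) \<le> C * e ^ K"
proof -
  have C: "0 \<le> C" using le[of 0] nm_nonneg[OF G[of 0]] by simp
  have tail: "nm ((\<Sum>k<i. G k) - (\<Sum>k<j. G k)) \<le> C * e ^ K" if "i \<ge> K" "j \<ge> K" for i j K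
  proof -
    have part: "nm ((\<Sum>k<i. G k) - (\<Sum>k<K. G k)) \<le> C * e ^ K" if "i \<ge> K" for i
    proof -
      have "(\<Sum>k<i. G k) - (\<Sum>k<K. G k) = (\<Sum>k\<in>{K..<i}. G k)"
        using that by (metis sum_diff_nat_ivl lessThan_atLeast0 le0)
      also have "nm \<dots> \<le> C * e ^ K"
      proof (rule nm_sum_le)
        fix k assume "k \<in> {K..<i}"
        then have "C * e ^ k \<le> C * e ^ K" using e C by (intro mult_left_mono power_decreasing) auto
        then show "nm (G k) \<le> C * e ^ K" using le[of k] by simp
      qed (use G e C in auto)
      finally show ?thesis .
    qed
    have "(\<Sum>k<i. G k) - (\<Sum>k<j. G k) = ((\<Sum>k<i. G k) - (\<Sum>k<K. G k)) - ((\<Sum>k<j. G k) - (\<Sum>k<K. G k))"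
      by simp
    also have "nm \<dots> \<le> C * e ^ K"
      by (rule nm_diff_le[of _ n]) (use part that G in \<open>auto intro!: T_sum\<close>)
    finally show ?thesis .
  qed
  have small: "\<exists>K. C * e ^ K \<le> d" if "d > 0" for d
  proof -
    have "(\<lambda>K. C * e ^ K) \<longlonglongrightarrow> C * 0"
      by (intro tendsto_mult tendsto_const LIMSEQ_power_zero) (use e in auto)
    then have "eventually (\<lambda>K. C * e ^ K < d) sequentially" using that by (simp add: order_tendstoD)
    then obtain K where "\<forall>k\<ge>K. C * e ^ k < d" unfolding eventually_sequentially by blast
    then show ?thesis by (intro exI[of _ K]) (simp add: less_imp_le)
  qed
  have "\<exists>K. \<forall>i\<ge>K. \<forall>j\<ge>K. nm ((\<Sum>k<i. G k) - (\<Sum>k<j. G k)) \<le> d" if "d > 0" for d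
    using small[OF that] tail by (meson order_trans)
  then obtain F where F: "F \<in> T n" "\<And>d. d > 0 \<Longrightarrow> \<exists>K. \<forall>i\<ge>K. nm ((\<Sum>k<i. G k) - F) \<le> d"
    using T_complete[of "\<lambda>i. \<Sum>k<i. G k" n] G by (metis (no_types, lifting) T_sum)
  have "nm ((\<Sum>k<K. G k) - F) \<le> C * e ^ K" for K
  proof (rule field_le_epsilon)
    fix d :: real assume d: "d > 0"
    obtain K' where K': "\<forall>i\<ge>K'. nm ((\<Sum>k<i. G k) - F) \<le> d" using F(2)[OF d] by blast
    let ?i = "max K K'"
    have "(\<Sum>k<K. G k) - F = ((\<Sum>k<K. G k) - (\<Sum>k<?i. G k)) + ((\<Sum>k<?i. G k) - F)" by simp
    also have "nm \<dots> \<le> C * e ^ K + d"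
    proof (rule nm_add_le)
      show "nm ((\<Sum>k<K. G k) - (\<Sum>k<?i. G k)) \<le> C * e ^ K + d" using tail[of K K ?i] d by simp
      show "nm ((\<Sum>k<?i. G k) - F) \<le> C * e ^ K + d"
        using K' C e by (smt (verit) max.cobounded2 mult_nonneg_nonneg zero_le_power)
    qed (use G F(1) in \<open>auto intro!: T_sum T_diff\<close>)
    finally show "nm ((\<Sum>k<K. G k) - F) \<le> C * e ^ K + d" .
  qed
  then show ?thesis using that F(1) by blast
qed

lemma eq_if_nm_small:
  assumes "f \<in> T n" "g \<in> T n" "\<And>d. d > 0 \<Longrightarrow> nm (f - g) \<le> d"
  shows "f = g"
proof -
  have "nm (f - g) \<le> 0" by (rule field_le_epsilon) (use assms(3) in auto)
  then show ?thesis using nm_eq_0[of "f - g" n] nm_nonneg[of "f - g" n] assms by fastforce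
qed

text \<open>The Neumann series of \<open>u\<close> is the inverse. This makes the units open, from
  which \<open>max_ideal_closed\<close> follows.\<close>

lemma one_minus_invertible:
  assumes u: "u \<in> T n" "nm u < 1"
  obtains w where "w \<in> T n" "(1 - u) * w = 1"
proof -
  have "nm (u ^ k) \<le> 1 * nm u ^ k" for k using nm_power_le[OF u(1)] by simp
  then obtain F where F: "F \<in> T n" "\<And>K. nm ((\<Sum>k<K. u ^ k) - F) \<le> 1 * nm u ^ K"
    using T_geometric_series[of "\<lambda>k. u ^ k" n 1 "nm u"] u nm_nonneg by blast
  have "(1 - u) * F = 1"
  proof (rule eq_if_nm_small[of _ n])
    fix d :: real assume d: "d > 0"
    have "(\<lambda>K. nm u ^ K) \<longlonglongrightarrow> 0" by (rule LIMSEQ_power_zero) (use u nm_nonneg[OF u(1)] in auto)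
    then obtain K where K: "nm u ^ K < d" using d by (metis eventually_sequentially order_refl order_tendstoD(2))
    have geo: "(1 - u) * (\<Sum>k<K. u ^ k) = 1 - u ^ K" by (metis one_diff_power_eq)
    have "(1 - u) * F - 1 = - ((1 - u) * ((\<Sum>k<K. u ^ k) - F)) - u ^ K"
      unfolding right_diff_distrib geo by simp
    also have "nm \<dots> \<le> d"
    proof (rule nm_diff_le)
      have "nm (1 - u) \<le> 1" using nm_diff_le[of 1 n u 1] u by simp
      then have "nm ((1 - u) * ((\<Sum>k<K. u ^ k) - F)) \<le> 1 * d"
        using u F K by (intro nm_mult_le[of _ n]) (auto intro!: T_sum intro: order_trans[OF F(2)])
      then show "nm (- ((1 - u) * ((\<Sum>k<K. u ^ k) - F))) \<le> d" by simp
      show "nm (u ^ K) \<le> d" using nm_power_le[OF u(1), of K] K by simp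
    qed (use u F in \<open>auto intro!: T_sum T_diff\<close>)
    finally show "nm ((1 - u) * F - 1) \<le> d" .
  qed (use u F in auto)
  then show ?thesis using that F by blast
qed

section \<open>Evaluation of power series\<close>

definition exps :: "nat \<Rightarrow> nat \<Rightarrow> nat \<Rightarrow> (nat \<Rightarrow> nat) set" where
  "exps n N D = {e. \<forall>i. (i \<in> {n..<N} \<longrightarrow> e i \<in> {..D}) \<and> (i \<notin> {n..<N} \<longrightarrow> e i = 0)}"

text \<open>A series in \<open>N\<close> variables is regarded as a series in the variables from
  \<open>n\<close> on with coefficients in \<open>T n\<close>; this is its coefficient at the
  exponent \<open>e\<close>.\<close>

definition slice :: "nat \<Rightarrow> 'k mps \<Rightarrow> (nat \<Rightarrow> nat) \<Rightarrow> 'k mps" where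
  "slice n f e = Mps (\<lambda>m. if m \<in> multi_indices n then coef f (m + e) else 0)"

definition pw :: "nat \<Rightarrow> nat \<Rightarrow> (nat \<Rightarrow> 'k mps) \<Rightarrow> (nat \<Rightarrow> nat) \<Rightarrow> 'k mps" where
  "pw n N y e = (\<Prod>i\<in>{n..<N}. y i ^ e i)"

text \<open>Substitution of \<open>y i\<close> for the variables \<open>n \<le> i < N\<close>, ignoring all terms whose degree in
  one of these variables exceeds \<open>D\<close>; hence multiplicative only on series of bounded degree.\<close>

definition theta :: "nat \<Rightarrow> nat \<Rightarrow> (nat \<Rightarrow> 'k mps) \<Rightarrow> nat \<Rightarrow> 'k mps \<Rightarrow> 'k mps" where
  "theta n N y D f = (\<Sum>e\<in>exps n N D. slice n f e * pw n N y e)"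

definition degb :: "nat \<Rightarrow> nat \<Rightarrow> nat \<Rightarrow> 'k mps set" where
  "degb n N D = {f. \<forall>m. coef f m \<noteq> 0 \<longrightarrow> (\<forall>i\<in>{n..<N}. m i \<le> D)}"

definition trunc :: "nat \<Rightarrow> nat \<Rightarrow> nat \<Rightarrow> 'k mps \<Rightarrow> 'k mps" where
  "trunc n N D f = Mps (\<lambda>m. if \<forall>i\<in>{n..<N}. m i \<le> D then coef f m else 0)"

lemma finite_exps [simp]: "finite (exps n N D)"
  unfolding exps_def by (intro finite_set_of_finite_funs) auto

lemma exps_out: "e \<in> exps n N D \<Longrightarrow> i \<notin> {n..<N} \<Longrightarrow> e i = 0"
  by (simp add: exps_def)

lemma exps_supp:
  assumes "e \<in> exps n N D" shows "finite {i. e i \<noteq> 0}"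
proof (rule finite_subset)
  show "{i. e i \<noteq> 0} \<subseteq> {n..<N}"
  proof (rule subsetI, rule ccontr)
    fix i assume "i \<in> {i. e i \<noteq> 0}" "i \<notin> {n..<N}"
    then show False using exps_out[OF assms, of i] by simp
  qed
qed simp

lemma zero_exps [simp]: "0 \<in> exps n N D"
  by (simp add: exps_def)

lemma exps_add: "e \<in> exps n N D \<Longrightarrow> k \<in> exps n N D' \<Longrightarrow> e + k \<in> exps n N (D + D')"
  by (force simp: exps_def intro: add_mono)

lemma unit_exps: "n \<le> i \<Longrightarrow> i < N \<Longrightarrow> 1 \<le> D \<Longrightarrow> unit_idx i \<in> exps n N D"
  by (simp add: exps_def unit_idx_def)

lemma coef_slice: "coef (slice n f e) m = (if m \<in> multi_indices n then coef f (m + e) else 0)"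
  unfolding slice_def by (subst coef_Mps) (use multi_indices_finite in auto)

lemma coef_trunc: "coef (trunc n N D f) m = (if \<forall>i\<in>{n..<N}. m i \<le> D then coef f m else 0)"
  unfolding trunc_def by (subst coef_Mps) (auto simp: coef_infinite)

lemma slice_add: "slice n (f + g) e = slice n f e + slice n g e"
  by (rule mps_eqI) (simp add: coef_slice)

lemma slice_diff: "slice n (f - g) e = slice n f e - slice n g e"
  by (rule mps_eqI) (simp add: coef_slice)

lemma slice_zero [simp]: "slice n 0 e = 0"
  by (rule mps_eqI) (simp add: coef_slice)

lemma slice_T:
  assumes "f \<in> T N" shows "slice n f e \<in> T n"
proof -
  have "finite {m. v (coef (slice n f e) m) \<ge> d}" if d: "d > 0" for d
  proof (rule finite_subset)
    show "{m. v (coef (slice n f e) m) \<ge> d} \<subseteq> (\<lambda>m. m + e) -` {m. v (coef f m) \<ge> d}"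
      using d by (auto simp: coef_slice split: if_splits)
    show "finite ((\<lambda>m. m + e) -` {m. v (coef f m) \<ge> d})"
      by (rule finite_vimageI[OF T_fin[OF assms d]]) (simp add: inj_on_def)
  qed
  then show ?thesis by (simp add: T_def coef_slice)
qed

lemma nm_slice: "f \<in> T N \<Longrightarrow> nm (slice n f e) \<le> nm f"
  by (rule nm_leI) (simp add: coef_slice coef_le_nm nm_nonneg)

lemma trunc_T [simp, intro]:
  assumes "f \<in> T M" shows "trunc n N D f \<in> T M"
proof -
  have "finite {m. v (coef (trunc n N D f) m) \<ge> d}" if d: "d > 0" for d
    by (rule finite_subset[OF _ T_fin[OF assms d]]) (use d in \<open>auto simp: coef_trunc split: if_splits\<close>)
  then show ?thesis using assms by (simp add: T_def coef_trunc)
qed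

lemma nm_trunc: "f \<in> T M \<Longrightarrow> nm (trunc n N D f) \<le> nm f"
  by (rule nm_leI) (simp add: coef_trunc coef_le_nm nm_nonneg)

lemma trunc_degb: "trunc n N D f \<in> degb n N D"
  by (simp add: degb_def coef_trunc)

lemma degb_mono: "D \<le> D' \<Longrightarrow> f \<in> degb n N D \<Longrightarrow> f \<in> degb n N D'"
  by (force simp: degb_def)

lemma trunc_close:
  assumes "f \<in> T M" "d > 0"
  obtains K where "\<And>D. D \<ge> K \<Longrightarrow> nm (f - trunc n N D f) \<le> d"
proof -
  let ?S = "{m. v (coef f m) \<ge> d}"
  let ?K = "Max (insert 0 ((\<lambda>(m, i). m i) ` (?S \<times> {n..<N})))"
  have fin: "finite ?S" by (rule T_fin) fact+
  have "nm (f - trunc n N D f) \<le> d" if D: "D \<ge> ?K" for D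
  proof (rule nm_leI)
    fix m
    show "v (coef (f - trunc n N D f) m) \<le> d"
    proof (cases "m \<in> ?S")
      case True
      have "m i \<le> D" if "i \<in> {n..<N}" for i
      proof -
        have "m i \<le> ?K" using True that fin by (intro Max_ge) (auto intro!: image_eqI[of _ _ "(m, i)"])
        then show ?thesis using D by simp
      qed
      then show ?thesis using assms by (simp add: coef_trunc)
    next
      case False
      then show ?thesis using assms by (simp add: coef_trunc)
    qed
  qed
  then show ?thesis using that by blast
qed

lemma slice_trunc: "e \<in> exps n N D \<Longrightarrow> slice n (trunc n N D f) e = slice n f e"
  by (rule mps_eqI) (force simp: coef_slice coef_trunc exps_def multi_indices_def)

lemma theta_trunc: "theta n N y D (trunc n N D f) = theta n N y D f"
  by (simp add: theta_def slice_trunc)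

lemma theta_add: "theta n N y D (f + g) = theta n N y D f + theta n N y D g"
  by (simp add: theta_def slice_add distrib_right sum.distrib)

lemma theta_diff: "theta n N y D (f - g) = theta n N y D f - theta n N y D g"
  by (simp add: theta_def slice_diff left_diff_distrib sum_subtractf)

lemma theta_zero [simp]: "theta n N y D 0 = 0"
  by (simp add: theta_def)

lemma theta_sum: "theta n N y D (\<Sum>i\<in>S. f i) = (\<Sum>i\<in>S. theta n N y D (f i))"
  by (induction S rule: infinite_finite_induct) (auto simp: theta_add)

text \<open>In the Cauchy product for the index \<open>m + e\<close> only the terms with
  \<open>p \<le> m\<close> survive: \<open>c\<close> lives on the first \<open>n\<close> variables,
  where \<open>e\<close> vanishes.\<close>

lemma slice_mult_base:
  assumes c: "c \<in> T n" and e: "e \<in> exps n N D"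
  shows "slice n (c * f) e = c * slice n f e"
proof (rule mps_eqI)
  fix m
  show "coef (slice n (c * f) e) m = coef (c * slice n f e) m"
  proof (cases "m \<in> multi_indices n")
    case True
    have "finite {i. (m + e) i \<noteq> 0}"
      by (rule finite_subset[OF _ finite_UnI[OF multi_indices_finite[OF True] exps_supp[OF e]]]) auto
    then have fin: "finite {p. p \<le> m + e}" by (rule finite_below)
    have "coef (c * f) (m + e) = (\<Sum>p | p \<le> m. coef c p * coef f (m + e - p))"
      unfolding coef_mult
    proof (rule sum.mono_neutral_right[OF fin])
      show "{p. p \<le> m} \<subseteq> {p. p \<le> m + e}"
        using order_trans[OF _ fun_le_add(1)] by blast
      show "\<forall>p\<in>{p. p \<le> m + e} - {p. p \<le> m}. coef c p * coef f (m + e - p) = 0"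
      proof
        fix p assume p: "p \<in> {p. p \<le> m + e} - {p. p \<le> m}"
        have "p \<notin> multi_indices n"
        proof
          assume pn: "p \<in> multi_indices n"
          have "p i \<le> m i" for i
          proof (cases "i < n")
            case True
            then have "e i = 0" by (intro exps_out[OF e]) auto
            moreover have "p i \<le> (m + e) i" using p by (simp only: le_fun_def) blast
            ultimately show ?thesis by simp
          qed (use pn in \<open>simp add: multi_indices_def\<close>)
          then show False using p by (simp add: le_fun_def)
        qed
        then show "coef c p * coef f (m + e - p) = 0" using T_coef[OF c] by simp
      qed
    qed
    also have "\<dots> = (\<Sum>p | p \<le> m. coef c p * coef (slice n f e) (m - p))"
    proof (rule sum.cong[OF refl])
      fix p assume "p \<in> {p. p \<le> m}"
      then have "p i \<le> m i" for i by (simp add: le_fun_def)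
      then have "m + e - p = (m - p) + e" "m - p \<in> multi_indices n"
        using True by (simp_all add: fun_eq_iff multi_indices_def)
      then show "coef c p * coef f (m + e - p) = coef c p * coef (slice n f e) (m - p)"
        by (simp add: coef_slice)
    qed
    finally show ?thesis using True by (simp add: coef_slice coef_mult)
  next
    case False
    have "(\<Sum>p | p \<le> m. coef c p * coef (slice n f e) (m - p)) = 0"
    proof (rule sum.neutral, rule ballI)
      fix p assume "p \<in> {p. p \<le> m}"
      then have "p + (m - p) = m" by (simp add: fun_le_add_diff)
      then have "p \<notin> multi_indices n \<or> m - p \<notin> multi_indices n"
        using False add_multi[of p "m - p" n] by metis
      then show "coef c p * coef (slice n f e) (m - p) = 0" using T_coef[OF c] by (auto simp: coef_slice)
    qed
    then show ?thesis using False by (simp add: coef_slice coef_mult)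
  qed
qed

lemma theta_mult_base: "c \<in> T n \<Longrightarrow> theta n N y D (c * f) = c * theta n N y D f"
  by (simp add: theta_def slice_mult_base sum_distrib_left mult.assoc)

lemma slice_one: "e \<in> exps n N D \<Longrightarrow> slice n 1 e = (if e = 0 then 1 else 0)"
  by (rule mps_eqI) (auto simp: coef_slice coef_one fun_eq_iff multi_indices_def)

lemma theta_one [simp]: "theta n N y D 1 = 1"
proof -
  have "theta n N y D 1 = (\<Sum>e\<in>exps n N D. if e = 0 then pw n N y 0 else 0)"
    unfolding theta_def by (rule sum.cong) (auto simp: slice_one)
  then show ?thesis by (simp add: pw_def)
qed

lemma theta_base: "c \<in> T n \<Longrightarrow> theta n N y D c = c"
  using theta_mult_base[of c n N y D 1] by simp

lemma slice_mult_mmon: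
  assumes e: "e \<in> exps n N D" and k: "k \<in> exps n N D'"
  shows "slice n (f * mmon 1 k) e = (if k \<le> e then slice n f (e - k) else 0)"
proof (rule mps_eqI)
  fix m
  have "k \<le> m + e \<longleftrightarrow> k \<le> e" if m: "m \<in> multi_indices n"
  proof
    assume L: "k \<le> m + e"
    have "k i \<le> e i" for i
    proof (cases "i \<in> {n..<N}")
      case True
      then have "m i = 0" using m by (simp add: multi_indices_def)
      moreover have "k i \<le> (m + e) i" using L by (simp only: le_fun_def)
      ultimately show ?thesis by simp
    qed (simp add: exps_out[OF k])
    then show "k \<le> e" by (simp add: le_fun_def)
  qed (rule order_trans[OF _ fun_le_add(2)])
  moreover have "m + e - k = m + (e - k)" if "k \<le> e"
    using that by (simp add: fun_eq_iff le_fun_def)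
  ultimately show "coef (slice n (f * mmon 1 k) e) m = coef (if k \<le> e then slice n f (e - k) else 0) m"
    using coef_mmon_mult[OF exps_supp[OF k], of 1 f] by (auto simp: coef_slice mult.commute)
qed

lemma slice_degb:
  assumes "f \<in> degb n N D" "e \<in> exps n N D'" "e \<notin> exps n N D"
  shows "slice n f e = 0"
proof (rule mps_eqI)
  fix m
  obtain i where i: "i \<in> {n..<N}" "e i > D" using assms(2,3) unfolding exps_def by fastforce
  then have "(m + e) i > D" by simp
  then have "coef f (m + e) = 0" using assms(1) i unfolding degb_def by (metis (mono_tags, lifting) mem_Collect_eq not_le)
  then show "coef (slice n f e) m = coef 0 m" by (simp add: coef_slice)
qed

lemma pw_add: "pw n N y (e + k) = pw n N y e * pw n N y k"
  by (simp add: pw_def power_add prod.distrib)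

lemma pw_unit: "n \<le> i \<Longrightarrow> i < N \<Longrightarrow> pw n N y (unit_idx i) = y i"
proof -
  assume "n \<le> i" "i < N"
  moreover have "pw n N y (unit_idx i) = (\<Prod>j\<in>{n..<N}. if j = i then y i else 1)"
    unfolding pw_def unit_idx_def by (rule prod.cong) auto
  ultimately show ?thesis by simp
qed

text \<open>Multiplication by a monomial shifts all exponents by \<open>k\<close>. The bound
  \<open>D + D'\<close> leaves room for every shifted exponent, and an exponent that does not arise
  by a shift has slice 0 because of the degree bound on \<open>f\<close>.\<close>

lemma theta_mult_mmon:
  assumes f: "f \<in> degb n N D" and k: "k \<in> exps n N D'"
  shows "theta n N y (D + D') (f * mmon 1 k) = theta n N y D f * pw n N y k"
proof -
  have "theta n N y (D + D') (f * mmon 1 k) =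
      (\<Sum>e\<in>(\<lambda>e. e + k) ` exps n N D. slice n (f * mmon 1 k) e * pw n N y e)"
    unfolding theta_def
  proof (rule sum.mono_neutral_right)
    show "(\<lambda>e. e + k) ` exps n N D \<subseteq> exps n N (D + D')" using exps_add k by blast
    show "\<forall>e\<in>exps n N (D + D') - (\<lambda>e. e + k) ` exps n N D. slice n (f * mmon 1 k) e * pw n N y e = 0"
    proof
      fix e assume e: "e \<in> exps n N (D + D') - (\<lambda>e. e + k) ` exps n N D"
      have "slice n (f * mmon 1 k) e = 0"
      proof (cases "k \<le> e")
        case True
        then have "e - k + k = e" using fun_le_add_diff[OF True] by (simp add: add.commute)
        then have "e - k \<notin> exps n N D" using e by (metis DiffD2 image_eqI)
        moreover have "e - k \<in> exps n N (D + D')" using e by (fastforce simp: exps_def)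
        ultimately have "slice n f (e - k) = 0" using slice_degb[OF f] by blast
        then show ?thesis using slice_mult_mmon[OF _ k] e by auto
      qed (use slice_mult_mmon[OF _ k] e in auto)
      then show "slice n (f * mmon 1 k) e * pw n N y e = 0" by simp
    qed
  qed simp
  also have "\<dots> = (\<Sum>e\<in>exps n N D. slice n (f * mmon 1 k) (e + k) * pw n N y (e + k))"
    by (subst sum.reindex) (auto simp: inj_on_def)
  also have "\<dots> = (\<Sum>e\<in>exps n N D. slice n f e * pw n N y e * pw n N y k)"
    by (rule sum.cong) (auto simp: slice_mult_mmon[OF exps_add[OF _ k] k] pw_add mult.assoc)
  finally show ?thesis by (simp add: theta_def sum_distrib_right)
qed

lemma slice_expansion:
  assumes f: "f \<in> T N" "f \<in> degb n N D"
  shows "f = (\<Sum>e\<in>exps n N D. slice n f e * mmon 1 e)"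
proof (rule mps_eqI)
  fix p :: "nat \<Rightarrow> nat"
  \<comment> \<open>The exponent of the only summand that can contribute to the coefficient at
    \<open>p\<close>. Below, \<open>max n N\<close> covers the case \<open>N < n\<close>, in which
    there is no variable to expand in.\<close>
  define e0 where "e0 = (\<lambda>i. if i \<in> {n..<N} then p i else 0)"
  have eq: "e \<le> p \<and> p - e \<in> multi_indices n \<longleftrightarrow> e = e0 \<and> p \<in> multi_indices (max n N)"
    if e: "e \<in> exps n N D" for e
  proof
    assume L: "e \<le> p \<and> p - e \<in> multi_indices n"
    have pe: "p i = e i" if "i \<ge> n" for i
    proof -
      have "e i \<le> p i" "p i - e i = 0" using L that by (auto simp: multi_indices_def le_fun_def)
      then show ?thesis by simp
    qed
    then have "e i = e0 i" for i using exps_out[OF e, of i] by (auto simp: e0_def)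
    moreover have "p i = 0" if "i \<ge> max n N" for i using pe[of i] that exps_out[OF e, of i] by auto
    ultimately show "e = e0 \<and> p \<in> multi_indices (max n N)" by (auto simp: multi_indices_def)
  next
    assume R: "e = e0 \<and> p \<in> multi_indices (max n N)"
    have "p i - e0 i = 0" if "i \<ge> n" for i
      using R that by (cases "i < N") (auto simp: e0_def multi_indices_def)
    then show "e \<le> p \<and> p - e \<in> multi_indices n"
      using R by (auto simp: multi_indices_def le_fun_def e0_def)
  qed
  have "coef (\<Sum>e\<in>exps n N D. slice n f e * mmon 1 e) p =
      (\<Sum>e\<in>exps n N D. if e = e0 \<and> p \<in> multi_indices (max n N) then coef f p else 0)"
    unfolding coef_sum
  proof (rule sum.cong[OF refl])
    fix e assume e: "e \<in> exps n N D"
    show "coef (slice n f e * mmon 1 e) p = (if e = e0 \<and> p \<in> multi_indices (max n N) then coef f p else 0)"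
      unfolding eq[OF e, symmetric]
      using coef_mmon_mult[OF exps_supp[OF e], of 1 "slice n f e" p] fun_le_add_diff[of e p]
      by (auto simp: coef_slice mult.commute add.commute)
  qed
  also have "\<dots> = coef f p"
  proof (cases "coef f p = 0")
    case False
    then have "p \<in> multi_indices (max n N)" using T_coef[OF T_mono[OF _ f(1)], of "max n N" p] by auto
    moreover have "e0 \<in> exps n N D" using False f(2) by (auto simp: e0_def exps_def degb_def)
    ultimately show ?thesis by simp
  qed (auto intro: sum.neutral)
  finally show "coef f p = coef (\<Sum>e\<in>exps n N D. slice n f e * mmon 1 e) p" by simp
qed

lemma degb_mult:
  assumes "f \<in> degb n N D" "g \<in> degb n N D'"
  shows "f * g \<in> degb n N (D + D')"
proof -
  have *: "coef (f * g) m = 0" if i: "i \<in> {n..<N}" "m i > D + D'" for i m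
    unfolding coef_mult
  proof (rule sum.neutral, rule ballI)
    fix p assume "p \<in> {p. p \<le> m}"
    then have "p i > D \<or> (m - p) i > D'" using i(2) by auto
    then have "coef f p = 0 \<or> coef g (m - p) = 0"
      using assms i(1) unfolding degb_def by (metis (mono_tags, lifting) mem_Collect_eq not_le)
    then show "coef f p * coef g (m - p) = 0" by auto
  qed
  show ?thesis unfolding degb_def
  proof (intro CollectI allI impI ballI)
    fix m i assume "coef (f * g) m \<noteq> 0" "i \<in> {n..<N}"
    then show "m i \<le> D + D'" using *[of i m] by (cases "m i \<le> D + D'") simp_all
  qed
qed

text \<open>Expanding \<open>g\<close> into monomials with coefficients in \<open>T n\<close>
  reduces this to linearity over \<open>T n\<close> and to \<open>theta_mult_mmon\<close>.\<close>

lemma theta_mult: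
  assumes f: "f \<in> degb n N D" and g: "g \<in> degb n N D'" "g \<in> T N"
  shows "theta n N y (D + D') (f * g) = theta n N y D f * theta n N y D' g"
proof -
  have "f * g = (\<Sum>e\<in>exps n N D'. slice n g e * (f * mmon 1 e))"
    using slice_expansion[OF g(2,1)] by (metis (no_types, lifting) mult.left_commute sum.cong sum_distrib_left)
  then have "theta n N y (D + D') (f * g) =
      (\<Sum>e\<in>exps n N D'. slice n g e * (theta n N y D f * pw n N y e))"
    by (simp add: theta_sum theta_mult_base[OF slice_T[OF g(2)]] theta_mult_mmon[OF f])
  also have "\<dots> = theta n N y D f * theta n N y D' g"
    by (simp add: theta_def[of _ _ _ D'] sum_distrib_left mult_ac)
  finally show ?thesis .
qed

lemma theta_mono:
  assumes "f \<in> degb n N D" "D \<le> D'"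
  shows "theta n N y D' f = theta n N y D f"
  using theta_mult_mmon[OF assms(1) zero_exps[of n N "D' - D"], of y] assms(2)
  by (simp add: pw_def flip: const_def)

lemma degb_one: "1 \<in> degb n N D"
  by (auto simp: degb_def coef_one split: if_splits)

lemma degb_var: "var i \<in> degb n N 1"
  unfolding degb_def var_def
  by (auto simp: coef_mmon[OF unit_idx_finite] split: if_splits) (simp add: unit_idx_def)

lemma theta_var:
  assumes "n \<le> i" "i < N" shows "theta n N y 1 (var i) = y i"
proof -
  have "theta n N y (0 + 1) (1 * mmon 1 (unit_idx i)) = theta n N y 0 1 * pw n N y (unit_idx i)"
    by (rule theta_mult_mmon[OF degb_one]) (use assms unit_exps in auto)
  then show ?thesis using assms by (simp add: pw_unit flip: var_def)
qed

subsection \<open>Homomorphisms between Tate algebras\<close>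

lemma pw_T: "(\<And>i. i \<in> {n..<N} \<Longrightarrow> y i \<in> T M) \<Longrightarrow> pw n N y e \<in> T M"
  unfolding pw_def by (intro T_prod T_power)

lemma nm_pw_le_1:
  assumes "\<And>i. i \<in> {n..<N} \<Longrightarrow> y i \<in> T M" "\<And>i. i \<in> {n..<N} \<Longrightarrow> nm (y i) \<le> 1"
  shows "nm (pw n N y e) \<le> 1"
  unfolding pw_def
proof (rule nm_prod_le_1)
  fix i assume i: "i \<in> {n..<N}"
  show "nm (y i ^ e i) \<le> 1"
    using nm_power_le[OF assms(1)[OF i], of "e i"] power_le_one[OF nm_nonneg[OF assms(1)[OF i]] assms(2)[OF i]]
    by (rule order_trans)
qed (use assms in auto)

lemma theta_T:
  assumes "f \<in> T N" "n \<le> M" "\<And>i. i \<in> {n..<N} \<Longrightarrow> y i \<in> T M"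
  shows "theta n N y D f \<in> T M"
  unfolding theta_def using assms by (intro T_sum T_mult T_mono[OF assms(2) slice_T[OF assms(1)]] pw_T)

lemma nm_theta_le:
  assumes "f \<in> T N" "n \<le> M" "\<And>i. i \<in> {n..<N} \<Longrightarrow> y i \<in> T M" "\<And>i. i \<in> {n..<N} \<Longrightarrow> nm (y i) \<le> 1"
  shows "nm (theta n N y D f) \<le> nm f"
  unfolding theta_def
proof (rule nm_sum_le)
  fix e
  have "nm (slice n f e * pw n N y e) \<le> nm f * 1"
    using assms by (intro nm_mult_le[of _ M] T_mono[OF assms(2) slice_T[OF assms(1)]] pw_T
      nm_slice[OF assms(1)] nm_pw_le_1[of _ _ _ M]) auto
  then show "nm (slice n f e * pw n N y e) \<le> nm f" by simp
  show "slice n f e * pw n N y e \<in> T M"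
    using assms by (intro T_mult T_mono[OF assms(2) slice_T[OF assms(1)]] pw_T)
qed (use assms nm_nonneg in auto)

text \<open>The continuous homomorphism from \<open>T n\<close> to \<open>T M\<close> with
  \<open>var i\<close> mapped to \<open>y i\<close>, for \<open>y i\<close> of norm at most 1,
  obtained as the limit of the evaluations truncated at degree \<open>D\<close>.\<close>

definition subst :: "nat \<Rightarrow> nat \<Rightarrow> (nat \<Rightarrow> 'k mps) \<Rightarrow> 'k mps \<Rightarrow> 'k mps" where
  "subst n M y f = (SOME G. G \<in> T M \<and> (\<forall>d>0. \<exists>K. \<forall>D\<ge>K. nm (theta 0 n y D f - G) \<le> d))"

context
  fixes n M :: nat and y :: "nat \<Rightarrow> 'k mps"
  assumes y: "\<And>i. i < n \<Longrightarrow> y i \<in> T M" "\<And>i. i < n \<Longrightarrow> nm (y i) \<le> 1"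
begin

lemma theta0_T: "f \<in> T n \<Longrightarrow> theta 0 n y D f \<in> T M"
  using theta_T[of f n 0 M y] y by simp

lemma nm_theta0_le: "f \<in> T n \<Longrightarrow> nm (theta 0 n y D f) \<le> nm f"
  using nm_theta_le[of f n 0 M y] y by simp

text \<open>Two truncated evaluations differ by an evaluation of \<open>f - trunc 0 n j f\<close>.
  Evaluation does not increase the norm, so they form a Cauchy sequence.\<close>

lemma subst_lim:
  assumes f: "f \<in> T n"
  shows subst_T: "subst n M y f \<in> T M"
    and subst_close: "d > 0 \<Longrightarrow> \<exists>K. \<forall>D\<ge>K. nm (theta 0 n y D f - subst n M y f) \<le> d"
proof -
  have "\<exists>K. \<forall>i\<ge>K. \<forall>j\<ge>K. nm (theta 0 n y i f - theta 0 n y j f) \<le> d" if d: "d > 0" for d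
  proof -
    obtain K where K: "\<And>D. D \<ge> K \<Longrightarrow> nm (f - trunc 0 n D f) \<le> d" using trunc_close[OF f d] by blast
    have le: "nm (theta 0 n y i f - theta 0 n y j f) \<le> d" if "K \<le> j" "j \<le> i" for i j
    proof -
      have "theta 0 n y i f - theta 0 n y j f = theta 0 n y i (f - trunc 0 n j f)"
        using theta_mono[OF trunc_degb that(2), of 0 n y f] by (simp add: theta_diff theta_trunc)
      also have "nm \<dots> \<le> nm (f - trunc 0 n j f)" by (rule nm_theta0_le) (use f in auto)
      finally show ?thesis using K[OF that(1)] by simp
    qed
    then show ?thesis by (metis nle_le nm_diff_commute)
  qed
  then obtain G where "G \<in> T M" "\<And>e. e > 0 \<Longrightarrow> \<exists>K. \<forall>i\<ge>K. nm (theta 0 n y i f - G) \<le> e"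
    using T_complete[of "\<lambda>i. theta 0 n y i f" M] theta0_T[OF f] by metis
  then have "\<exists>G. G \<in> T M \<and> (\<forall>d>0. \<exists>K. \<forall>D\<ge>K. nm (theta 0 n y D f - G) \<le> d)" by blast
  then have *: "subst n M y f \<in> T M \<and> (\<forall>d>0. \<exists>K. \<forall>D\<ge>K. nm (theta 0 n y D f - subst n M y f) \<le> d)"
    unfolding subst_def by (rule someI_ex)
  show "subst n M y f \<in> T M" using * by blast
  show "d > 0 \<Longrightarrow> \<exists>K. \<forall>D\<ge>K. nm (theta 0 n y D f - subst n M y f) \<le> d" using * by blast
qed

lemma subst_eqI:
  assumes f: "f \<in> T n" and G: "G \<in> T M"
    and lim: "\<And>d. d > 0 \<Longrightarrow> \<exists>K. \<forall>D\<ge>K. nm (theta 0 n y D f - G) \<le> d"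
  shows "subst n M y f = G"
proof (rule eq_if_nm_small[of _ M])
  fix d :: real assume d: "d > 0"
  obtain K1 K2 where K: "\<forall>D\<ge>K1. nm (theta 0 n y D f - subst n M y f) \<le> d" "\<forall>D\<ge>K2. nm (theta 0 n y D f - G) \<le> d"
    using subst_close[OF f d] lim[OF d] by blast
  let ?t = "theta 0 n y (max K1 K2) f"
  have "subst n M y f - G = (?t - G) - (?t - subst n M y f)" by simp
  also have "nm \<dots> \<le> d"
    by (rule nm_diff_le[of _ M]) (use K f G theta0_T subst_T in auto)
  finally show "nm (subst n M y f - G) \<le> d" .
qed (use subst_T f G in auto)

lemma subst_degb:
  assumes "f \<in> T n" "f \<in> degb 0 n D" shows "subst n M y f = theta 0 n y D f"
proof (rule subst_eqI)
  fix d :: real assume "d > 0"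
  then show "\<exists>K. \<forall>D'\<ge>K. nm (theta 0 n y D' f - theta 0 n y D f) \<le> d"
    using theta_mono[OF assms(2)] by (metis diff_self less_imp_le nm_zero)
qed (use assms theta0_T in auto)

lemma nm_subst:
  assumes f: "f \<in> T n" shows "nm (subst n M y f) \<le> nm f"
proof (rule field_le_epsilon)
  fix d :: real assume d: "d > 0"
  obtain K where K: "nm (theta 0 n y K f - subst n M y f) \<le> d" using subst_close[OF f d] by blast
  have "nm (theta 0 n y K f - (theta 0 n y K f - subst n M y f)) \<le> nm f + d"
    by (rule nm_diff_le[of _ M])
      (use f d K nm_theta0_le[OF f, of K] nm_nonneg[OF f] theta0_T subst_T in auto)
  then show "nm (subst n M y f) \<le> nm f + d" by simp
qed

lemma subst_add:
  assumes "f \<in> T n" "g \<in> T n" shows "subst n M y (f + g) = subst n M y f + subst n M y g"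
proof (rule subst_eqI)
  fix d :: real assume d: "d > 0"
  obtain K1 K2 where K: "\<forall>D\<ge>K1. nm (theta 0 n y D f - subst n M y f) \<le> d"
    "\<forall>D\<ge>K2. nm (theta 0 n y D g - subst n M y g) \<le> d"
    using subst_close d assms by meson
  have "nm (theta 0 n y D (f + g) - (subst n M y f + subst n M y g)) \<le> d" if "D \<ge> max K1 K2" for D
  proof -
    have "theta 0 n y D (f + g) - (subst n M y f + subst n M y g) =
      (theta 0 n y D f - subst n M y f) + (theta 0 n y D g - subst n M y g)" by (simp add: theta_add)
    also have "nm \<dots> \<le> d" by (rule nm_add_le[of _ M]) (use that K assms theta0_T subst_T in auto)
    finally show ?thesis .
  qed
  then show "\<exists>K. \<forall>D\<ge>K. nm (theta 0 n y D (f + g) - (subst n M y f + subst n M y g)) \<le> d" by blast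
qed (use assms subst_T in auto)

lemma subst_base: "c \<in> T 0 \<Longrightarrow> subst n M y c = c"
  by (rule subst_eqI) (auto simp: theta_base intro: T_mono[of 0])

lemma subst_const: "subst n M y (const c) = const c"
  by (rule subst_base) simp

lemma subst_zero: "subst n M y 0 = 0"
  by (rule subst_base) simp

lemma subst_one: "subst n M y 1 = 1"
  by (rule subst_base) simp

lemma subst_diff: "f \<in> T n \<Longrightarrow> g \<in> T n \<Longrightarrow> subst n M y (f - g) = subst n M y f - subst n M y g"
  using subst_add[of "f - g" g] by (auto simp: eq_diff_eq)

lemma subst_sum: "(\<And>i. i \<in> S \<Longrightarrow> f i \<in> T n) \<Longrightarrow> subst n M y (\<Sum>i\<in>S. f i) = (\<Sum>i\<in>S. subst n M y (f i))"
  by (induction S rule: infinite_finite_induct) (auto simp: subst_add subst_zero T_sum)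

lemma subst_var: "i < n \<Longrightarrow> subst n M y (var i) = y i"
  using subst_degb[OF T_var degb_var] theta_var[of 0 i n y] by simp

lemma subst_mult:
  assumes f: "f \<in> T n" and g: "g \<in> T n"
  shows "subst n M y (f * g) = subst n M y f * subst n M y g"
proof (rule eq_if_nm_small[of _ M])
  fix d :: real assume d: "d > 0"
  \<comment> \<open>A common bound for \<open>f\<close>, \<open>g\<close> and the truncation of
    \<open>g\<close>, made positive by the 1. Truncating with precision \<open>d / ?B\<close> keeps
    every mixed product below \<open>d\<close>.\<close>
  let ?B = "nm f + nm g + 1" and ?s = "subst n M y"
  have B: "?B > 0" "nm f \<le> ?B" "nm g \<le> ?B" using nm_nonneg f g by (smt (verit))+
  obtain K1 where K1: "\<And>D. D \<ge> K1 \<Longrightarrow> nm (f - trunc 0 n D f) \<le> d / ?B"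
    using trunc_close[OF f, of "d / ?B"] d B by (metis divide_pos_pos)
  obtain K2 where K2: "\<And>D. D \<ge> K2 \<Longrightarrow> nm (g - trunc 0 n D g) \<le> d / ?B"
    using trunc_close[OF g, of "d / ?B"] d B by (metis divide_pos_pos)
  define f' where "f' = trunc 0 n (max K1 K2) f"
  define g' where "g' = trunc 0 n (max K1 K2) g"
  have T: "f' \<in> T n" "g' \<in> T n" "?s f' \<in> T M" "?s g' \<in> T M" "?s f \<in> T M" "?s g \<in> T M"
    using f g subst_T by (auto simp: f'_def g'_def)
  have close: "nm (f - f') \<le> d / ?B" "nm (g - g') \<le> d / ?B" and g'B: "nm g' \<le> ?B"
    using K1 K2 nm_trunc[OF g, of 0 n "max K1 K2"] B by (auto simp: f'_def g'_def)
  have "f' * g' \<in> degb 0 n (max K1 K2 + max K1 K2)"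
    unfolding f'_def g'_def by (intro degb_mult trunc_degb)
  then have "?s (f' * g') = theta 0 n y (max K1 K2 + max K1 K2) (f' * g')"
    using T by (intro subst_degb) auto
  also have "\<dots> = theta 0 n y (max K1 K2) f' * theta 0 n y (max K1 K2) g'"
    using T by (intro theta_mult) (auto simp: f'_def g'_def trunc_degb)
  also have "\<dots> = ?s f' * ?s g'"
    using T by (subst (1 2) subst_degb[of _ "max K1 K2"]) (auto simp: f'_def g'_def trunc_degb)
  finally have mult: "?s (f' * g') = ?s f' * ?s g'" .
  \<comment> \<open>Multiplicativity holds exactly for the truncations, so the defect consists of
    terms each containing a difference \<open>f - f'\<close> or \<open>g - g'\<close>.\<close>
  have "?s (f * g) - ?s f * ?s g = ?s (f * g - f' * g') - (?s f * (?s g - ?s g') + (?s f - ?s f') * ?s g')"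
    using f g T by (simp add: subst_diff mult algebra_simps)
  also have "\<dots> = ?s (f * (g - g') + (f - f') * g') - (?s f * ?s (g - g') + ?s (f - f') * ?s g')"
    using f g T by (simp add: subst_diff algebra_simps)
  also have "nm \<dots> \<le> d"
  proof (rule nm_diff_le)
    have dB: "?B * (d / ?B) = d" "d / ?B * ?B = d" using B by auto
    have "nm (f * (g - g')) \<le> ?B * (d / ?B)" by (rule nm_mult_le[of _ n]) (use f g T close B in auto)
    moreover have "nm ((f - f') * g') \<le> d / ?B * ?B" by (rule nm_mult_le[of _ n]) (use f g T close g'B in auto)
    ultimately have "nm (f * (g - g') + (f - f') * g') \<le> d"
      using f g T dB by (intro nm_add_le[of _ n]) auto
    then show "nm (?s (f * (g - g') + (f - f') * g')) \<le> d"
      using nm_subst[of "f * (g - g') + (f - f') * g'"] f g T by fastforce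
    have "nm (?s f * ?s (g - g')) \<le> ?B * (d / ?B)"
      using nm_subst[of f] nm_subst[of "g - g'"] f g T close B
      by (intro nm_mult_le[of _ M]) (auto intro!: subst_T)
    moreover have "nm (?s (f - f') * ?s g') \<le> d / ?B * ?B"
      using nm_subst[of "f - f'"] nm_subst[of g'] f g T close g'B
      by (intro nm_mult_le[of _ M]) (auto intro!: subst_T)
    ultimately show "nm (?s f * ?s (g - g') + ?s (f - f') * ?s g') \<le> d"
      using f g T dB by (intro nm_add_le[of _ M]) (auto intro!: subst_T)
  qed (use f g T in \<open>auto intro!: subst_T T_add T_mult T_diff\<close>)
  finally show "nm (?s (f * g) - ?s f * ?s g) \<le> d" .
qed (use f g subst_T in auto)

end

end

section \<open>Subrings and maximal ideals as sets\<close>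

definition sub_ring :: "'r::comm_ring_1 set \<Rightarrow> bool" where
  "sub_ring R \<longleftrightarrow> 1 \<in> R \<and> (\<forall>a\<in>R. \<forall>b\<in>R. a - b \<in> R \<and> a * b \<in> R)"

definition ideal_in :: "'r::comm_ring_1 set \<Rightarrow> 'r set \<Rightarrow> bool" where
  "ideal_in R M \<longleftrightarrow> M \<subseteq> R \<and> 0 \<in> M \<and> (\<forall>a\<in>M. \<forall>b\<in>M. a + b \<in> M) \<and> (\<forall>r\<in>R. \<forall>a\<in>M. r * a \<in> M)"

text \<open>Maximality is expressed by the quotient being a field, since inverses modulo
  \<open>M\<close> are what the arguments use.\<close>

definition max_ideal :: "'r::comm_ring_1 set \<Rightarrow> 'r set \<Rightarrow> bool" where
  "max_ideal R M \<longleftrightarrow> ideal_in R M \<and> 1 \<notin> M \<and> (\<forall>a\<in>R - M. \<exists>b\<in>R. a * b - 1 \<in> M)"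

lemma
  assumes "sub_ring R"
  shows sub_ring_one: "1 \<in> R"
    and sub_ring_diff: "a \<in> R \<Longrightarrow> b \<in> R \<Longrightarrow> a - b \<in> R"
    and sub_ring_mult: "a \<in> R \<Longrightarrow> b \<in> R \<Longrightarrow> a * b \<in> R"
    and sub_ring_zero: "0 \<in> R"
    and sub_ring_uminus: "a \<in> R \<Longrightarrow> - a \<in> R"
    and sub_ring_add: "a \<in> R \<Longrightarrow> b \<in> R \<Longrightarrow> a + b \<in> R"
proof -
  show 1: "1 \<in> R" and d: "a \<in> R \<Longrightarrow> b \<in> R \<Longrightarrow> a - b \<in> R" and "a \<in> R \<Longrightarrow> b \<in> R \<Longrightarrow> a * b \<in> R" for a b
    using assms by (auto simp: sub_ring_def)
  show 0: "0 \<in> R" using d[OF 1 1] by simp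
  show u: "a \<in> R \<Longrightarrow> - a \<in> R" for a using d[OF 0] by fastforce
  show "a \<in> R \<Longrightarrow> b \<in> R \<Longrightarrow> a + b \<in> R" using d[OF _ u, of a b] by simp
qed

lemma
  assumes "ideal_in R M"
  shows ideal_sub: "a \<in> M \<Longrightarrow> a \<in> R"
    and ideal_zero: "0 \<in> M"
    and ideal_add: "a \<in> M \<Longrightarrow> b \<in> M \<Longrightarrow> a + b \<in> M"
    and ideal_mult: "r \<in> R \<Longrightarrow> a \<in> M \<Longrightarrow> r * a \<in> M"
    and ideal_mult': "r \<in> R \<Longrightarrow> a \<in> M \<Longrightarrow> a * r \<in> M"
  using assms by (auto simp: ideal_in_def mult.commute)

lemma
  assumes "sub_ring R" "ideal_in R M"
  shows ideal_uminus: "a \<in> M \<Longrightarrow> - a \<in> M"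
    and ideal_diff: "a \<in> M \<Longrightarrow> b \<in> M \<Longrightarrow> a - b \<in> M"
proof -
  show u: "a \<in> M \<Longrightarrow> - a \<in> M" for a
    using ideal_mult[OF assms(2) sub_ring_uminus[OF assms(1) sub_ring_one[OF assms(1)]], of a] by simp
  show "a \<in> M \<Longrightarrow> b \<in> M \<Longrightarrow> a - b \<in> M" using ideal_add[OF assms(2) _ u, of a b] by simp
qed

lemma ideal_sum: "ideal_in R M \<Longrightarrow> (\<And>i. i \<in> S \<Longrightarrow> f i \<in> M) \<Longrightarrow> (\<Sum>i\<in>S. f i) \<in> M"
  by (induction S rule: infinite_finite_induct) (auto intro: ideal_zero ideal_add)

lemma max_ideal_ideal: "max_ideal R M \<Longrightarrow> ideal_in R M"
  by (simp add: max_ideal_def)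

lemma max_ideal_one: "max_ideal R M \<Longrightarrow> 1 \<notin> M"
  by (simp add: max_ideal_def)

lemma max_ideal_inverse:
  "max_ideal R M \<Longrightarrow> a \<in> R \<Longrightarrow> a \<notin> M \<Longrightarrow> \<exists>b\<in>R. a * b - 1 \<in> M"
  by (simp add: max_ideal_def)

lemma exists_max_ideal:
  assumes R: "sub_ring R" and J: "ideal_in R J" "1 \<notin> J"
  obtains M where "max_ideal R M" "J \<subseteq> M"
proof -
  let ?S = "{M. ideal_in R M \<and> 1 \<notin> M \<and> J \<subseteq> M}"
  have "\<exists>M\<in>?S. \<forall>X\<in>?S. M \<subseteq> X \<longrightarrow> X = M"
  proof (rule subset_Zorn_nonempty)
    show "?S \<noteq> {}" using J by blast
    fix C assume C: "C \<noteq> {}" "subset.chain ?S C"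
    have sub: "C \<subseteq> ?S" and tot: "\<And>X Y. X \<in> C \<Longrightarrow> Y \<in> C \<Longrightarrow> X \<subseteq> Y \<or> Y \<subseteq> X"
      using C(2) by (auto simp: subset_chain_def)
    have "ideal_in R (\<Union>C)"
      unfolding ideal_in_def
    proof (intro conjI ballI)
      show "\<Union>C \<subseteq> R" using sub by (auto simp: ideal_in_def)
      show "0 \<in> \<Union>C" using sub C(1) by (auto simp: ideal_in_def)
      show "a + b \<in> \<Union>C" if ab: "a \<in> \<Union>C" "b \<in> \<Union>C" for a b
      proof -
        obtain X Y where XY: "X \<in> C" "Y \<in> C" "a \<in> X" "b \<in> Y" using ab by blast
        then obtain Z where "Z \<in> C" "a \<in> Z" "b \<in> Z" using tot[of X Y] by blast
        then show ?thesis using sub ideal_add[of R Z a b] by blast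
      qed
      show "r * a \<in> \<Union>C" if ra: "r \<in> R" "a \<in> \<Union>C" for r a
      proof -
        obtain X where "X \<in> C" "a \<in> X" using ra(2) by blast
        then show ?thesis using sub ideal_mult[OF _ ra(1), of X a] by blast
      qed
    qed
    then show "\<Union>C \<in> ?S" using sub C(1) by blast
  qed
  then obtain M where "M \<in> ?S" and mx': "\<forall>X\<in>?S. M \<subseteq> X \<longrightarrow> X = M" by (rule bexE)
  then have M: "ideal_in R M" "1 \<notin> M" "J \<subseteq> M" by simp_all
  have mx: "X = M" if "ideal_in R X" "1 \<notin> X" "M \<subseteq> X" for X
    using bspec[OF mx', of X] that M(3) by simp
  have "\<exists>b\<in>R. a * b - 1 \<in> M" if a: "a \<in> R" "a \<notin> M" for a
  proof -
    let ?X = "{m + a * r | m r. m \<in> M \<and> r \<in> R}"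
    have "ideal_in R ?X"
      unfolding ideal_in_def
    proof (intro conjI ballI)
      show "?X \<subseteq> R" using a ideal_sub[OF M(1)] by (auto intro!: sub_ring_add[OF R] sub_ring_mult[OF R])
      show "0 \<in> ?X" using ideal_zero[OF M(1)] sub_ring_zero[OF R] by force
      show "x + y \<in> ?X" if xy: "x \<in> ?X" "y \<in> ?X" for x y
      proof -
        obtain m r m' r' where "x = m + a * r" "y = m' + a * r'" "m \<in> M" "m' \<in> M" "r \<in> R" "r' \<in> R"
          using xy by blast
        moreover from this have "x + y = (m + m') + a * (r + r')" by (simp add: algebra_simps)
        moreover have "m + m' \<in> M" "r + r' \<in> R"
          using calculation ideal_add[OF M(1)] sub_ring_add[OF R] by auto
        ultimately show ?thesis by blast
      qed
      show "s * x \<in> ?X" if sx: "s \<in> R" "x \<in> ?X" for s x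
      proof -
        obtain m r where "x = m + a * r" "m \<in> M" "r \<in> R" using sx by blast
        moreover from this have "s * x = s * m + a * (s * r)" by (simp add: algebra_simps)
        moreover have "s * m \<in> M" "s * r \<in> R"
          using calculation ideal_mult[OF M(1) sx(1)] sub_ring_mult[OF R sx(1)] by auto
        ultimately show ?thesis by blast
      qed
    qed
    moreover have "M \<subseteq> ?X" using sub_ring_zero[OF R] by force
    moreover have "a \<in> ?X" using ideal_zero[OF M(1)] sub_ring_one[OF R] by force
    ultimately have "1 \<in> ?X" using mx[of ?X] a by blast
    then obtain m r where m: "1 = m + a * r" "m \<in> M" "r \<in> R" by blast
    have "a * r - 1 = - m" unfolding m(1) by simp
    then show ?thesis using ideal_uminus[OF R M(1) m(2)] m(3) by (intro bexI[of _ r]) auto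
  qed
  then have "max_ideal R M" using M by (simp add: max_ideal_def)
  then show ?thesis using that M by blast
qed

text \<open>The argument is that of Nakayama's lemma: since \<open>a\<close> is invertible modulo \<open>M\<close>, the generators
  can be removed one at a time at the cost of a factor congruent to \<open>1\<close> modulo \<open>a\<close>; in the end such
  a factor lies in \<open>M\<close>, which makes \<open>a\<close> invertible in \<open>R'\<close>.\<close>

lemma max_ideal_Int_finite:
  fixes e :: "nat \<Rightarrow> 'r::comm_ring_1"
  assumes R: "sub_ring R" and R': "sub_ring R'" "R' \<subseteq> R" and M: "max_ideal R M"
    and e: "\<And>j. j < s \<Longrightarrow> e j \<in> R"
    and gen: "\<And>t. t \<in> R \<Longrightarrow> \<exists>r. (\<forall>j<s. r j \<in> R') \<and> t - (\<Sum>j<s. r j * e j) \<in> M"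
  shows "max_ideal R' (M \<inter> R')"
proof -
  note I = max_ideal_ideal[OF M]
  have "\<exists>b\<in>R'. a * b - 1 \<in> M \<inter> R'" if a: "a \<in> R'" "a \<notin> M" for a
  proof -
    have aR: "a \<in> R" using a R' by blast
    obtain i where i: "i \<in> R" "a * i - 1 \<in> M" using max_ideal_inverse[OF M aR a(2)] by blast
    have "\<exists>q\<in>R'. \<forall>t\<in>R. \<exists>r. (\<forall>j<s - d. r j \<in> R') \<and> (1 + a * q) * t - (\<Sum>j<s - d. r j * e j) \<in> M"
      if "d \<le> s" for d
      using that
    proof (induction d)
      case 0
      show ?case using gen sub_ring_zero[OF R'(1)] by (intro bexI[of _ 0]) auto
    next
      case (Suc d)
      \<comment> \<open>\<open>e k\<close> is the last of the remaining generators, the one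
        eliminated in this step.\<close>
      then obtain k where k: "s - d = Suc k" "s - Suc d = k" "k < s" by (metis Suc_diff_Suc Suc_le_lessD diff_less_Suc Suc_leD less_SucE diff_le_self lessI order_le_less_trans)
      obtain q where q: "q \<in> R'" and
        gq: "\<And>t. t \<in> R \<Longrightarrow> \<exists>r. (\<forall>j<Suc k. r j \<in> R') \<and> (1 + a * q) * t - (\<Sum>j<Suc k. r j * e j) \<in> M"
        using Suc k by auto
      define u where "u = 1 + a * q"
      have u: "u \<in> R'" unfolding u_def by (intro sub_ring_add sub_ring_mult sub_ring_one R' a q)
      obtain r where r: "\<And>j. j < Suc k \<Longrightarrow> r j \<in> R'" "u * (i * e k) - (\<Sum>j<Suc k. r j * e j) \<in> M"
        using gq[of "i * e k"] sub_ring_mult[OF R i(1) e[OF k(3)]] unfolding u_def by blast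
      \<comment> \<open>Multiply the expansion of \<open>u * (i * e k)\<close> by \<open>a\<close>.
        Since \<open>a * i\<close> is congruent to 1, it becomes an expansion of
        \<open>u * e k\<close> with coefficients \<open>a * r j\<close>; moving the term for
        \<open>k\<close> to the left leaves the factor \<open>w\<close>, and \<open>X\<close> is the
        resulting relation. Both \<open>u\<close> and \<open>w\<close> are congruent to 1 modulo
        \<open>a\<close>.\<close>
      define w where "w = u - a * r k"
      define X where "X = w * e k - (\<Sum>j<k. a * r j * e j)"
      have rk: "r k \<in> R'" using r by simp
      have w: "w \<in> R'" unfolding w_def by (intro sub_ring_diff sub_ring_mult R' a u rk)
      have X: "X \<in> M"
      proof -
        have "X = a * (u * (i * e k) - (\<Sum>j<Suc k. r j * e j)) - (u * e k) * (a * i - 1)"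
          by (simp add: X_def w_def algebra_simps sum_distrib_left)
        also have "\<dots> \<in> M"
          by (rule ideal_diff[OF R I]; rule ideal_mult[OF I])
            (use r(2) i u R' aR e[OF k(3)] in \<open>auto intro: sub_ring_mult[OF R]\<close>)
        finally show ?thesis .
      qed
      have wu: "w * u = 1 + a * (q + (q - r k) * u)"
        by (simp add: w_def u_def algebra_simps)
      show ?case
      proof (intro bexI ballI)
        show "q + (q - r k) * u \<in> R'" by (intro sub_ring_add sub_ring_mult sub_ring_diff R' q u rk)
        fix t assume t: "t \<in> R"
        obtain p where p: "\<And>j. j < Suc k \<Longrightarrow> p j \<in> R'" "u * t - (\<Sum>j<Suc k. p j * e j) \<in> M"
          using gq[OF t] unfolding u_def by blast
        \<comment> \<open>The coefficients after multiplying the expansion of \<open>u * t\<close>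
          by \<open>w\<close> and replacing \<open>w * e k\<close> by means of
          \<open>X\<close>.\<close>
        let ?r = "\<lambda>j. w * p j + p k * (a * r j)"
        have "w * u * t - (\<Sum>j<k. ?r j * e j) = w * (u * t - (\<Sum>j<Suc k. p j * e j)) + p k * X"
          by (simp add: X_def algebra_simps sum_distrib_left sum.distrib)
        also have "\<dots> \<in> M"
          using p X w R' by (intro ideal_add[OF I] ideal_mult[OF I]) auto
        finally show "\<exists>r'. (\<forall>j<s - Suc d. r' j \<in> R') \<and>
            (1 + a * (q + (q - r k) * u)) * t - (\<Sum>j<s - Suc d. r' j * e j) \<in> M"
          unfolding k(2) wu[symmetric]
          using w p(1) r(1) a by (intro exI[of _ ?r]) (auto intro!: sub_ring_add sub_ring_mult R')
      qed
    qed
    from this[of s] obtain q where q: "q \<in> R'" "1 + a * q \<in> M"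
      using sub_ring_one[OF R] by force
    have "a * (- q) - 1 = - (1 + a * q)" by simp
    then have "a * (- q) - 1 \<in> M" using ideal_uminus[OF R I q(2)] by metis
    moreover have "a * (- q) - 1 \<in> R'"
      by (intro sub_ring_diff sub_ring_mult sub_ring_uminus sub_ring_one R' a q)
    ultimately show ?thesis using sub_ring_uminus[OF R'(1) q(1)] by blast
  qed
  then show ?thesis
    using I max_ideal_one[OF M] R' sub_ring_zero[OF R'(1)] sub_ring_add[OF R'(1)] sub_ring_mult[OF R'(1)]
    unfolding max_ideal_def ideal_in_def by auto
qed

context complete_nonarch_field
begin

lemma T_sub_ring [simp]: "sub_ring (T n)"
  by (auto simp: sub_ring_def)

text \<open>If \<open>b\<close> were an inverse of \<open>t\<close> modulo \<open>M\<close>, and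
  \<open>m\<close> in \<open>M\<close> were close to \<open>t\<close>, then
  \<open>1 - (t - m) * b\<close> would be a unit, being close to 1, and yet would lie in
  \<open>M\<close>.\<close>

lemma max_ideal_closed:
  assumes M: "max_ideal (T n) M" and t: "t \<in> T n"
    and close: "\<And>d. d > 0 \<Longrightarrow> \<exists>m\<in>M. nm (t - m) \<le> d"
  shows "t \<in> M"
proof (rule ccontr)
  note I = max_ideal_ideal[OF M]
  assume "t \<notin> M"
  then obtain b where b: "b \<in> T n" "t * b - 1 \<in> M" using max_ideal_inverse[OF M t] by blast
  have pos: "nm b + 1 > 0" using nm_nonneg[OF b(1)] by simp
  obtain m where m: "m \<in> M" "nm (t - m) \<le> 1 / (2 * (nm b + 1))"
    using close[of "1 / (2 * (nm b + 1))"] pos by auto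
  have mT: "m \<in> T n" using ideal_sub[OF I m(1)] .
  let ?u = "(t - m) * b"
  have "nm ?u \<le> 1 / (2 * (nm b + 1)) * (nm b + 1)"
    by (rule nm_mult_le[of _ n]) (use t b mT m in auto)
  also have "\<dots> < 1" using pos by simp
  finally obtain w where w: "w \<in> T n" "(1 - ?u) * w = 1"
    using one_minus_invertible[of ?u n] t b mT by blast
  have "1 - ?u = m * b - (t * b - 1)" by (simp add: algebra_simps)
  also have "\<dots> \<in> M" by (rule ideal_diff[OF T_sub_ring I ideal_mult'[OF I b(1) m(1)] b(2)])
  finally have "(1 - ?u) * w \<in> M" by (intro ideal_mult'[OF I] w)
  then show False using w max_ideal_one[OF M] by simp
qed

section \<open>Residue fields are finite-dimensional\<close>

definition lspan :: "'k mps set \<Rightarrow> 'k mps set \<Rightarrow> 'k mps set" where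
  "lspan E M = {t. \<exists>c. t - (\<Sum>e\<in>E. const (c e) * e) \<in> M}"

definition fin_dim :: "nat \<Rightarrow> 'k mps set \<Rightarrow> bool" where
  "fin_dim n M \<longleftrightarrow> (\<exists>E. finite E \<and> E \<subseteq> T n \<and> T n \<subseteq> lspan E M)"

lemma lspan_add:
  assumes I: "ideal_in R M" and "a \<in> lspan E M" "b \<in> lspan E M"
  shows "a + b \<in> lspan E M"
proof -
  obtain c d where "a - (\<Sum>e\<in>E. const (c e) * e) \<in> M" "b - (\<Sum>e\<in>E. const (d e) * e) \<in> M"
    using assms(2,3) by (auto simp: lspan_def)
  from ideal_add[OF I this] have "a + b - (\<Sum>e\<in>E. const (c e + d e) * e) \<in> M"
    by (simp add: const_add[symmetric] distrib_right sum.distrib algebra_simps)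
  then show ?thesis unfolding lspan_def by (intro CollectI exI[of _ "\<lambda>e. c e + d e"])
qed

lemma lspan_scale:
  assumes I: "ideal_in R M" and "const k \<in> R" "a \<in> lspan E M"
  shows "const k * a \<in> lspan E M"
proof -
  obtain c where "a - (\<Sum>e\<in>E. const (c e) * e) \<in> M" using assms(3) by (auto simp: lspan_def)
  from ideal_mult[OF I assms(2) this] have "const k * a - (\<Sum>e\<in>E. const (k * c e) * e) \<in> M"
    by (simp add: const_mult[symmetric] sum_distrib_left algebra_simps)
  then show ?thesis unfolding lspan_def by (intro CollectI exI[of _ "\<lambda>e. k * c e"])
qed

lemma lspan_ideal: "m \<in> M \<Longrightarrow> m \<in> lspan E M"
  unfolding lspan_def by (rule CollectI, rule exI[of _ "\<lambda>_. 0"]) simp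

lemma lspan_base:
  assumes I: "ideal_in R M" and "finite E" "e \<in> E"
  shows "e \<in> lspan E M"
proof -
  have "(\<Sum>x\<in>E. const (if x = e then 1 else 0) * x) = (\<Sum>x\<in>E. if x = e then e else 0)"
    by (rule sum.cong) auto
  then have "e - (\<Sum>x\<in>E. const (if x = e then 1 else 0) * x) = 0" using assms by simp
  then show ?thesis unfolding lspan_def using ideal_zero[OF I]
    by (intro CollectI exI[of _ "\<lambda>x. if x = e then 1 else 0"]) simp
qed

lemma lspan_sum:
  "ideal_in R M \<Longrightarrow> (\<And>i. i \<in> S \<Longrightarrow> f i \<in> lspan E M) \<Longrightarrow> (\<Sum>i\<in>S. f i) \<in> lspan E M"
  by (induction S rule: infinite_finite_induct) (auto intro: lspan_add lspan_ideal ideal_zero)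

lemma var_power: "(var N :: 'r::comm_ring_1 mps) ^ k = mmon 1 (\<lambda>j. if j = N then k else 0)"
proof (induction k)
  case 0
  have "(\<lambda>j. if j = N then 0 else 0) = (0 :: nat \<Rightarrow> nat)" by auto
  then show ?case using const_1 unfolding const_def by (simp add: zero_fun_def)
next
  case (Suc k)
  have "(var N :: 'r mps) ^ Suc k = mmon 1 (unit_idx N) * mmon 1 (\<lambda>j. if j = N then k else 0)"
    by (simp add: Suc flip: var_def)
  also have "\<dots> = mmon (1 * 1) (unit_idx N + (\<lambda>j. if j = N then k else 0))"
    by (rule mmon_mult) (auto simp: unit_idx_def)
  also have "unit_idx N + (\<lambda>j. if j = N then k else 0) = (\<lambda>j. if j = N then Suc k else 0)"
    by (auto simp: unit_idx_def)
  finally show ?case by simp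
qed

lemma mmon_eq_pw:
  assumes "m \<in> multi_indices N"
  shows "mmon 1 m = pw 0 N var m"
  using assms
proof (induction N arbitrary: m)
  case 0
  then have m: "m = 0" by (auto simp: multi_indices_def)
  show ?case using const_1 unfolding m const_def by (simp add: pw_def zero_fun_def)
next
  case (Suc N)
  let ?m = "m(N := 0)" and ?k = "\<lambda>j. if j = N then m N else 0"
  have m: "?m \<in> multi_indices N" "?k \<in> multi_indices (Suc N)" using Suc.prems by (auto simp: multi_indices_def)
  have "mmon 1 m = mmon (1 * 1) (?m + ?k)" by (rule arg_cong2[where f = mmon]) (auto simp: fun_eq_iff)
  also have "\<dots> = mmon 1 ?m * mmon 1 ?k"
    by (rule mmon_mult[symmetric]) (use m multi_indices_finite in blast)+
  also have "\<dots> = pw 0 N var ?m * var N ^ m N" by (simp only: Suc.IH[OF m(1)] var_power)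
  also have "\<dots> = pw 0 (Suc N) var m"
    unfolding pw_def by (simp add: atLeast0_lessThan_Suc mult.commute)
  finally show ?case .
qed

lemma coef_finite_part:
  assumes "finite S" "S \<subseteq> multi_indices n"
  shows "coef (\<Sum>m\<in>S. mmon (c m) m) p = (if p \<in> S then c p else 0)"
proof -
  have "coef (\<Sum>m\<in>S. mmon (c m) m) p = (\<Sum>m\<in>S. if p = m then c m else 0)"
    unfolding coef_sum by (rule sum.cong) (auto simp: coef_mmon'[OF subsetD[OF assms(2)]])
  then show ?thesis using assms by simp
qed

lemma mmon_eq_const_mult: "m \<in> multi_indices n \<Longrightarrow> mmon c m = const c * mmon 1 m"
  unfolding const_def by (subst mmon_mult) (use multi_indices_finite in auto)

section \<open>Shearing the variables and monic polynomials\<close>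

lemma digits_unique:
  fixes a b :: "nat \<Rightarrow> nat"
  assumes "\<And>i. i < k \<Longrightarrow> a i < B" "\<And>i. i < k \<Longrightarrow> b i < B"
    and "(\<Sum>i<k. B ^ i * a i) = (\<Sum>i<k. B ^ i * b i)" "i < k"
  shows "a i = b i"
  using assms
proof (induction k arbitrary: a b i)
  case (Suc k)
  have eq: "(\<Sum>i<Suc k. B ^ i * c i) = c 0 + B * (\<Sum>i<k. B ^ i * c (Suc i))" for c :: "nat \<Rightarrow> nat"
    by (simp add: sum.lessThan_Suc_shift sum_distrib_left mult.assoc del: sum.lessThan_Suc)
  have e: "a 0 + B * (\<Sum>i<k. B ^ i * a (Suc i)) = b 0 + B * (\<Sum>i<k. B ^ i * b (Suc i))"
    using Suc.prems(3) unfolding eq .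
  have lt: "a 0 < B" "b 0 < B" using Suc.prems by auto
  have a0: "a 0 = b 0" using arg_cong[OF e, of "\<lambda>x. x mod B"] lt by simp
  then have "(\<Sum>i<k. B ^ i * a (Suc i)) = (\<Sum>i<k. B ^ i * b (Suc i))" using e lt by simp
  then have "a (Suc j) = b (Suc j)" if "j < k" for j
    using Suc.IH[of "\<lambda>i. a (Suc i)" "\<lambda>i. b (Suc i)" j] Suc.prems that by simp
  then show ?case using a0 Suc.prems(4) by (cases i) auto
qed simp

text \<open>Instead of transforming series by an automorphism, the subring of coefficients is
  changed: \<open>T n\<close> is embedded by sending \<open>var i\<close> to
  \<open>shear n B i\<close>. Over this image, \<open>var i\<close> equals
  \<open>shear n B i\<close> plus a pure power of \<open>var n\<close>, so it is a monic polynomial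
  in \<open>var n\<close>.\<close>

definition shear :: "nat \<Rightarrow> nat \<Rightarrow> nat \<Rightarrow> 'k mps" where
  "shear n B i = var i - var n ^ (B ^ Suc i)"

definition shear_hom :: "nat \<Rightarrow> nat \<Rightarrow> 'k mps \<Rightarrow> 'k mps" where
  "shear_hom n B = subst n (Suc n) (shear n B)"

text \<open>The degree in \<open>var n\<close> of the monomial with exponent \<open>m\<close>, seen
  as a polynomial over the sheared copy of \<open>T n\<close>. If the exponents are below
  \<open>B\<close>, they are its base-\<open>B\<close> digits.\<close>

definition shear_deg :: "nat \<Rightarrow> nat \<Rightarrow> (nat \<Rightarrow> nat) \<Rightarrow> nat" where
  "shear_deg n B m = m n + (\<Sum>i<n. B ^ Suc i * m i)"

text \<open>Polynomials in \<open>var n\<close> of degree below \<open>d\<close> over the sheared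
  copy of \<open>T n\<close>, with integral coefficients.\<close>

definition low_deg :: "nat \<Rightarrow> nat \<Rightarrow> nat \<Rightarrow> 'k mps set" where
  "low_deg n B d =
    {(\<Sum>j<d. shear_hom n B (p j) * var n ^ j) | p. \<forall>j<d. p j \<in> T n \<and> nm (p j) \<le> 1}"

lemma shear_T: "i < n \<Longrightarrow> shear n B i \<in> T (Suc n)"
  by (simp add: shear_def)

lemma nm_var_power_le: "nm (var i ^ k) \<le> 1"
  using nm_power_le[OF T_var[of i "Suc i"], of k] by simp

lemma nm_shear: "i < n \<Longrightarrow> nm (shear n B i) \<le> 1"
  unfolding shear_def by (rule nm_diff_le[of _ "Suc n"]) (auto simp: nm_var_power_le)

lemma
  shows shear_hom_T: "p \<in> T n \<Longrightarrow> shear_hom n B p \<in> T (Suc n)"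
    and nm_shear_hom: "p \<in> T n \<Longrightarrow> nm (shear_hom n B p) \<le> nm p"
    and shear_hom_add: "p \<in> T n \<Longrightarrow> q \<in> T n \<Longrightarrow> shear_hom n B (p + q) = shear_hom n B p + shear_hom n B q"
    and shear_hom_diff: "p \<in> T n \<Longrightarrow> q \<in> T n \<Longrightarrow> shear_hom n B (p - q) = shear_hom n B p - shear_hom n B q"
    and shear_hom_mult: "p \<in> T n \<Longrightarrow> q \<in> T n \<Longrightarrow> shear_hom n B (p * q) = shear_hom n B p * shear_hom n B q"
    and shear_hom_const: "shear_hom n B (const c) = const c"
    and shear_hom_zero: "shear_hom n B 0 = 0"
    and shear_hom_one: "shear_hom n B 1 = 1"
    and shear_hom_var: "i < n \<Longrightarrow> shear_hom n B (var i) = shear n B i"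
    and shear_hom_sum: "(\<And>i. i \<in> S \<Longrightarrow> f i \<in> T n) \<Longrightarrow> shear_hom n B (\<Sum>i\<in>S. f i) = (\<Sum>i\<in>S. shear_hom n B (f i))"
  unfolding shear_hom_def using shear_T[of _ n B] nm_shear[of _ n B]
  by (auto intro!: subst_T nm_subst subst_add subst_diff subst_mult subst_const subst_zero subst_one subst_var subst_sum)

lemma low_deg_T: "w \<in> low_deg n B d \<Longrightarrow> w \<in> T (Suc n)"
  by (auto simp: low_deg_def intro!: T_sum T_mult shear_hom_T)

lemma low_deg_term:
  assumes "p \<in> T n" "nm p \<le> 1" "j < d"
  shows "shear_hom n B p * var n ^ j \<in> low_deg n B d"
proof -
  let ?p = "\<lambda>i. if i = j then p else 0"
  have "(\<Sum>i<d. shear_hom n B (?p i) * var n ^ i) = (\<Sum>i<d. if i = j then shear_hom n B p * var n ^ j else 0)"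
    by (rule sum.cong) (auto simp: shear_hom_zero)
  then have "shear_hom n B p * var n ^ j = (\<Sum>i<d. shear_hom n B (?p i) * var n ^ i)" using assms by simp
  then show ?thesis using assms unfolding low_deg_def by (intro CollectI exI[of _ ?p]) auto
qed

lemma low_deg_zero: "0 \<in> low_deg n B d"
  unfolding low_deg_def by (rule CollectI, rule exI[of _ "\<lambda>_. 0"]) (simp add: shear_hom_zero)

lemma low_deg_add:
  assumes "a \<in> low_deg n B d" "b \<in> low_deg n B d" shows "a + b \<in> low_deg n B d"
proof -
  obtain p q where p: "\<forall>j<d. p j \<in> T n \<and> nm (p j) \<le> 1" "a = (\<Sum>j<d. shear_hom n B (p j) * var n ^ j)"
    and q: "\<forall>j<d. q j \<in> T n \<and> nm (q j) \<le> 1" "b = (\<Sum>j<d. shear_hom n B (q j) * var n ^ j)"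
    using assms unfolding low_deg_def by blast
  have "a + b = (\<Sum>j<d. shear_hom n B (p j + q j) * var n ^ j)"
    unfolding p(2) q(2) sum.distrib[symmetric]
    by (rule sum.cong) (use p(1) q(1) in \<open>auto simp: shear_hom_add algebra_simps\<close>)
  moreover have "\<forall>j<d. p j + q j \<in> T n \<and> nm (p j + q j) \<le> 1" using p(1) q(1) nm_add_le by auto
  ultimately show ?thesis unfolding low_deg_def by (intro CollectI exI[of _ "\<lambda>j. p j + q j"]) auto
qed

lemma low_deg_sum: "(\<And>i. i \<in> S \<Longrightarrow> f i \<in> low_deg n B d) \<Longrightarrow> (\<Sum>i\<in>S. f i) \<in> low_deg n B d"
  by (induction S rule: infinite_finite_induct) (auto intro: low_deg_zero low_deg_add)

lemma low_deg_mono: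
  assumes "w \<in> low_deg n B d" "d \<le> d'" shows "w \<in> low_deg n B d'"
proof -
  obtain p where p: "\<forall>j<d. p j \<in> T n \<and> nm (p j) \<le> 1" "w = (\<Sum>j<d. shear_hom n B (p j) * var n ^ j)"
    using assms unfolding low_deg_def by blast
  show ?thesis unfolding p(2) by (rule low_deg_sum, rule low_deg_term) (use p(1) assms in auto)
qed

lemma low_deg_mult_hom:
  assumes q: "q \<in> T n" "nm q \<le> 1" and w: "w \<in> low_deg n B d"
  shows "shear_hom n B q * w \<in> low_deg n B d"
proof -
  obtain p where p: "\<forall>j<d. p j \<in> T n \<and> nm (p j) \<le> 1" "w = (\<Sum>j<d. shear_hom n B (p j) * var n ^ j)"
    using w unfolding low_deg_def by blast
  have "shear_hom n B q * w = (\<Sum>j<d. shear_hom n B (q * p j) * var n ^ j)"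
    unfolding p(2) sum_distrib_left
    by (rule sum.cong) (use p(1) q in \<open>auto simp: shear_hom_mult mult_ac\<close>)
  also have "\<dots> \<in> low_deg n B d"
    using p(1) q nm_mult_le[of q n _ 1 1] by (intro low_deg_sum low_deg_term) auto
  finally show ?thesis .
qed

lemma low_deg_power_mult:
  assumes w: "w \<in> low_deg n B d" shows "var n ^ a * w \<in> low_deg n B (a + d)"
proof -
  obtain p where p: "\<forall>j<d. p j \<in> T n \<and> nm (p j) \<le> 1" "w = (\<Sum>j<d. shear_hom n B (p j) * var n ^ j)"
    using w unfolding low_deg_def by blast
  have "var n ^ a * w = (\<Sum>j<d. shear_hom n B (p j) * var n ^ (a + j))"
    unfolding p(2) sum_distrib_left by (rule sum.cong) (auto simp: power_add mult_ac)
  also have "\<dots> \<in> low_deg n B (a + d)" using p(1) by (intro low_deg_sum low_deg_term) auto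
  finally show ?thesis .
qed

lemma low_deg_mult:
  assumes w: "w \<in> low_deg n B d" and u: "u \<in> low_deg n B d'"
  shows "w * u \<in> low_deg n B (d + d')"
proof -
  obtain p where p: "\<forall>j<d. p j \<in> T n \<and> nm (p j) \<le> 1" "w = (\<Sum>j<d. shear_hom n B (p j) * var n ^ j)"
    using w unfolding low_deg_def by blast
  have "w * u = (\<Sum>j<d. shear_hom n B (p j) * (var n ^ j * u))"
    unfolding p(2) sum_distrib_right by (rule sum.cong) (auto simp: mult_ac)
  also have "\<dots> \<in> low_deg n B (d + d')"
  proof (rule low_deg_sum)
    fix j assume j: "j \<in> {..<d}"
    have "var n ^ j * u \<in> low_deg n B (d + d')"
      by (rule low_deg_mono[OF low_deg_power_mult[OF u]]) (use j in simp)
    then show "shear_hom n B (p j) * (var n ^ j * u) \<in> low_deg n B (d + d')"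
      using p(1) j by (intro low_deg_mult_hom) auto
  qed
  finally show ?thesis .
qed

text \<open>Membership of \<open>z - var n ^ a\<close> in \<open>low_deg n B a\<close> is the
  encoding of \<open>z\<close> being a monic integral polynomial of degree \<open>a\<close> in
  \<open>var n\<close>.\<close>

lemma monic_mult:
  assumes "z - var n ^ a \<in> low_deg n B a" "w - var n ^ b \<in> low_deg n B b"
  shows "z * w - var n ^ (a + b) \<in> low_deg n B (a + b)"
proof -
  have "z * w - var n ^ (a + b) = (z - var n ^ a) * (w - var n ^ b) +
      var n ^ a * (w - var n ^ b) + var n ^ b * (z - var n ^ a)"
    by (simp add: power_add algebra_simps)
  also have "\<dots> \<in> low_deg n B (a + b)"
    using low_deg_mult[OF assms] low_deg_power_mult[OF assms(2)] low_deg_power_mult[OF assms(1), of b]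
    by (intro low_deg_add) (auto simp: add.commute)
  finally show ?thesis .
qed

lemma monic_power:
  assumes "z - var n ^ a \<in> low_deg n B a"
  shows "z ^ k - var n ^ (a * k) \<in> low_deg n B (a * k)"
  by (induction k) (use monic_mult[OF assms] in \<open>auto simp: low_deg_zero\<close>)

lemma monic_prod:
  assumes "\<And>i. i \<in> S \<Longrightarrow> z i - var n ^ a i \<in> low_deg n B (a i)"
  shows "(\<Prod>i\<in>S. z i) - var n ^ (\<Sum>i\<in>S. a i) \<in> low_deg n B (\<Sum>i\<in>S. a i)"
  using assms
  by (induction S rule: infinite_finite_induct) (auto simp: low_deg_zero intro: monic_mult)

lemma monic_mmon:
  assumes B: "B \<ge> 1" and m: "m \<in> multi_indices (Suc n)"
  shows "mmon 1 m - var n ^ shear_deg n B m \<in> low_deg n B (shear_deg n B m)"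
proof -
  have "var i - var n ^ (B ^ Suc i) \<in> low_deg n B (B ^ Suc i)" if "i < n" for i
    using low_deg_term[of "var i" n 0 "B ^ Suc i" B] that B by (simp add: shear_hom_var shear_def)
  then have "(\<Prod>i<n. var i ^ m i) - var n ^ (\<Sum>i<n. B ^ Suc i * m i) \<in> low_deg n B (\<Sum>i<n. B ^ Suc i * m i)"
    by (intro monic_prod monic_power) auto
  moreover have "var n ^ m n - var n ^ m n \<in> low_deg n B (m n)" by (simp add: low_deg_zero)
  ultimately have "(\<Prod>i<n. var i ^ m i) * var n ^ m n - var n ^ ((\<Sum>i<n. B ^ Suc i * m i) + m n)
      \<in> low_deg n B ((\<Sum>i<n. B ^ Suc i * m i) + m n)" by (rule monic_mult)
  moreover have "mmon 1 m = (\<Prod>i<n. var i ^ m i) * (var n ^ m n :: 'k mps)"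
    unfolding mmon_eq_pw[OF m] pw_def by (simp add: atLeast0LessThan)
  ultimately show ?thesis by (simp add: shear_deg_def add.commute)
qed

lemma shear_deg_inj:
  assumes "m \<in> multi_indices (Suc n)" "k \<in> multi_indices (Suc n)"
    and "\<And>i. i \<le> n \<Longrightarrow> m i < B" "\<And>i. i \<le> n \<Longrightarrow> k i < B" "shear_deg n B m = shear_deg n B k"
  shows "m = k"
proof -
  \<comment> \<open>The digits in order: the exponent of the last variable comes first, because it
    has weight 1.\<close>
  define r where "r = (\<lambda>m i. case i of 0 \<Rightarrow> m n | Suc j \<Rightarrow> (m j :: nat))"
  have deg: "shear_deg n B m = (\<Sum>i<Suc n. B ^ i * r m i)" for m
  proof -
    have "(\<Sum>i<Suc n. B ^ i * r m i) = B ^ 0 * r m 0 + (\<Sum>i<n. B ^ Suc i * r m (Suc i))"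
      by (rule sum.lessThan_Suc_shift)
    also have "\<dots> = shear_deg n B m" unfolding shear_deg_def r_def by simp
    finally show ?thesis by (rule sym)
  qed
  have lt: "r m i < B" "r k i < B" if "i < Suc n" for i
    using that assms(3,4) by (cases i; simp add: r_def)+
  have sums: "(\<Sum>i<Suc n. B ^ i * r m i) = (\<Sum>i<Suc n. B ^ i * r k i)"
    using assms(5) unfolding deg .
  have eq: "r m i = r k i" if "i < Suc n" for i
    using digits_unique[OF lt(1) lt(2) sums that] .
  show ?thesis
  proof
    fix i
    consider "i < n" | "i = n" | "i > n" by linarith
    then show "m i = k i"
    proof cases
      case 1 then show ?thesis using eq[of "Suc i"] by (simp add: r_def)
    next
      case 2 then show ?thesis using eq[of 0] by (simp add: r_def)
    next
      case 3 then show ?thesis using assms(1,2) by (simp add: multi_indices_def)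
    qed
  qed
qed

section \<open>Division with remainder modulo a maximal ideal\<close>

lemma nonzero_in_max_ideal:
  assumes M: "max_ideal (T (Suc n)) M"
  obtains f where "f \<in> M" "nm f = 1"
proof -
  note I = max_ideal_ideal[OF M]
  have x: "var n \<in> T (Suc n)" by simp
  obtain g where g: "g \<in> M" "g \<noteq> 0"
  proof (cases "var n \<in> M")
    case True
    moreover have "var n \<noteq> (0 :: 'k mps)" using nm_var[of n] nm_zero by (metis zero_neq_one)
    ultimately show ?thesis using that by blast
  next
    case False
    then obtain b where b: "b \<in> T (Suc n)" "var n * b - 1 \<in> M" using max_ideal_inverse[OF M x] by blast
    \<comment> \<open>Multiples of a variable have constant coefficient 0, so this element of
      \<open>M\<close> has constant coefficient -1.\<close>
    have "\<not> unit_idx n \<le> 0" by (auto simp: le_fun_def unit_idx_def)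
    then have "coef (var n * b - 1) 0 = - 1"
      unfolding var_def by (simp add: coef_mmon_mult[OF unit_idx_finite] coef_one)
    then have "var n * b - 1 \<noteq> 0" using coef_zero[of 0] by (metis neg_equal_0_iff_equal zero_neq_one)
    then show ?thesis using that b by blast
  qed
  obtain c where "nm (const (inverse c) * g) = 1" using T_scale[OF ideal_sub[OF I g(1)] g(2)] by blast
  moreover have "const (inverse c) * g \<in> M" by (rule ideal_mult[OF I _ g(1)]) simp
  ultimately show ?thesis using that by blast
qed

text \<open>After the shear, some \<open>f \<in> M\<close> becomes, up to a series of norm \<open>< 1\<close>, a monic polynomial
  of degree \<open>s\<close> in the last variable with integral coefficients.\<close>

lemma shear_exists:
  assumes M: "max_ideal (T (Suc n)) M"
  obtains B s \<epsilon> w m where "B \<ge> 1" "0 < \<epsilon>" "\<epsilon> < 1" "w \<in> low_deg n B s" "m \<in> M"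
    "nm (var n ^ s - w - m) \<le> \<epsilon>"
proof -
  note I = max_ideal_ideal[OF M]
  obtain f where f: "f \<in> M" "nm f = 1" using nonzero_in_max_ideal[OF M] by blast
  have fT: "f \<in> T (Suc n)" using ideal_sub[OF I f(1)] .
  define S where "S = {m. v (coef f m) \<ge> 1}"
  have S: "finite S" unfolding S_def using T_fin[OF fT] by simp
  have Sm: "S \<subseteq> multi_indices (Suc n)" unfolding S_def using T_coef[OF fT] by force
  have v1: "v (coef f m) = 1" if "m \<in> S" for m using that coef_le_nm[OF fT, of m] f by (simp add: S_def)
  obtain m0 where "v (coef f m0) = 1" using nm_attained[OF fT] f by metis
  then have "S \<noteq> {}" by (auto simp: S_def intro!: exI[of _ m0])
  \<comment> \<open>A base above every exponent of a dominant monomial of \<open>f\<close>. Then the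
    shear degrees of these monomials are distinct, and exactly one of them, that of \<mu>, is the
    largest.\<close>
  define B where "B = Suc (Max ((\<lambda>(m, i). m i) ` (S \<times> {..n})))"
  have mB: "m i < B" if "m \<in> S" "i \<le> n" for m i
    unfolding B_def less_Suc_eq_le using that S by (intro Max_ge) (auto intro!: image_eqI[of _ _ "(m, i)"])
  define s where "s = Max (shear_deg n B ` S)"
  have "s \<in> shear_deg n B ` S" unfolding s_def using S \<open>S \<noteq> {}\<close> by (intro Max_in) auto
  then obtain \<mu> where \<mu>: "\<mu> \<in> S" "shear_deg n B \<mu> = s" by auto
  have less: "shear_deg n B m < s" if "m \<in> S - {\<mu>}" for m
  proof -
    have "shear_deg n B m \<le> s" unfolding s_def using S that by (intro Max_ge) auto
    moreover have "shear_deg n B m \<noteq> s"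
      using shear_deg_inj[of m n \<mu> B] that \<mu> Sm mB by auto
    ultimately show ?thesis by simp
  qed
  have B1: "B \<ge> 1" by (simp add: B_def)
  define h where "h = f - (\<Sum>m\<in>S. mmon (coef f m) m)"
  have hT: "h \<in> T (Suc n)" unfolding h_def using fT Sm by (intro T_diff T_sum T_mmon) auto
  have "v (coef h p) < 1" for p
    using coef_le_nm[OF fT, of p] f S Sm by (auto simp: h_def coef_finite_part S_def)
  then have h1: "nm h < 1" using nm_attained[OF hT] by metis
  let ?c = "coef f \<mu>"
  have c: "v ?c = 1" using v1 \<mu> by simp
  then have c0: "?c \<noteq> 0" by auto
  \<comment> \<open>Everything of degree below \<open>s\<close> in the dominant part of
    \<open>f\<close>: the other monomials and the part of the monomial \<mu> below its leading
    power.\<close>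
  define w where "w = (\<Sum>m\<in>S - {\<mu>}. mmon (coef f m) m) + const ?c * (mmon 1 \<mu> - var n ^ s)"
  have constV: "const a * u \<in> low_deg n B s" if "v a \<le> 1" "u \<in> low_deg n B s" for a u
    using low_deg_mult_hom[of "const a" n u B s] that by (simp add: shear_hom_const nm_const)
  have wV: "w \<in> low_deg n B s"
    unfolding w_def
  proof (intro low_deg_add low_deg_sum)
    fix m assume m: "m \<in> S - {\<mu>}"
    have "mmon 1 m - var n ^ shear_deg n B m \<in> low_deg n B s"
      using low_deg_mono[OF monic_mmon[OF B1, of m n]] less[OF m] m Sm by (auto simp: less_imp_le)
    moreover have "var n ^ shear_deg n B m \<in> low_deg n B s"
      using low_deg_term[of 1 n "shear_deg n B m" s B] less[OF m] by (simp add: shear_hom_one)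
    ultimately have "mmon 1 m \<in> low_deg n B s" using low_deg_add by fastforce
    moreover have "m \<in> multi_indices (Suc n)" "v (coef f m) \<le> 1" using m Sm v1 by auto
    ultimately show "mmon (coef f m) m \<in> low_deg n B s"
      using constV[of "coef f m" "mmon 1 m"] mmon_eq_const_mult[of m "Suc n" "coef f m"] by simp
  next
    show "const ?c * (mmon 1 \<mu> - var n ^ s) \<in> low_deg n B s"
      using constV[of ?c] c monic_mmon[OF B1, of \<mu> n] \<mu> Sm by auto
  qed
  have inv: "const (inverse ?c) * const ?c = 1" using c0 by (simp add: const_mult)
  have "f - h = (\<Sum>m\<in>S. mmon (coef f m) m)" by (simp add: h_def)
  also have "\<dots> = mmon ?c \<mu> + (\<Sum>m\<in>S - {\<mu>}. mmon (coef f m) m)" using S \<mu> by (intro sum.remove) auto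
  also have "mmon ?c \<mu> = const ?c * mmon 1 \<mu>" using mmon_eq_const_mult \<mu> Sm by blast
  finally have "f - h = const ?c * var n ^ s + w" by (simp add: w_def algebra_simps)
  then have "const (inverse ?c) * (f - h - w) = const (inverse ?c) * const ?c * var n ^ s"
    by (simp add: mult.assoc)
  then have xs: "var n ^ s = const (inverse ?c) * (f - h - w)" by (simp add: inv)
  \<comment> \<open>The value 1/2 makes \<epsilon> positive also when \<open>h\<close> is 0.\<close>
  define \<epsilon> where "\<epsilon> = max (1/2) (nm h)"
  show ?thesis
  proof (rule that[of B \<epsilon>])
    show "const (- inverse ?c) * w \<in> low_deg n B s" using constV wV c by (simp add: v_inverse)
    show "const (inverse ?c) * f \<in> M" by (rule ideal_mult[OF I _ f(1)]) simp
    have "var n ^ s - const (- inverse ?c) * w - const (inverse ?c) * f = const (- inverse ?c) * h"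
      unfolding xs by (simp add: const_uminus[symmetric] algebra_simps)
    also have "nm \<dots> \<le> \<epsilon>" using nm_const_mult[OF hT] c by (simp add: v_inverse \<epsilon>_def)
    finally show "nm (var n ^ s - const (- inverse ?c) * w - const (inverse ?c) * f) \<le> \<epsilon>" .
  qed (use B1 h1 in \<open>auto simp: \<epsilon>_def\<close>)
qed

text \<open>Let \<open>G\<close> be the set of series that have low degree modulo \<open>M\<close>
  up to an error \<epsilon>. It contains 1 and \<open>var n ^ s\<close>, and it is closed under
  addition, integral sheared coefficients and multiplication by \<open>var n\<close>, hence under
  every \<open>var i\<close>. So it contains all integral monomials, thus the finite part of
  \<open>t\<close> with coefficients of size at least \<epsilon>, and the rest of \<open>t\<close>
  is small. By the ultrametric inequality the errors never accumulate.\<close>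

lemma approx_low_deg:
  assumes M: "max_ideal (T (Suc n)) M" and B: "B \<ge> 1" and \<epsilon>: "0 < \<epsilon>" "\<epsilon> < 1"
    and w0: "w0 \<in> low_deg n B s" "m0 \<in> M" "nm (var n ^ s - w0 - m0) \<le> \<epsilon>"
    and t: "t \<in> T (Suc n)" "nm t \<le> 1"
  obtains w m where "w \<in> low_deg n B s" "m \<in> M" "nm (t - w - m) \<le> \<epsilon>"
proof -
  note I = max_ideal_ideal[OF M]
  define G where "G = {t \<in> T (Suc n). \<exists>w\<in>low_deg n B s. \<exists>m\<in>M. nm (t - w - m) \<le> \<epsilon>}"
  have GT: "g \<in> T (Suc n)" if "g \<in> G" for g using that by (simp add: G_def)
  have G_add: "a + b \<in> G" if ab: "a \<in> G" "b \<in> G" for a b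
  proof -
    obtain w m w' m' where w: "w \<in> low_deg n B s" "m \<in> M" "nm (a - w - m) \<le> \<epsilon>"
      "w' \<in> low_deg n B s" "m' \<in> M" "nm (b - w' - m') \<le> \<epsilon>" using ab unfolding G_def by blast
    have "a + b - (w + w') - (m + m') = (a - w - m) + (b - w' - m')" by simp
    also have "nm \<dots> \<le> \<epsilon>"
      by (rule nm_add_le[of _ "Suc n"]) (use w GT ab low_deg_T ideal_sub[OF I] in auto)
    finally have "nm (a + b - (w + w') - (m + m')) \<le> \<epsilon>" .
    moreover have "w + w' \<in> low_deg n B s" "m + m' \<in> M" using w low_deg_add ideal_add[OF I] by simp_all
    moreover have "a + b \<in> T (Suc n)" using GT ab by simp
    ultimately show ?thesis unfolding G_def by blast
  qed
  have low_G: "w \<in> G" if "w \<in> low_deg n B s" for w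
    using that low_deg_T ideal_zero[OF I] \<epsilon> by (force simp: G_def)
  have M_G: "m \<in> G" if "m \<in> M" for m
    using that ideal_sub[OF I] \<epsilon> low_deg_zero by (force simp: G_def)
  have small_G: "a \<in> G" if "a \<in> T (Suc n)" "nm a \<le> \<epsilon>" for a
    using that ideal_zero[OF I] low_deg_zero[of n B s] by (force simp: G_def)
  have G_sum: "(\<Sum>i\<in>S. a i) \<in> G" if "\<And>i. i \<in> S \<Longrightarrow> a i \<in> G" for S :: "'z set" and a
    using that by (induction S rule: infinite_finite_induct) (auto intro: G_add M_G ideal_zero[OF I])
  have G_mult: "q * g \<in> G"
    if q: "q \<in> T (Suc n)" "nm q \<le> 1" "\<And>w. w \<in> low_deg n B s \<Longrightarrow> q * w \<in> G" and g: "g \<in> G" for q g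
  proof -
    obtain w m where w: "w \<in> low_deg n B s" "m \<in> M" "nm (g - w - m) \<le> \<epsilon>" using g unfolding G_def by blast
    have "nm (q * (g - w - m)) \<le> 1 * \<epsilon>"
      by (rule nm_mult_le[of _ "Suc n"]) (use w q GT g low_deg_T ideal_sub[OF I] in auto)
    then have "q * (g - w - m) \<in> G"
      using q w GT[OF g] low_deg_T ideal_sub[OF I] by (intro small_G T_mult T_diff) auto
    moreover have "q * g = q * (g - w - m) + q * w + q * m" by (simp add: algebra_simps)
    ultimately show ?thesis using q w ideal_mult[OF I q(1)] by (metis G_add M_G)
  qed
  have hom_G: "shear_hom n B q * g \<in> G" if "q \<in> T n" "nm q \<le> 1" "g \<in> G" for q g
    by (rule G_mult) (use that low_G low_deg_mult_hom shear_hom_T nm_shear_hom[of q n B] in auto)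
  have "var n ^ s \<in> G" using w0 by (auto simp: G_def)
  then have top: "shear_hom n B p * var n ^ j \<in> G" if "p \<in> T n" "nm p \<le> 1" "j \<le> s" for p j
    using that hom_G low_G low_deg_term by (cases "j = s") auto
  have x_G: "var n * g \<in> G" if "g \<in> G" for g
  proof (rule G_mult)
    fix w assume "w \<in> low_deg n B s"
    then obtain p where p: "\<forall>j<s. p j \<in> T n \<and> nm (p j) \<le> 1" "w = (\<Sum>j<s. shear_hom n B (p j) * var n ^ j)"
      unfolding low_deg_def by blast
    have "var n * w = (\<Sum>j<s. shear_hom n B (p j) * var n ^ Suc j)"
      unfolding p(2) sum_distrib_left by (rule sum.cong) (auto simp: mult_ac)
    then show "var n * w \<in> G" using p(1) by (simp only:) (intro G_sum top, auto)
  qed (use that in auto)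
  have xpow_G: "var n ^ k * g \<in> G" if "g \<in> G" for k g
    by (induction k) (use that x_G in \<open>auto simp: mult.assoc\<close>)
  have var_G: "var i * g \<in> G" if i: "i \<le> n" and g: "g \<in> G" for i g
  proof (cases "i = n")
    case False
    then have i': "i < n" using i by simp
    have "var i * g = shear_hom n B (var i) * g + var n ^ (B ^ Suc i) * g"
      using i' by (simp add: shear_hom_var shear_def algebra_simps)
    also have "\<dots> \<in> G" using i' g by (intro G_add hom_G xpow_G) auto
    finally show ?thesis .
  qed (use x_G g in simp)
  have varpow_G: "var i ^ k * g \<in> G" if "i \<le> n" "g \<in> G" for i k g
    by (induction k) (use that var_G in \<open>auto simp: mult.assoc\<close>)
  have prod_G: "(\<Prod>i\<in>S. var i ^ m i) * g \<in> G" if "g \<in> G" "S \<subseteq> {..n}" for S m g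
    using that(2)
    by (induction S rule: infinite_finite_induct) (use that(1) varpow_G in \<open>auto simp: mult.assoc\<close>)
  have one_G: "1 \<in> G" using top[of 1 0] by (simp add: shear_hom_one)
  have mmon_G: "mmon c m \<in> G" if m: "m \<in> multi_indices (Suc n)" and c: "v c \<le> 1" for c m
  proof -
    have "mmon 1 m = (\<Prod>i\<in>{0..<Suc n}. var i ^ m i) * (1 :: 'k mps)"
      unfolding mmon_eq_pw[OF m] pw_def by simp
    also have "\<dots> \<in> G" by (rule prod_G[OF one_G]) auto
    finally have "shear_hom n B (const c) * mmon 1 m \<in> G" using c by (intro hom_G) (auto simp: nm_const)
    then show ?thesis using mmon_eq_const_mult[OF m, of c] by (simp add: shear_hom_const)
  qed
  define F where "F = {m. v (coef t m) \<ge> \<epsilon>}"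
  have F: "finite F" "F \<subseteq> multi_indices (Suc n)"
    unfolding F_def using T_fin[OF t(1) \<epsilon>(1)] T_coef[OF t(1)] \<epsilon> by auto force
  let ?t = "\<Sum>m\<in>F. mmon (coef t m) m"
  have tG: "?t \<in> G"
    using F(2) t(2) coef_le_nm[OF t(1)] by (intro G_sum mmon_G) (auto intro: order_trans)
  have "nm (t - ?t) \<le> \<epsilon>"
    by (rule nm_leI) (use F \<epsilon> in \<open>auto simp: coef_finite_part F_def\<close>)
  then have "t - ?t \<in> G" using t GT[OF tG] by (intro small_G) auto
  then have "t \<in> G" using G_add[OF tG] by force
  then show ?thesis using that unfolding G_def by blast
qed

text \<open>After rescaling, \<open>approx_low_deg\<close> replaces any \<open>u\<close> by a
  remainder of norm at most \<epsilon> times that of \<open>u\<close>. Repeating this on the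
  remainders gives coefficients that are geometric series in \<open>T n\<close>.\<close>

lemma low_deg_generates:
  assumes M: "max_ideal (T (Suc n)) M" and B: "B \<ge> 1" and \<epsilon>: "0 < \<epsilon>" "\<epsilon> < 1"
    and w0: "w0 \<in> low_deg n B s" "m0 \<in> M" "nm (var n ^ s - w0 - m0) \<le> \<epsilon>"
    and t: "t \<in> T (Suc n)"
  obtains p where "\<And>j. j < s \<Longrightarrow> p j \<in> T n" "t - (\<Sum>j<s. shear_hom n B (p j) * var n ^ j) \<in> M"
proof -
  note I = max_ideal_ideal[OF M]
  let ?W = "\<lambda>p. \<Sum>j<s. shear_hom n B (p j) * var n ^ j"
  have WT: "?W p \<in> T (Suc n)" if "\<And>j. j < s \<Longrightarrow> p j \<in> T n" for p
    using that by (auto intro!: T_sum T_mult shear_hom_T)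
  have "\<exists>p m. (\<forall>j<s. p j \<in> T n \<and> nm (p j) \<le> nm u) \<and> m \<in> M \<and> nm (u - ?W p - m) \<le> \<epsilon> * nm u"
    if u: "u \<in> T (Suc n)" for u
  proof (cases "u = 0")
    case True
    then show ?thesis using ideal_zero[OF I]
      by (intro exI[of _ "\<lambda>_. 0"] exI[of _ 0]) (simp add: shear_hom_zero)
  next
    case False
    then obtain c where c: "c \<noteq> 0" "v c = nm u" "nm (const (inverse c) * u) = 1" using T_scale[OF u] by metis
    have inv: "const c * (const (inverse c) * a) = a" for a
      using c(1) by (simp add: const_mult flip: mult.assoc)
    obtain w m where w: "w \<in> low_deg n B s" "m \<in> M" "nm (const (inverse c) * u - w - m) \<le> \<epsilon>"
      using approx_low_deg[OF M B \<epsilon> w0, of "const (inverse c) * u"] u c(3) by auto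
    obtain p where p: "\<forall>j<s. p j \<in> T n \<and> nm (p j) \<le> 1" "w = ?W p" using w(1) unfolding low_deg_def by blast
    have "const c * w = ?W (\<lambda>j. const c * p j)"
      unfolding p(2) sum_distrib_left
      by (rule sum.cong) (use p(1) in \<open>auto simp: shear_hom_mult shear_hom_const mult_ac\<close>)
    then have "u - ?W (\<lambda>j. const c * p j) - const c * m = const c * (const (inverse c) * u - w - m)"
      using inv[of u] by (simp add: right_diff_distrib)
    then have "nm (u - ?W (\<lambda>j. const c * p j) - const c * m) \<le> nm u * \<epsilon>"
      using w u low_deg_T[OF w(1)] ideal_sub[OF I w(2)] c
      by (simp add: nm_const_mult[of _ "Suc n"] mult_left_mono nm_nonneg)
    moreover have "nm (const c * p j) \<le> nm u" if "j < s" for j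
      using p(1) that c nm_const_mult[of "p j" n c] nm_nonneg[OF u] by (simp add: mult_left_le)
    ultimately show ?thesis using p(1) ideal_mult[OF I T_const w(2), of c]
      by (intro exI[of _ "\<lambda>j. const c * p j"] exI[of _ "const c * m"]) (auto simp: mult.commute)
  qed
  then have "\<forall>u. \<exists>q. u \<in> T (Suc n) \<longrightarrow> (\<forall>j<s. fst q j \<in> T n \<and> nm (fst q j) \<le> nm u) \<and> snd q \<in> M \<and>
      nm (u - ?W (fst q) - snd q) \<le> \<epsilon> * nm u" by simp
  from choice[OF this] obtain Q where
    Q: "\<forall>u. u \<in> T (Suc n) \<longrightarrow> (\<forall>j<s. fst (Q u) j \<in> T n \<and> nm (fst (Q u) j) \<le> nm u) \<and>
      snd (Q u) \<in> M \<and> nm (u - ?W (fst (Q u)) - snd (Q u)) \<le> \<epsilon> * nm u" by (rule exE)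
  define P m where "P u = fst (Q u)" and "m u = snd (Q u)" for u
  have P: "\<And>u j. u \<in> T (Suc n) \<Longrightarrow> j < s \<Longrightarrow> P u j \<in> T n \<and> nm (P u j) \<le> nm u"
    and m: "\<And>u. u \<in> T (Suc n) \<Longrightarrow> m u \<in> M \<and> nm (u - ?W (P u) - m u) \<le> \<epsilon> * nm u"
    using Q unfolding P_def m_def by simp_all
  define r where "r = rec_nat t (\<lambda>_ u. u - ?W (P u) - m u)"
  have r0: "r 0 = t" and rS: "r (Suc k) = r k - ?W (P (r k)) - m (r k)" for k by (simp_all add: r_def)
  have r: "r k \<in> T (Suc n)" "nm (r k) \<le> nm t * \<epsilon> ^ k" for k
  proof -
    have "r k \<in> T (Suc n) \<and> nm (r k) \<le> nm t * \<epsilon> ^ k"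
    proof (induction k)
      case (Suc k)
      have "nm (r (Suc k)) \<le> \<epsilon> * nm (r k)" using m[of "r k"] Suc by (simp add: rS)
      also have "\<dots> \<le> \<epsilon> * (nm t * \<epsilon> ^ k)" using Suc \<epsilon> by (intro mult_left_mono) auto
      finally have "nm (r (Suc k)) \<le> nm t * \<epsilon> ^ Suc k" by (simp add: mult_ac)
      moreover have "r (Suc k) \<in> T (Suc n)"
        unfolding rS using Suc P m ideal_sub[OF I] by (intro T_diff WT) auto
      ultimately show ?case by blast
    qed (use t r0 in simp)
    then show "r k \<in> T (Suc n)" "nm (r k) \<le> nm t * \<epsilon> ^ k" by auto
  qed
  have "\<exists>F. F \<in> T n \<and> (\<forall>K. nm ((\<Sum>k<K. P (r k) j) - F) \<le> nm t * \<epsilon> ^ K)" if j: "j < s" for j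
  proof -
    have "nm (P (r k) j) \<le> nm t * \<epsilon> ^ k" for k using P[OF r(1) j, of k] r(2)[of k] by linarith
    then obtain F where "F \<in> T n" "\<And>K. nm ((\<Sum>k<K. P (r k) j) - F) \<le> nm t * \<epsilon> ^ K"
      using T_geometric_series[of "\<lambda>k. P (r k) j" n "nm t" \<epsilon>] P[OF r(1) j] \<epsilon> by auto
    then show ?thesis by blast
  qed
  then obtain F where F: "\<And>j. j < s \<Longrightarrow> F j \<in> T n"
    "\<And>j K. j < s \<Longrightarrow> nm ((\<Sum>k<K. P (r k) j) - F j) \<le> nm t * \<epsilon> ^ K" by metis
  have partial: "t = (\<Sum>k<K. ?W (P (r k))) + (\<Sum>k<K. m (r k)) + r K" for K
    by (induction K) (simp_all add: r0 rS)
  \<comment> \<open>The contributions from \<open>M\<close> enter only through their finite partial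
    sums; closedness of \<open>M\<close> takes care of the limit.\<close>
  have "t - ?W F \<in> M"
  proof (rule max_ideal_closed[OF M])
    fix d :: real assume d: "d > 0"
    have "(\<lambda>K. nm t * \<epsilon> ^ K) \<longlonglongrightarrow> nm t * 0"
      by (intro tendsto_mult tendsto_const LIMSEQ_power_zero) (use \<epsilon> in auto)
    then have "eventually (\<lambda>K. nm t * \<epsilon> ^ K < d) sequentially" using d by (simp add: order_tendstoD)
    then obtain K where K: "nm t * \<epsilon> ^ K < d" unfolding eventually_sequentially by blast
    have "(\<Sum>k<K. ?W (P (r k))) = (\<Sum>j<s. (\<Sum>k<K. shear_hom n B (P (r k) j) * var n ^ j))"
      by (rule sum.swap)
    also have "\<dots> = ?W (\<lambda>j. \<Sum>k<K. P (r k) j)"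
      by (rule sum.cong) (use P[OF r(1)] in \<open>auto simp: shear_hom_sum sum_distrib_right\<close>)
    finally have "t - ?W F - (\<Sum>k<K. m (r k)) = ?W (\<lambda>j. \<Sum>k<K. P (r k) j) - ?W F + r K"
      using partial[of K] by simp
    also have "?W (\<lambda>j. \<Sum>k<K. P (r k) j) - ?W F = ?W (\<lambda>j. (\<Sum>k<K. P (r k) j) - F j)"
      unfolding sum_subtractf[symmetric]
      by (rule sum.cong) (use P[OF r(1)] F in \<open>auto simp: shear_hom_diff T_sum left_diff_distrib\<close>)
    also have "nm (\<dots> + r K) \<le> d"
    proof (rule nm_add_le)
      show "nm (?W (\<lambda>j. (\<Sum>k<K. P (r k) j) - F j)) \<le> d"
      proof (rule nm_sum_le)
        fix j assume j: "j \<in> {..<s}"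
        have T: "(\<Sum>k<K. P (r k) j) - F j \<in> T n" using P[OF r(1)] F j by (auto intro!: T_sum T_diff)
        then show "shear_hom n B ((\<Sum>k<K. P (r k) j) - F j) * var n ^ j \<in> T (Suc n)"
          by (intro T_mult shear_hom_T) auto
        have "nm (shear_hom n B ((\<Sum>k<K. P (r k) j) - F j) * var n ^ j) \<le> d * 1"
        proof (rule nm_mult_le[OF shear_hom_T[OF T]])
          show "nm (shear_hom n B ((\<Sum>k<K. P (r k) j) - F j)) \<le> d"
            using nm_shear_hom[OF T, of B] F(2)[of j K] j K by simp
        qed (auto simp: nm_var_power_le)
        then show "nm (shear_hom n B ((\<Sum>k<K. P (r k) j) - F j) * var n ^ j) \<le> d" by simp
      qed (use d in simp)
      show "nm (r K) \<le> d" using r(2)[of K] K by simp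
    qed (use r(1) P[OF r(1)] F in \<open>auto intro!: T_sum T_diff T_mult shear_hom_T\<close>)
    finally show "\<exists>m\<in>M. nm (t - ?W F - m) \<le> d"
      using m[OF r(1)] by (intro bexI[of _ "\<Sum>k<K. m (r k)"] ideal_sum[OF I]) auto
  qed (use t F in \<open>auto intro!: WT T_diff\<close>)
  then show ?thesis using that F by blast
qed

text \<open>Modulo \<open>M\<close>, the powers of \<open>var n\<close> below \<open>s\<close>
  generate \<open>T (Suc n)\<close> over the sheared copy of \<open>T n\<close>. By
  \<open>max_ideal_Int_finite\<close> the intersection of \<open>M\<close> with that copy is
  maximal, and so is its preimage in \<open>T n\<close>. The induction hypothesis gives a finite
  spanning set for the preimage; its products with the powers of \<open>var n\<close> span.\<close>

lemma max_ideal_fin_dim: "max_ideal (T n) M \<Longrightarrow> fin_dim n M"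
proof (induction n arbitrary: M)
  case 0
  note I = max_ideal_ideal[OF 0]
  have "t = const (coef t 0) * 1" if "t \<in> T 0" for t
  proof (rule mps_eqI)
    fix m :: "nat \<Rightarrow> nat"
    have "m \<notin> multi_indices 0" if "m \<noteq> 0" using that by (auto simp: multi_indices_def)
    then show "coef t m = coef (const (coef t 0) * 1) m"
      using T_coef[OF that, of m] by (cases "m = 0") (simp_all add: coef_one coef_const)
  qed
  then have "T 0 \<subseteq> lspan {1} M"
    using lspan_scale[OF I T_const lspan_base[OF I, of "{1}" 1]] by (metis finite.emptyI finite.insertI insertI1 subsetI)
  then show ?case unfolding fin_dim_def by (intro exI[of _ "{1}"]) auto
next
  case (Suc n)
  note M = Suc.prems and I = max_ideal_ideal[OF Suc.prems]
  obtain B s \<epsilon> w m where *: "B \<ge> 1" "0 < \<epsilon>" "\<epsilon> < 1" "w \<in> low_deg n B s" "m \<in> M"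
    "nm (var n ^ s - w - m) \<le> \<epsilon>" by (rule shear_exists[OF M])
  note gen = low_deg_generates[OF M *]
  let ?h = "shear_hom n B"
  have R': "sub_ring (?h ` T n)"
    unfolding sub_ring_def
  proof (intro conjI ballI)
    show "1 \<in> ?h ` T n" using shear_hom_one[of n B] by (metis T_one imageI)
    fix a b assume "a \<in> ?h ` T n" "b \<in> ?h ` T n"
    then obtain p q where "p \<in> T n" "q \<in> T n" "a = ?h p" "b = ?h q" by blast
    then show "a - b \<in> ?h ` T n" "a * b \<in> ?h ` T n"
      using shear_hom_diff[of p n q B] shear_hom_mult[of p n q B] by (metis T_diff imageI, metis T_mult imageI)
  qed
  have M': "max_ideal (?h ` T n) (M \<inter> ?h ` T n)"
  proof (rule max_ideal_Int_finite[OF T_sub_ring R' _ M, where s = s and e = "\<lambda>j. var n ^ j"])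
    fix t assume "t \<in> T (Suc n)"
    then obtain p where "\<And>j. j < s \<Longrightarrow> p j \<in> T n" "t - (\<Sum>j<s. ?h (p j) * var n ^ j) \<in> M"
      using gen by blast
    then show "\<exists>r. (\<forall>j<s. r j \<in> ?h ` T n) \<and> t - (\<Sum>j<s. r j * var n ^ j) \<in> M"
      by (intro exI[of _ "\<lambda>j. ?h (p j)"]) auto
  qed (auto intro: shear_hom_T)
  let ?M = "{p \<in> T n. ?h p \<in> M}"
  have "max_ideal (T n) ?M"
    unfolding max_ideal_def ideal_in_def
  proof (intro conjI ballI)
    show "0 \<in> ?M" using ideal_zero[OF I] by (simp add: shear_hom_zero)
    show "1 \<notin> ?M" using max_ideal_one[OF M] by (simp add: shear_hom_one)
    show "a + b \<in> ?M" if "a \<in> ?M" "b \<in> ?M" for a b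
      using that ideal_add[OF I] by (auto simp: shear_hom_add)
    show "r * a \<in> ?M" if "r \<in> T n" "a \<in> ?M" for r a
      using that ideal_mult[OF I] shear_hom_T by (auto simp: shear_hom_mult)
    fix a assume a: "a \<in> T n - ?M"
    then obtain b where "b \<in> T n" "?h a * ?h b - 1 \<in> M"
      using max_ideal_inverse[OF M', of "?h a"] by auto
    then show "\<exists>b\<in>T n. a * b - 1 \<in> ?M"
      using a by (intro bexI[of _ b]) (auto simp: shear_hom_diff shear_hom_mult shear_hom_one)
  qed auto
  from Suc.IH[OF this] obtain E where E: "finite E" "E \<subseteq> T n" "T n \<subseteq> lspan E ?M" unfolding fin_dim_def by blast
  let ?E = "(\<lambda>(e, j). ?h e * var n ^ j) ` (E \<times> {..<s})"
  have fin: "finite ?E" using E by simp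
  have hom_span: "?h p * var n ^ j \<in> lspan ?E M" if p: "p \<in> T n" and j: "j < s" for p j
  proof -
    obtain c where c: "p - (\<Sum>e\<in>E. const (c e) * e) \<in> ?M" using E(3) p by (auto simp: lspan_def)
    have "?h (p - (\<Sum>e\<in>E. const (c e) * e)) = ?h p - (\<Sum>e\<in>E. ?h (const (c e) * e))"
      using p E(2) by (subst shear_hom_diff) (auto simp: shear_hom_sum subset_iff intro!: T_sum)
    also have "\<dots> = ?h p - (\<Sum>e\<in>E. const (c e) * ?h e)"
      using E(2) by (auto simp: shear_hom_mult shear_hom_const subset_iff intro!: sum.cong)
    finally have "?h p - (\<Sum>e\<in>E. const (c e) * ?h e) \<in> M" using c by simp
    then have 1: "(?h p - (\<Sum>e\<in>E. const (c e) * ?h e)) * var n ^ j \<in> M"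
      by (intro ideal_mult'[OF I]) auto
    have 2: "(\<Sum>e\<in>E. const (c e) * (?h e * var n ^ j)) \<in> lspan ?E M"
      by (intro lspan_sum[OF I] lspan_scale[OF I T_const] lspan_base[OF I fin]) (use j in auto)
    have eq: "?h p * var n ^ j =
        (?h p - (\<Sum>e\<in>E. const (c e) * ?h e)) * var n ^ j + (\<Sum>e\<in>E. const (c e) * (?h e * var n ^ j))"
      by (simp add: algebra_simps sum_distrib_left)
    show ?thesis by (subst eq) (rule lspan_add[OF I lspan_ideal[OF 1] 2])
  qed
  have "t \<in> lspan ?E M" if t: "t \<in> T (Suc n)" for t
  proof -
    obtain p where p: "\<And>j. j < s \<Longrightarrow> p j \<in> T n" "t - (\<Sum>j<s. ?h (p j) * var n ^ j) \<in> M" using gen[OF t] by blast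
    have "(\<Sum>j<s. ?h (p j) * var n ^ j) \<in> lspan ?E M"
      using p(1) hom_span by (intro lspan_sum[OF I]) auto
    from lspan_add[OF I lspan_ideal[OF p(2)] this] show ?thesis by simp
  qed
  moreover have "?E \<subseteq> T (Suc n)" using E(2) by (auto intro!: shear_hom_T T_mult)
  ultimately show ?case using fin unfolding fin_dim_def by blast
qed

end

text \<open>A constant factor disappears on taking k-th roots. This turns equivalent
  power-multiplicative norms into equal ones.\<close>

lemma le_of_powers_le:
  fixes x y C :: real
  assumes "0 \<le> x" "0 \<le> y" "\<And>k. x ^ k \<le> C * y ^ k"
  shows "x \<le> y"
proof (rule ccontr)
  assume "\<not> x \<le> y"
  show False
  proof (cases "y = 0")
    case True
    then show ?thesis using assms(3)[of 1] \<open>\<not> x \<le> y\<close> by simp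
  next
    case False
    then have y: "y > 0" using assms(2) by simp
    then have "1 < x / y" using \<open>\<not> x \<le> y\<close> by simp
    then obtain k where "C < (x / y) ^ k" using real_arch_pow by blast
    then show ?thesis using assms(3)[of k] y by (simp add: power_divide pos_less_divide_eq)
  qed
qed

context complete_nonarch_field
begin

section \<open>The absolute value of a residue field\<close>

text \<open>Power-multiplicative norms on the residue field of \<open>M\<close>, seen as functions on \<open>T n\<close>.\<close>

definition pm_norm :: "nat \<Rightarrow> 'k mps set \<Rightarrow> ('k mps \<Rightarrow> real) \<Rightarrow> bool" where
  "pm_norm n M w \<longleftrightarrow>
    (\<forall>a\<in>T n. 0 \<le> w a \<and> (w a = 0 \<longleftrightarrow> a \<in> M)) \<and>
    (\<forall>a\<in>T n. \<forall>b\<in>T n. w (a + b) \<le> max (w a) (w b) \<and> w (a * b) \<le> w a * w b) \<and>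
    (\<forall>a\<in>T n. \<forall>k. w (a ^ k) = w a ^ k) \<and>
    (\<forall>c. \<forall>a\<in>T n. w (const c * a) = v c * w a)"

definition abs_val :: "nat \<Rightarrow> 'k mps set \<Rightarrow> ('k mps \<Rightarrow> real) \<Rightarrow> bool" where
  "abs_val n M w \<longleftrightarrow>
    (\<forall>a\<in>T n. 0 \<le> w a \<and> (w a = 0 \<longleftrightarrow> a \<in> M)) \<and>
    (\<forall>a\<in>T n. \<forall>b\<in>T n. w (a + b) \<le> max (w a) (w b) \<and> w (a * b) = w a * w b) \<and>
    (\<forall>c. w (const c) = v c)"

lemma
  assumes "pm_norm n M w"
  shows pm_nonneg: "a \<in> T n \<Longrightarrow> 0 \<le> w a"
    and pm_zero_iff: "a \<in> T n \<Longrightarrow> w a = 0 \<longleftrightarrow> a \<in> M"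
    and pm_add: "a \<in> T n \<Longrightarrow> b \<in> T n \<Longrightarrow> w (a + b) \<le> max (w a) (w b)"
    and pm_mult: "a \<in> T n \<Longrightarrow> b \<in> T n \<Longrightarrow> w (a * b) \<le> w a * w b"
    and pm_power: "a \<in> T n \<Longrightarrow> w (a ^ k) = w a ^ k"
    and pm_const: "a \<in> T n \<Longrightarrow> w (const c * a) = v c * w a"
  using assms by (auto simp: pm_norm_def)

lemma
  assumes "abs_val n M w"
  shows abs_val_nonneg: "a \<in> T n \<Longrightarrow> 0 \<le> w a"
    and abs_val_zero_iff: "a \<in> T n \<Longrightarrow> w a = 0 \<longleftrightarrow> a \<in> M"
    and abs_val_add: "a \<in> T n \<Longrightarrow> b \<in> T n \<Longrightarrow> w (a + b) \<le> max (w a) (w b)"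
    and abs_val_mult: "a \<in> T n \<Longrightarrow> b \<in> T n \<Longrightarrow> w (a * b) = w a * w b"
    and abs_val_const: "w (const c) = v c"
  using assms by (auto simp: abs_val_def)

lemma abs_val_power: "abs_val n M w \<Longrightarrow> a \<in> T n \<Longrightarrow> w (a ^ k) = w a ^ k"
proof (induction k)
  case 0
  then show ?case using abs_val_const[OF 0(1), of 1] by simp
qed (simp add: abs_val_mult)

lemma abs_val_sum_le:
  assumes "abs_val n M w" "\<And>i. i \<in> S \<Longrightarrow> f i \<in> T n" "\<And>i. i \<in> S \<Longrightarrow> w (f i) \<le> B" "0 \<le> B"
  shows "w (\<Sum>i\<in>S. f i) \<le> B"
  using assms(2-)
proof (induction S rule: infinite_finite_induct)
  case (insert x S)
  have "w (f x + (\<Sum>i\<in>S. f i)) \<le> max (w (f x)) (w (\<Sum>i\<in>S. f i))"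
    using insert by (intro abs_val_add[OF assms(1)] T_sum) auto
  also have "\<dots> \<le> B" using insert by (intro max.boundedI) auto
  finally show ?case using insert by simp
qed (use abs_val_const[OF assms(1), of 0] in auto)

lemma abs_val_imp_pm_norm: "abs_val n M w \<Longrightarrow> pm_norm n M w"
  unfolding pm_norm_def
  by (simp add: abs_val_nonneg abs_val_zero_iff abs_val_add abs_val_mult abs_val_power abs_val_const)

lemma pm_uminus: "pm_norm n M w \<Longrightarrow> a \<in> T n \<Longrightarrow> w (- a) = w a"
  using pm_const[of n M w a "- 1"] by (simp flip: const_uminus)

lemma pm_diff: "pm_norm n M w \<Longrightarrow> a \<in> T n \<Longrightarrow> b \<in> T n \<Longrightarrow> w (a - b) \<le> max (w a) (w b)"
  using pm_add[of n M w a "- b"] pm_uminus[of n M w b] by simp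

lemma pm_cong:
  assumes w: "pm_norm n M w" and T: "a \<in> T n" "b \<in> T n" and ab: "a - b \<in> M"
  shows "w a = w b"
proof -
  have 0: "w (a - b) = 0" using ab T pm_zero_iff[OF w, of "a - b"] by simp
  have "w a \<le> max (w (a - b)) (w b)" using pm_add[OF w, of "a - b" b] T by simp
  moreover have "w b \<le> max (w a) (w (a - b))" using pm_diff[OF w, of a "a - b"] T by simp
  ultimately show ?thesis using 0 pm_nonneg[OF w T(1)] pm_nonneg[OF w T(2)] by auto
qed

lemma pm_sum_le:
  assumes w: "pm_norm n M w" and I: "ideal_in (T n) M"
    and "\<And>i. i \<in> S \<Longrightarrow> f i \<in> T n" "\<And>i. i \<in> S \<Longrightarrow> w (f i) \<le> B" "0 \<le> B"
  shows "w (\<Sum>i\<in>S. f i) \<le> B"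
  using assms(3-)
proof (induction S rule: infinite_finite_induct)
  case (insert x S)
  have "w (f x + (\<Sum>i\<in>S. f i)) \<le> max (w (f x)) (w (\<Sum>i\<in>S. f i))"
    using insert by (intro pm_add[OF w] T_sum) auto
  also have "\<dots> \<le> B" using insert by (intro max.boundedI) auto
  finally show ?case using insert by simp
qed (use pm_zero_iff[OF w, of 0] ideal_zero[OF I] in auto)

subsection \<open>Uniqueness\<close>

lemma pm_coefficient_bound:
  assumes w: "pm_norm n M w" and I: "ideal_in (T n) M"
    and E: "finite E" "E \<subseteq> T n"
    and indep: "\<And>c. (\<Sum>e\<in>E. const (c e) * e) \<in> M \<Longrightarrow> \<forall>e\<in>E. c e = 0"
  shows "\<exists>C>0. \<forall>c. \<forall>e\<in>E. v (c e) \<le> C * w (\<Sum>e\<in>E. const (c e) * e)"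
  using E indep
proof (induction E rule: finite_induct)
  case empty
  show ?case by (intro exI[of _ 1]) auto
next
  case (insert x F)
  have x: "x \<in> T n" and F: "F \<subseteq> T n" using insert.prems by auto
  let ?S = "\<lambda>c. \<Sum>e\<in>F. const (c e) * e"
  have ST: "?S c \<in> T n" for c using F by (auto intro!: T_sum T_mult)
  have S_diff: "?S c - ?S d = ?S (\<lambda>e. c e - d e)" for c d
    by (simp add: const_diff[symmetric] left_diff_distrib sum_subtractf)
  have "\<forall>e\<in>F. c e = 0" if "?S c \<in> M" for c
  proof -
    have "(\<Sum>e\<in>insert x F. const ((c(x := 0)) e) * e) = ?S c"
      using insert.hyps by (auto intro!: sum.cong)
    then have 0: "\<forall>e\<in>insert x F. (c(x := 0)) e = 0" using insert.prems(2)[of "c(x := 0)"] that by simp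
    show ?thesis
    proof
      fix e assume "e \<in> F"
      then show "c e = 0" using bspec[OF 0, of e] insert.hyps by (cases "e = x") auto
    qed
  qed
  then obtain C where C: "C > 0" "\<And>c e. e \<in> F \<Longrightarrow> v (c e) \<le> C * w (?S c)"
    using insert.IH F by blast
  \<comment> \<open>\<open>x\<close> has positive distance from the span of \<open>F\<close>.
    Otherwise combinations of \<open>F\<close> approximate \<open>x\<close>; their differences are
    small, so by induction their coefficients are Cauchy. By completeness of the base field they
    converge, and the limit is a relation that contradicts independence.\<close>
  have "\<exists>\<delta>>0. \<forall>c. \<delta> \<le> w (x - ?S c)"
  proof (rule ccontr)
    assume "\<not> ?thesis"
    then have "\<exists>c. w (x - ?S c) < 1 / real (Suc k)" for k
      by (metis not_le of_nat_0_less_iff zero_less_Suc zero_less_divide_1_iff)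
    then obtain c where c: "\<And>k. w (x - ?S (c k)) < 1 / real (Suc k)" by metis
    have cauchy: "v (c i e - c j e) \<le> C * (1 / real (Suc K))" if "e \<in> F" "K \<le> i" "K \<le> j" for i j K e
    proof -
      have small: "w (x - ?S (c i)) \<le> 1 / real (Suc K)" if "K \<le> i" for i
        using c[of i] that by (meson frac_le less_imp_le of_nat_0_less_iff of_nat_mono order_refl order_trans Suc_le_mono zero_le_one zero_less_Suc)
      have "v (c i e - c j e) \<le> C * w (?S (\<lambda>e. c i e - c j e))" by (rule C(2)[OF \<open>e \<in> F\<close>])
      also have "?S (\<lambda>e. c i e - c j e) = (x - ?S (c j)) - (x - ?S (c i))" by (simp flip: S_diff)
      also have "w \<dots> \<le> max (w (x - ?S (c j))) (w (x - ?S (c i)))"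
        by (rule pm_diff[OF w]) (use x ST in auto)
      also have "\<dots> \<le> 1 / real (Suc K)" using small that by simp
      finally show ?thesis using C(1) by simp
    qed
    have "\<exists>L. (\<lambda>k. v (c k e - L)) \<longlonglongrightarrow> 0" if e: "e \<in> F" for e
    proof (rule complete, intro allI impI)
      fix d :: real assume d: "d > 0"
      obtain K where K: "C / d < real K" using reals_Archimedean2 by blast
      have "C * (1 / real (Suc K)) < d"
        using K d by (simp add: field_simps)
      then show "\<exists>N. \<forall>i\<ge>N. \<forall>j\<ge>N. v (c i e - c j e) < d"
        using cauchy[OF e] by (meson le_less_trans)
    qed
    then obtain L where L: "\<And>e. e \<in> F \<Longrightarrow> (\<lambda>k. v (c k e - L e)) \<longlonglongrightarrow> 0" by metis
    have "w (x - ?S L) \<le> 0"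
    proof (rule field_le_epsilon)
      fix d :: real assume d: "d > 0"
      have "(\<lambda>k. v (c k e - L e) * w e) \<longlonglongrightarrow> 0 * w e" if "e \<in> F" for e
        by (intro tendsto_mult tendsto_const L that)
      then have "\<forall>e\<in>F. eventually (\<lambda>k. v (c k e - L e) * w e < d) sequentially"
        using d by (auto intro!: order_tendstoD(2))
      then have "eventually (\<lambda>k. \<forall>e\<in>F. v (c k e - L e) * w e < d) sequentially"
        by (rule eventually_ball_finite[OF insert.hyps(1)])
      moreover have "eventually (\<lambda>k. 1 / real (Suc k) < d) sequentially"
        using d LIMSEQ_inverse_real_of_nat by (auto simp: inverse_eq_divide intro!: order_tendstoD(2))
      ultimately have "eventually (\<lambda>k. (\<forall>e\<in>F. v (c k e - L e) * w e < d) \<and> 1 / real (Suc k) < d) sequentially"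
        by (rule eventually_conj)
      then obtain k where k: "\<forall>e\<in>F. v (c k e - L e) * w e < d" "1 / real (Suc k) < d"
        unfolding eventually_sequentially by blast
      have A: "w (?S (\<lambda>e. c k e - L e)) \<le> d"
        using k F d by (intro pm_sum_le[OF w I]) (auto simp: pm_const[OF w] subset_iff less_imp_le)
      have B: "w (x - ?S (c k)) \<le> d" using c[of k] k by simp
      have eq: "x - ?S L = (x - ?S (c k)) + ?S (\<lambda>e. c k e - L e)" by (simp flip: S_diff)
      have "w (x - ?S L) \<le> max (w (x - ?S (c k))) (w (?S (\<lambda>e. c k e - L e)))"
        unfolding eq by (rule pm_add[OF w T_diff[OF x ST] ST])
      also have "\<dots> \<le> d" by (rule max.boundedI[OF B A])
      finally show "w (x - ?S L) \<le> 0 + d" by simp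
    qed
    then have "x - ?S L \<in> M"
      using pm_zero_iff[OF w, of "x - ?S L"] pm_nonneg[OF w, of "x - ?S L"] x ST by fastforce
    moreover have "(\<Sum>e\<in>insert x F. const (((\<lambda>e. - L e)(x := 1)) e) * e) = x - ?S L"
    proof -
      have "(\<Sum>e\<in>F. const (((\<lambda>e. - L e)(x := 1)) e) * e) = (\<Sum>e\<in>F. - (const (L e) * e))"
        by (rule sum.cong) (use insert.hyps in \<open>auto simp flip: const_uminus\<close>)
      then show ?thesis using insert.hyps by (simp add: sum_negf)
    qed
    ultimately have "((\<lambda>e. - L e)(x := 1)) x = 0" using insert.prems(2)[of "(\<lambda>e. - L e)(x := 1)"] by simp
    then show False by simp
  qed
  then obtain \<delta> where \<delta>: "\<delta> > 0" "\<And>c. \<delta> \<le> w (x - ?S c)" by blast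
  \<comment> \<open>The first bound is for the coefficient of \<open>x\<close>, which is at most
    \<open>w s / \<delta>\<close> for the whole sum \<open>s\<close>. The second is for the others:
    the sum over \<open>F\<close> is \<open>s\<close> minus the term at \<open>x\<close>, to which
    the constant \<open>C\<close> of the induction applies.\<close>
  let ?C = "max (1 / \<delta>) (C * (1 + w x / \<delta>))"
  have wx: "0 \<le> w x" using pm_nonneg[OF w x] .
  have "\<forall>e\<in>insert x F. v (c e) \<le> ?C * w (\<Sum>e\<in>insert x F. const (c e) * e)" for c
  proof -
    define s where "s = (\<Sum>e\<in>insert x F. const (c e) * e)"
    have s: "s = const (c x) * x + ?S c" unfolding s_def using insert.hyps by simp
    have sT: "s \<in> T n" unfolding s using x ST by auto
    have ws: "0 \<le> w s" using pm_nonneg[OF w sT] .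
    have cx: "v (c x) * \<delta> \<le> w s"
    proof (cases "c x = 0")
      case False
      have "const (c x) * (const (- (c e / c x)) * e) = - (const (c e) * e)" for e
        using False by (simp add: const_mult const_uminus flip: mult.assoc)
           (simp add: const_uminus[symmetric])
      then have "s = const (c x) * (x - ?S (\<lambda>e. - (c e / c x)))"
        unfolding s by (simp add: right_diff_distrib sum_distrib_left sum_negf)
      then have "w s = v (c x) * w (x - ?S (\<lambda>e. - (c e / c x)))" using pm_const[OF w] x ST by simp
      then show ?thesis using \<delta>(2)[of "\<lambda>e. - (c e / c x)"] nonneg[of "c x"] by (simp add: mult_left_mono)
    qed (use ws in simp)
    then have cx': "v (c x) \<le> w s / \<delta>" using \<delta>(1) by (simp add: pos_le_divide_eq)
    have "v (c e) \<le> C * (1 + w x / \<delta>) * w s" if e: "e \<in> F" for e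
    proof -
      have "w (?S c) \<le> (1 + w x / \<delta>) * w s"
      proof -
        have "?S c = s - const (c x) * x" unfolding s by simp
        then have "w (?S c) \<le> max (w s) (v (c x) * w x)"
          using pm_diff[OF w sT, of "const (c x) * x"] pm_const[OF w x] x by simp
        also have "\<dots> \<le> (1 + w x / \<delta>) * w s"
          using mult_right_mono[OF cx' wx] ws wx \<delta>(1) by (auto simp: algebra_simps)
        finally show ?thesis .
      qed
      then have "C * w (?S c) \<le> C * ((1 + w x / \<delta>) * w s)" using C(1) by simp
      then show ?thesis using C(2)[OF e, of c] by (simp add: mult.assoc)
    qed
    moreover have "C * (1 + w x / \<delta>) * w s \<le> ?C * w s" "1 / \<delta> * w s \<le> ?C * w s"
      by (rule mult_right_mono[OF _ ws]; simp)+
    ultimately have "\<forall>e\<in>insert x F. v (c e) \<le> ?C * w s" using cx' by fastforce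
    then show ?thesis by (simp add: s_def)
  qed
  moreover have "?C > 0" using \<delta>(1) by (simp add: less_max_iff_disj)
  ultimately show ?case by blast
qed

text \<open>In a spanning set of least size any nontrivial relation would allow removing an
  element.\<close>

lemma fin_dim_basis:
  assumes I: "ideal_in (T n) M" and "fin_dim n M"
  obtains E where "finite E" "E \<subseteq> T n" "T n \<subseteq> lspan E M"
    "\<forall>c. (\<Sum>e\<in>E. const (c e) * e) \<in> M \<longrightarrow> (\<forall>e\<in>E. c e = 0)"
proof -
  let ?P = "\<lambda>E. finite E \<and> E \<subseteq> T n \<and> T n \<subseteq> lspan E M"
  obtain E0 where "?P E0" using assms(2) unfolding fin_dim_def by blast
  then obtain E where E: "?P E" and least: "\<And>F. ?P F \<Longrightarrow> card E \<le> card F"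
    using ex_has_least_nat[of ?P E0 card] by blast
  have "c x = 0" if c: "(\<Sum>e\<in>E. const (c e) * e) \<in> M" and x: "x \<in> E" for c x
  proof (rule ccontr)
    assume cx: "c x \<noteq> 0"
    let ?F = "E - {x}"
    have F: "finite ?F" using E by simp
    have "(\<Sum>e\<in>E. const (c e) * e) = const (c x) * x + (\<Sum>e\<in>?F. const (c e) * e)"
      using E x by (intro sum.remove) auto
    then have "const (inverse (c x)) * (\<Sum>e\<in>E. const (c e) * e) =
        const (inverse (c x)) * const (c x) * x + (\<Sum>e\<in>?F. const (inverse (c x) * c e) * e)"
      by (simp add: distrib_left sum_distrib_left const_mult flip: mult.assoc)
    also have "const (inverse (c x)) * const (c x) = 1" using cx by (simp add: const_mult)
    finally have "x - (\<Sum>e\<in>?F. const (- (inverse (c x) * c e)) * e) \<in> M"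
      using ideal_mult[OF I T_const c, of "inverse (c x)"] by (simp add: sum_negf flip: const_uminus)
    then have "x \<in> lspan ?F M"
      unfolding lspan_def by (intro CollectI exI[of _ "\<lambda>e. - (inverse (c x) * c e)"])
    then have base: "e \<in> lspan ?F M" if "e \<in> E" for e
      using lspan_base[OF I F, of e] that by (cases "e = x") auto
    have "t \<in> lspan ?F M" if t: "t \<in> T n" for t
    proof -
      obtain d where d: "t - (\<Sum>e\<in>E. const (d e) * e) \<in> M" using E t by (auto simp: lspan_def)
      have "(\<Sum>e\<in>E. const (d e) * e) \<in> lspan ?F M"
        by (intro lspan_sum[OF I] lspan_scale[OF I T_const] base)
      from lspan_add[OF I lspan_ideal[OF d] this] show ?thesis by simp
    qed
    then have "card E \<le> card ?F" using E by (intro least) auto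
    then show False using E x by (metis card_Diff1_less not_le)
  qed
  then show ?thesis using that[of E] E by blast
qed

text \<open>Coefficient bounds with respect to a basis make any two such norms equivalent. Applying
  the equivalence to all powers of \<open>a\<close> removes the constant.\<close>

lemma pm_norm_unique:
  assumes M: "max_ideal (T n) M" and w: "pm_norm n M w" "pm_norm n M w'" and a: "a \<in> T n"
  shows "w a = w' a"
proof -
  note I = max_ideal_ideal[OF M]
  obtain E where E: "finite E" "E \<subseteq> T n" "T n \<subseteq> lspan E M"
    "\<forall>c. (\<Sum>e\<in>E. const (c e) * e) \<in> M \<longrightarrow> (\<forall>e\<in>E. c e = 0)"
    using fin_dim_basis[OF I max_ideal_fin_dim[OF M]] by blast
  have le: "u a \<le> u' a" if u: "pm_norm n M u" "pm_norm n M u'" for u u'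
  proof -
    obtain C where C: "C > 0" "\<And>c e. e \<in> E \<Longrightarrow> v (c e) \<le> C * u' (\<Sum>e\<in>E. const (c e) * e)"
      using pm_coefficient_bound[OF u(2) I E(1,2)] E(4) by blast
    let ?B = "\<Sum>e\<in>E. u e"
    have uE: "0 \<le> u e" if "e \<in> E" for e using pm_nonneg[OF u(1)] E(2) that by blast
    have bound: "u t \<le> C * ?B * u' t" if t: "t \<in> T n" for t
    proof -
      obtain c where c: "t - (\<Sum>e\<in>E. const (c e) * e) \<in> M" using E(3) t by (auto simp: lspan_def)
      let ?s = "\<Sum>e\<in>E. const (c e) * e"
      have sT: "?s \<in> T n" using E(2) by (auto intro!: T_sum T_mult)
      have u's: "0 \<le> u' ?s" using pm_nonneg[OF u(2) sT] .
      have "u ?s \<le> C * u' ?s * ?B"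
      proof (rule pm_sum_le[OF u(1) I])
        fix e assume e: "e \<in> E"
        have "u e \<le> ?B" using e uE E(1) by (intro member_le_sum) auto
        then show "u (const (c e) * e) \<le> C * u' ?s * ?B"
          using e E(2) C(1) u's uE[OF e] nonneg by (subst pm_const[OF u(1)]) (auto intro!: mult_mono C(2))
      qed (use E(2) C(1) u's uE in \<open>auto intro!: mult_nonneg_nonneg sum_nonneg\<close>)
      then show ?thesis
        using pm_cong[OF u(1) t sT c] pm_cong[OF u(2) t sT c] by (simp add: mult_ac)
    qed
    have "u a ^ k \<le> C * ?B * u' a ^ k" for k
      using bound[OF T_power[OF a], of k] unfolding pm_power[OF u(1) a] pm_power[OF u(2) a] .
    then show ?thesis
      by (rule le_of_powers_le[OF pm_nonneg[OF u(1) a] pm_nonneg[OF u(2) a]])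
  qed
  show ?thesis using le w by (simp add: order_antisym)
qed

subsection \<open>Existence\<close>

text \<open>A witnessed upper bound for the residue norm of \<open>t\<close> modulo
  \<open>M\<close>; working with witnesses avoids an infimum.\<close>

definition near :: "'k mps set \<Rightarrow> 'k mps \<Rightarrow> real \<Rightarrow> bool" where
  "near M t B \<longleftrightarrow> (\<exists>m\<in>M. nm (t - m) \<le> B)"

text \<open>The spectral seminorm of the residue norm of \<open>T n\<close> modulo \<open>M\<close>.\<close>

definition rho :: "'k mps set \<Rightarrow> 'k mps \<Rightarrow> real" where
  "rho M t = Inf {r. r > 0 \<and> (\<exists>C. \<forall>k. near M (t ^ k) (C * r ^ k))}"

context
  fixes n M assumes M: "max_ideal (T n) M"
begin

lemma M_ideal: "ideal_in (T n) M"
  by (rule max_ideal_ideal[OF M])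

lemma M_T: "m \<in> M \<Longrightarrow> m \<in> T n"
  by (rule ideal_sub[OF M_ideal])

lemma near_add:
  assumes "t \<in> T n" "u \<in> T n" "near M t B" "near M u B" shows "near M (t + u) B"
proof -
  obtain m m' where m: "m \<in> M" "m' \<in> M" "nm (t - m) \<le> B" "nm (u - m') \<le> B"
    using assms unfolding near_def by blast
  have "t + u - (m + m') = (t - m) + (u - m')" by simp
  also have "nm \<dots> \<le> B" by (rule nm_add_le[of _ n]) (use assms m M_T in auto)
  finally show ?thesis unfolding near_def using ideal_add[OF M_ideal m(1,2)] by blast
qed

lemma near_le: "near M t B \<Longrightarrow> B \<le> B' \<Longrightarrow> near M t B'"
  unfolding near_def by (meson order_trans)

lemma near_nonneg: "t \<in> T n \<Longrightarrow> near M t B \<Longrightarrow> 0 \<le> B"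
  unfolding near_def using M_T nm_nonneg by (meson T_diff order_trans)

lemma near_norm: "nm t \<le> B \<Longrightarrow> near M t B"
  unfolding near_def using ideal_zero[OF M_ideal] by (intro bexI[of _ 0]) auto

lemma near_mult:
  assumes "t \<in> T n" "u \<in> T n" "near M t B" "near M u B'" shows "near M (t * u) (B * B')"
proof -
  obtain m m' where m: "m \<in> M" "m' \<in> M" "nm (t - m) \<le> B" "nm (u - m') \<le> B'"
    using assms unfolding near_def by blast
  have "m * u + (t - m) * m' \<in> M"
    by (rule ideal_add[OF M_ideal ideal_mult'[OF M_ideal _ m(1)] ideal_mult[OF M_ideal _ m(2)]])
      (use assms m M_T in auto)
  moreover have "t * u - (m * u + (t - m) * m') = (t - m) * (u - m')" by (simp add: algebra_simps)
  moreover have "nm ((t - m) * (u - m')) \<le> B * B'"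
    by (rule nm_mult_le[of _ n]) (use assms m M_T in auto)
  ultimately show ?thesis unfolding near_def by metis
qed

lemma near_sum:
  "finite S \<Longrightarrow> S \<noteq> {} \<Longrightarrow> (\<And>i. i \<in> S \<Longrightarrow> f i \<in> T n) \<Longrightarrow> (\<And>i. i \<in> S \<Longrightarrow> near M (f i) B) \<Longrightarrow>
    near M (\<Sum>i\<in>S. f i) B"
  by (induction S rule: finite_ne_induct) (auto intro!: near_add T_sum)

text \<open>By the ultrametric inequality multiples by natural numbers are no larger, so binomial
  coefficients do no harm in \<open>rho_add\<close>.\<close>

lemma near_of_nat:
  assumes "t \<in> T n" "near M t B" shows "near M (of_nat k * t) B"
proof (induction k)
  case 0
  show ?case using near_nonneg[OF assms] by (intro near_norm) simp
next
  case (Suc k)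
  have "of_nat k * t \<in> T n" using assms by (induction k) (auto simp: distrib_right)
  then show ?case using near_add[OF assms(1) _ assms(2) Suc] by (simp add: distrib_right)
qed

section \<open>Properties of the spectral seminorm\<close>

definition radii :: "'k mps \<Rightarrow> real set" where
  "radii t = {r. r > 0 \<and> (\<exists>C. \<forall>k. near M (t ^ k) (C * r ^ k))}"

lemma rho_radii: "rho M t = Inf (radii t)"
  by (simp add: rho_def radii_def)

lemma radii_norm: "t \<in> T n \<Longrightarrow> nm t \<le> r \<Longrightarrow> r > 0 \<Longrightarrow> r \<in> radii t"
  unfolding radii_def
proof (intro CollectI conjI exI[of _ 1] allI near_norm)
  fix k assume "t \<in> T n" "nm t \<le> r"
  then show "nm (t ^ k) \<le> 1 * r ^ k"
    using nm_power_le[of t n k] power_mono[of "nm t" r k] nm_nonneg[of t n] by simp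
qed

lemma radii_up:
  assumes t: "t \<in> T n" and "r \<in> radii t" "r \<le> s" shows "s \<in> radii t"
proof -
  obtain C where C: "r > 0" "\<And>k. near M (t ^ k) (C * r ^ k)" using assms by (auto simp: radii_def)
  have "0 \<le> C" using near_nonneg[OF _ C(2)[of 0]] by simp
  then have "near M (t ^ k) (C * s ^ k)" for k
    using C assms by (intro near_le[OF C(2)[of k]] mult_left_mono power_mono) auto
  then show ?thesis using C(1) assms(3) by (auto simp: radii_def)
qed

lemma radii_ne: "t \<in> T n \<Longrightarrow> radii t \<noteq> {}"
  using radii_norm[of t "nm t + 1"] nm_nonneg[of t n] by force

lemma radii_bdd: "bdd_below (radii t)"
  by (rule bdd_belowI[of _ 0]) (simp add: radii_def)

lemma rho_le: "r \<in> radii t \<Longrightarrow> rho M t \<le> r"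
  unfolding rho_radii by (rule cInf_lower[OF _ radii_bdd])

lemma rho_less: "t \<in> T n \<Longrightarrow> rho M t < r \<Longrightarrow> r \<in> radii t"
  unfolding rho_radii using cInf_lessD[OF radii_ne] radii_up by (meson less_imp_le)

lemma rho_nonneg: "t \<in> T n \<Longrightarrow> 0 \<le> rho M t"
  unfolding rho_radii by (rule cInf_greatest[OF radii_ne]) (simp_all add: radii_def)

lemma rho_le_nm: "t \<in> T n \<Longrightarrow> rho M t \<le> nm t"
proof (rule field_le_epsilon)
  fix e :: real assume "t \<in> T n" "e > 0"
  then show "rho M t \<le> nm t + e" using nm_nonneg[of t n] by (intro rho_le radii_norm) auto
qed

text \<open>For \<open>r\<close> above both values, each term of the binomial expansion of the k-th
  power is bounded by a constant times \<open>r ^ k\<close>, and so is their sum, without a factor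
  for the number of terms.\<close>

lemma rho_add:
  assumes t: "t \<in> T n" "u \<in> T n" shows "rho M (t + u) \<le> max (rho M t) (rho M u)"
proof (rule dense_ge)
  fix r assume r: "max (rho M t) (rho M u) < r"
  obtain C where C: "\<And>k. near M (t ^ k) (C * r ^ k)" "r > 0"
    using rho_less[OF t(1), of r] r by (auto simp: radii_def)
  obtain D where D: "\<And>k. near M (u ^ k) (D * r ^ k)" using rho_less[OF t(2), of r] r by (auto simp: radii_def)
  have "near M ((t + u) ^ k) (C * D * r ^ k)" for k
    unfolding binomial_ring
  proof (rule near_sum)
    fix i assume i: "i \<in> {..k}"
    have "near M (t ^ i * u ^ (k - i)) (C * r ^ i * (D * r ^ (k - i)))"
      using t C D by (intro near_mult) auto
    moreover have "C * r ^ i * (D * r ^ (k - i)) = C * D * (r ^ i * r ^ (k - i))" by simp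
    moreover have "r ^ i * r ^ (k - i) = r ^ k" using i by (simp flip: power_add)
    ultimately have "near M (t ^ i * u ^ (k - i)) (C * D * r ^ k)" by metis
    then show "near M (of_nat (k choose i) * t ^ i * u ^ (k - i)) (C * D * r ^ k)"
      using t near_of_nat[of "t ^ i * u ^ (k - i)" "C * D * r ^ k" "k choose i"] by (simp only: mult.assoc) simp
    have "of_nat j \<in> T n" for j by (induction j) auto
    then show "of_nat (k choose i) * t ^ i * u ^ (k - i) \<in> T n" using t by auto
  qed auto
  then show "rho M (t + u) \<le> r" using C(2) by (intro rho_le) (auto simp: radii_def)
qed

lemma rho_mult:
  assumes t: "t \<in> T n" "u \<in> T n" shows "rho M (t * u) \<le> rho M t * rho M u"
proof -
  have le: "rho M (t * u) \<le> r * s" if r: "rho M t < r" and s: "rho M u < s" for r s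
  proof -
    obtain C where C: "\<And>k. near M (t ^ k) (C * r ^ k)" "r > 0" using rho_less[OF t(1) r] by (auto simp: radii_def)
    obtain D where D: "\<And>k. near M (u ^ k) (D * s ^ k)" "s > 0" using rho_less[OF t(2) s] by (auto simp: radii_def)
    have "near M ((t * u) ^ k) (C * D * (r * s) ^ k)" for k
      using near_mult[OF _ _ C(1)[of k] D(1)[of k]] t by (simp add: power_mult_distrib mult_ac)
    then show ?thesis using C(2) D(2) by (intro rho_le) (auto simp: radii_def)
  qed
  have "(\<lambda>k. (rho M t + 1 / real (Suc k)) * (rho M u + 1 / real (Suc k))) \<longlonglongrightarrow> (rho M t + 0) * (rho M u + 0)"
    using LIMSEQ_inverse_real_of_nat by (intro tendsto_intros) (simp_all add: inverse_eq_divide)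
  then show ?thesis using le by (auto intro!: LIMSEQ_le_const)
qed

lemma rho_ideal: assumes m: "m \<in> M" shows "rho M m = 0"
proof -
  have "near M (m ^ k) (1 * r ^ k)" if "r > 0" for r k
  proof (cases k)
    case 0
    then show ?thesis by (intro near_norm) simp
  next
    case (Suc j)
    then have "m ^ k \<in> M" using m M_T by (auto intro: ideal_mult'[OF M_ideal])
    then show ?thesis unfolding near_def using that by (intro bexI[of _ "m ^ k"]) auto
  qed
  then have "rho M m \<le> r" if "r > 0" for r
    using that by (intro rho_le) (auto simp: radii_def intro!: exI[of _ 1])
  then have "rho M m \<le> 0" by (metis dense_ge)
  then show ?thesis using rho_nonneg[OF M_T[OF m]] by simp
qed

text \<open>A value below 1 would put 1 arbitrarily close to \<open>M\<close>, which is
  closed.\<close>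

lemma rho_one: "rho M 1 = 1"
proof (rule order_antisym)
  show "rho M 1 \<le> 1" using rho_le_nm[of 1] by simp
  show "1 \<le> rho M 1"
  proof (rule ccontr)
    assume "\<not> ?thesis"
    then obtain r where r: "rho M 1 < r" "r < 1" using dense not_le by metis
    obtain C where C: "\<And>k. near M (1 ^ k) (C * r ^ k)" "r > 0" using rho_less[of 1 r] r by (auto simp: radii_def)
    have "1 \<in> M"
    proof (rule max_ideal_closed[OF M])
      fix d :: real assume d: "d > 0"
      have "(\<lambda>k. C * r ^ k) \<longlonglongrightarrow> C * 0"
        by (intro tendsto_mult tendsto_const LIMSEQ_power_zero) (use r C in auto)
      then have "eventually (\<lambda>k. C * r ^ k < d) sequentially" using d by (simp add: order_tendstoD)
      then obtain k where "C * r ^ k < d" unfolding eventually_sequentially by blast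
      then show "\<exists>m\<in>M. nm (1 - m) \<le> d" using near_le[OF C(1)[of k], of d] unfolding near_def by simp
    qed simp
    then show False using max_ideal_one[OF M] by simp
  qed
qed

text \<open>An element outside \<open>M\<close> has an inverse \<open>b\<close> modulo
  \<open>M\<close>, and submultiplicativity gives \<open>1 \<le> rho M t * rho M b\<close>.\<close>

lemma rho_zero_iff: "t \<in> T n \<Longrightarrow> rho M t = 0 \<longleftrightarrow> t \<in> M"
proof
  assume t: "t \<in> T n" "rho M t = 0"
  show "t \<in> M"
  proof (rule ccontr)
    assume "t \<notin> M"
    then obtain b where b: "b \<in> T n" "t * b - 1 \<in> M" using max_ideal_inverse[OF M t(1)] by blast
    have "rho M 1 = rho M (t * b + - (t * b - 1))" by simp
    also have "\<dots> \<le> max (rho M (t * b)) (rho M (- (t * b - 1)))" using t b by (intro rho_add) auto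
    also have "rho M (- (t * b - 1)) = 0" by (rule rho_ideal[OF ideal_uminus[OF T_sub_ring M_ideal b(2)]])
    finally show False using rho_mult[OF t(1) b(1)] t rho_one by simp
  qed
qed (rule rho_ideal)

lemma rho_const:
  assumes t: "t \<in> T n" shows "rho M (const c * t) = v c * rho M t"
proof -
  have le: "rho M (const c * u) \<le> v c * rho M u" if "u \<in> T n" for c u
    using rho_mult[OF T_const that, of c] rho_le_nm[OF T_const, of c] rho_nonneg[OF that]
    by (simp add: nm_const) (meson mult_right_mono order_trans)
  show ?thesis
  proof (cases "c = 0")
    case True
    then show ?thesis using rho_ideal[OF ideal_zero[OF M_ideal]] by simp
  next
    case False
    then have "const (inverse c) * (const c * t) = t" by (simp add: const_mult flip: mult.assoc)
    then have "rho M t \<le> inverse (v c) * rho M (const c * t)"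
      using le[of "const c * t" "inverse c"] t by (simp add: v_inverse)
    then have "v c * rho M t \<le> rho M (const c * t)"
      using v_pos[OF False] by (simp add: field_simps)
    then show ?thesis using le[OF t, of c] by simp
  qed
qed

lemma rho_power:
  assumes t: "t \<in> T n" shows "rho M (t ^ k) = rho M t ^ k"
proof (cases "k = 0")
  case False
  show ?thesis
  proof (rule order_antisym)
    show "rho M (t ^ k) \<le> rho M t ^ k"
    proof (induction k)
      case (Suc k)
      have "rho M (t ^ Suc k) \<le> rho M t * rho M (t ^ k)" using rho_mult[of t "t ^ k"] t by simp
      also have "\<dots> \<le> rho M t * rho M t ^ k" using Suc rho_nonneg[OF t] by (rule mult_left_mono)
      finally show ?case by simp
    qed (simp add: rho_one)
    show "rho M t ^ k \<le> rho M (t ^ k)"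
    proof (rule dense_ge)
      fix r assume "rho M (t ^ k) < r"
      then obtain C where C: "\<And>q. near M ((t ^ k) ^ q) (C * r ^ q)" "r > 0"
        using rho_less[of "t ^ k" r] t by (auto simp: radii_def)
      define x where "x = root k r"
      have x: "x > 0" "x ^ k = r" using C(2) False by (auto simp: x_def real_root_gt_zero)
      have C0: "0 \<le> C" using near_nonneg[OF _ C(1)[of 0]] by simp
      \<comment> \<open>To pass from powers of \<open>t ^ k\<close> to all powers of
        \<open>t\<close>, divide the exponent \<open>j\<close> by \<open>k\<close> with remainder.
        The remainder is below \<open>k\<close>, so its contribution is bounded by the k-th power of
        a number at least 1.\<close>
      let ?D = "C * (1 + nm t / x) ^ k"
      have "near M (t ^ j) (?D * x ^ j)" for j
      proof -
        let ?q = "j div k" and ?i = "j mod k"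
        have i: "?i < k" using False by simp
        have "near M ((t ^ k) ^ ?q * t ^ ?i) (C * r ^ ?q * nm t ^ ?i)"
          by (rule near_mult[OF _ _ C(1) near_norm[OF nm_power_le[OF t]]]) (use t in auto)
        moreover have "(t ^ k) ^ ?q * t ^ ?i = t ^ j"
          by (simp flip: power_mult power_add)
        moreover have "C * r ^ ?q * nm t ^ ?i \<le> ?D * x ^ j"
        proof -
          have "nm t ^ ?i = (nm t / x) ^ ?i * x ^ ?i" using x(1) by (simp add: power_divide)
          moreover have "r ^ ?q * x ^ ?i = x ^ j" unfolding x(2)[symmetric] by (simp flip: power_mult power_add)
          ultimately have eq: "C * r ^ ?q * nm t ^ ?i = C * (nm t / x) ^ ?i * x ^ j" by (simp add: mult_ac)
          have nt: "0 \<le> nm t / x" using nm_nonneg[OF t] x(1) by simp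
          have "(nm t / x) ^ ?i \<le> (1 + nm t / x) ^ ?i" using nt by (intro power_mono) auto
          also have "\<dots> \<le> (1 + nm t / x) ^ k" using nt i by (intro power_increasing) auto
          finally have "C * (nm t / x) ^ ?i \<le> ?D" using C0 by (rule mult_left_mono)
          then show ?thesis unfolding eq using x(1) by (intro mult_right_mono) auto
        qed
        ultimately show ?thesis using near_le by metis
      qed
      then have "rho M t \<le> x" using x(1) by (intro rho_le) (auto simp: radii_def)
      then have "rho M t ^ k \<le> x ^ k" using rho_nonneg[OF t] by (intro power_mono)
      then show "rho M t ^ k \<le> r" using x(2) by simp
    qed
  qed
qed (simp add: rho_one)

lemma rho_pm_norm: "pm_norm n M (rho M)"
  unfolding pm_norm_def by (simp add: rho_nonneg rho_zero_iff rho_add rho_mult rho_power rho_const)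

text \<open>For \<open>f \<notin> M\<close> the limit of \<open>w (a f\<^sup>k) / w (f)\<^sup>k\<close> is again a power-multiplicative norm, hence
  equal to \<open>w\<close>; but it is multiplicative with respect to \<open>f\<close>.\<close>

lemma pm_norm_multiplicative:
  assumes w: "pm_norm n M w" and a: "a \<in> T n" and f: "f \<in> T n"
  shows "w (a * f) = w a * w f"
proof (cases "f \<in> M")
  case True
  then have "w f = 0" "w (a * f) = 0"
    using pm_zero_iff[OF w f] pm_zero_iff[OF w, of "a * f"] a f ideal_mult[OF M_ideal a True] by simp_all
  then show ?thesis by simp
next
  case False
  then have wf: "w f > 0" using pm_zero_iff[OF w f] pm_nonneg[OF w f] by simp
  define X where "X b k = w (b * f ^ k) / w f ^ k" for b k
  have X0: "0 \<le> X b k" if "b \<in> T n" for b k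
    unfolding X_def using that f wf by (intro divide_nonneg_nonneg pm_nonneg[OF w]) auto
  have "\<exists>l. X b \<longlonglongrightarrow> l" if b: "b \<in> T n" for b
  proof -
    have "X b (Suc k) \<le> X b k" for k
    proof -
      have "w (b * f ^ k * f) \<le> w (b * f ^ k) * w f" using b f by (intro pm_mult[OF w]) auto
      then show ?thesis unfolding X_def using wf by (simp add: field_simps)
    qed
    then have "decseq (X b)" by (rule decseq_SucI)
    then show ?thesis using X0[OF b] by (metis decseq_convergent)
  qed
  then obtain l where l: "\<And>b. b \<in> T n \<Longrightarrow> X b \<longlonglongrightarrow> l b" by metis
  have l_nonneg: "0 \<le> l b" if "b \<in> T n" for b using X0[OF that] l[OF that] by (auto intro: LIMSEQ_le_const)
  have l_M: "l b = 0" if "b \<in> M" for b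
  proof -
    have "X b k = 0" for k
      unfolding X_def using pm_zero_iff[OF w, of "b * f ^ k"] ideal_mult'[OF M_ideal _ that, of "f ^ k"] f M_T[OF that] by simp
    then have "X b = (\<lambda>_. 0)" by auto
    then show ?thesis using l[OF M_T[OF that]] LIMSEQ_unique tendsto_const by metis
  qed
  have l_one: "l 1 = 1"
  proof -
    have "X 1 = (\<lambda>_. 1)" unfolding X_def using wf f by (auto simp: pm_power[OF w])
    then show ?thesis using l[OF T_one] LIMSEQ_unique tendsto_const by metis
  qed
  have l_add: "l (b + c) \<le> max (l b) (l c)" if T: "b \<in> T n" "c \<in> T n" for b c
  proof (rule LIMSEQ_le)
    show "X (b + c) \<longlonglongrightarrow> l (b + c)" using T l by simp
    show "(\<lambda>k. max (X b k) (X c k)) \<longlonglongrightarrow> max (l b) (l c)" using T l by (intro tendsto_max)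
    have "X (b + c) k \<le> max (X b k) (X c k)" for k
    proof -
      have "w ((b + c) * f ^ k) \<le> max (w (b * f ^ k)) (w (c * f ^ k))"
        using pm_add[OF w, of "b * f ^ k" "c * f ^ k"] T f by (simp add: distrib_right)
      then have "X (b + c) k \<le> max (w (b * f ^ k)) (w (c * f ^ k)) / w f ^ k"
        unfolding X_def using wf by (intro divide_right_mono) auto
      then show ?thesis unfolding X_def using wf by (auto simp: max_def divide_right_mono split: if_splits)
    qed
    then show "\<exists>N. \<forall>k\<ge>N. X (b + c) k \<le> max (X b k) (X c k)" by blast
  qed
  have l_mult: "l (b * c) \<le> l b * l c" if T: "b \<in> T n" "c \<in> T n" for b c
  proof (rule LIMSEQ_le)
    \<comment> \<open>Along the even indices \<open>f ^ (2 * k)\<close> can be shared equally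
      between \<open>b\<close> and \<open>c\<close>. For powers, the indices \<open>k * j\<close>
      serve the same purpose.\<close>
    have "(X (b * c) \<circ> (\<lambda>k. 2 * k)) \<longlonglongrightarrow> l (b * c)"
      by (rule LIMSEQ_subseq_LIMSEQ) (use T l in \<open>auto simp: strict_mono_def\<close>)
    then show "(\<lambda>k. X (b * c) (2 * k)) \<longlonglongrightarrow> l (b * c)" by (simp add: o_def)
    show "(\<lambda>k. X b k * X c k) \<longlonglongrightarrow> l b * l c" using T l by (intro tendsto_mult)
    have "X (b * c) (2 * k) \<le> X b k * X c k" for k
    proof -
      have "w (b * c * f ^ (2 * k)) \<le> w (b * f ^ k) * w (c * f ^ k)"
      proof -
        have "b * c * f ^ (2 * k) = (b * f ^ k) * (c * f ^ k)"
          unfolding mult_2 power_add by (simp only: mult_ac)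
        then show ?thesis using pm_mult[OF w, of "b * f ^ k" "c * f ^ k"] T f by simp
      qed
      then have "w (b * c * f ^ (2 * k)) / w f ^ (2 * k) \<le> w (b * f ^ k) * w (c * f ^ k) / w f ^ (2 * k)"
        using wf by (intro divide_right_mono) auto
      then show ?thesis unfolding X_def by (simp add: mult_2 power_add)
    qed
    then show "\<exists>N. \<forall>k\<ge>N. X (b * c) (2 * k) \<le> X b k * X c k" by blast
  qed
  have l_power: "l (b ^ j) = l b ^ j" if b: "b \<in> T n" for b j
  proof (cases "j = 0")
    case False
    have "(X (b ^ j) \<circ> (\<lambda>k. k * j)) \<longlonglongrightarrow> l (b ^ j)"
      by (rule LIMSEQ_subseq_LIMSEQ) (use b l False in \<open>auto simp: strict_mono_def\<close>)
    moreover have "(X (b ^ j) \<circ> (\<lambda>k. k * j)) = (\<lambda>k. X b k ^ j)"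
    proof
      fix k
      have "w (b ^ j * f ^ (k * j)) = w (b * f ^ k) ^ j"
        using pm_power[OF w, of "b * f ^ k" j] b f by (simp add: power_mult_distrib power_mult)
      then show "(X (b ^ j) \<circ> (\<lambda>k. k * j)) k = X b k ^ j"
        unfolding X_def by (simp add: power_divide power_mult)
    qed
    moreover have "(\<lambda>k. X b k ^ j) \<longlonglongrightarrow> l b ^ j" using b l by (intro tendsto_power)
    ultimately show ?thesis using LIMSEQ_unique by metis
  qed (simp add: l_one)
  have l_const: "l (const c * b) = v c * l b" if b: "b \<in> T n" for b c
  proof -
    have "X (const c * b) = (\<lambda>k. v c * X b k)"
      unfolding X_def using b f by (auto simp: pm_const[OF w] mult.assoc)
    moreover have "(\<lambda>k. v c * X b k) \<longlonglongrightarrow> v c * l b" using b l by (intro tendsto_mult tendsto_const)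
    moreover have "X (const c * b) \<longlonglongrightarrow> l (const c * b)" using b by (intro l) auto
    ultimately show ?thesis using LIMSEQ_unique by metis
  qed
  \<comment> \<open>The limit could have lost the definiteness of \<open>w\<close>; invertibility
    modulo \<open>M\<close> together with \<open>l 1 = 1\<close> restores it.\<close>
  have l_zero: "b \<in> M" if b: "b \<in> T n" "l b = 0" for b
  proof (rule ccontr)
    assume "b \<notin> M"
    then obtain i where i: "i \<in> T n" "b * i - 1 \<in> M" using max_ideal_inverse[OF M b(1)] by blast
    have "l 1 = l (b * i + - (b * i - 1))" by simp
    also have "\<dots> \<le> max (l (b * i)) (l (- (b * i - 1)))" using b i by (intro l_add) auto
    also have "l (- (b * i - 1)) = 0" by (rule l_M[OF ideal_uminus[OF T_sub_ring M_ideal i(2)]])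
    finally show False using l_mult[OF b(1) i(1)] b l_one by simp
  qed
  have "pm_norm n M l"
    unfolding pm_norm_def using l_nonneg l_M l_zero l_add l_mult l_power l_const by (intro conjI ballI allI) auto
  then have eq: "l b = w b" if "b \<in> T n" for b by (rule pm_norm_unique[OF M _ w that])
  \<comment> \<open>Multiplying the argument by \<open>f\<close> only shifts the sequence by one and
    contributes the factor \<open>w f\<close>.\<close>
  have "X (a * f) = (\<lambda>k. X a (Suc k) * w f)" unfolding X_def using wf by (auto simp: mult_ac)
  moreover have "(\<lambda>k. X a (Suc k) * w f) \<longlonglongrightarrow> l a * w f"
    by (intro tendsto_mult tendsto_const LIMSEQ_Suc l a)
  moreover have "X (a * f) \<longlonglongrightarrow> l (a * f)" using a f by (intro l) auto
  ultimately have "l (a * f) = l a * w f" using LIMSEQ_unique by metis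
  then show ?thesis using eq a f by simp
qed

lemma rho_abs_val: "abs_val n M (rho M)"
  unfolding abs_val_def
proof (intro conjI allI ballI)
  show "rho M (const c) = v c" for c using rho_const[OF T_one, of c] rho_one by simp
qed (use rho_nonneg rho_zero_iff rho_add pm_norm_multiplicative[OF rho_pm_norm] in auto)

lemma abs_val_unique: "abs_val n M w \<Longrightarrow> t \<in> T n \<Longrightarrow> w t = rho M t"
  using pm_norm_unique[OF M abs_val_imp_pm_norm rho_pm_norm] by blast

end

section \<open>Relaxing the inequalities of an empty Laurent domain\<close>

lemma fin_dim_finite_generation:
  assumes "fin_dim n M"
  obtains s e where "\<And>j::nat. j < s \<Longrightarrow> e j \<in> T n"
    "\<And>t. t \<in> T n \<Longrightarrow> \<exists>c. t - (\<Sum>j<s. const (c j) * e j) \<in> M"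
proof -
  obtain E where E: "finite E" "E \<subseteq> T n" "T n \<subseteq> lspan E M" using assms unfolding fin_dim_def by blast
  obtain h where h: "bij_betw h {0..<card E} E" using ex_bij_betw_nat_finite[OF E(1)] by blast
  show ?thesis
  proof (rule that[of "card E" h])
    show "h j \<in> T n" if "j < card E" for j using h E(2) that by (auto simp: bij_betw_def)
    fix t assume "t \<in> T n"
    then obtain c where c: "t - (\<Sum>e\<in>E. const (c e) * e) \<in> M" using E(3) by (auto simp: lspan_def)
    have "(\<Sum>e\<in>E. const (c e) * e) = (\<Sum>j<card E. const (c (h j)) * h j)"
      using sum.reindex_bij_betw[OF h, of "\<lambda>e. const (c e) * e"] by (simp add: atLeast0LessThan)
    then show "\<exists>c. t - (\<Sum>j<card E. const (c j) * h j) \<in> M" using c by (intro exI[of _ "\<lambda>j. c (h j)"]) simp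
  qed
qed

text \<open>The residue field of \<open>Q\<close> is finite over the base field, hence over the
  image of \<open>T n\<close>, so \<open>max_ideal_Int_finite\<close> applies. Restricting
  \<open>rho Q\<close> to \<open>T n\<close> gives an absolute value on the smaller residue field,
  and there is only one.\<close>

lemma max_ideal_restrict:
  assumes Q: "max_ideal (T N) Q" and n: "n \<le> N"
  shows "max_ideal (T n) (Q \<inter> T n)"
    and "a \<in> T n \<Longrightarrow> rho Q a = rho (Q \<inter> T n) a"
proof -
  obtain s e where e: "\<And>j::nat. j < s \<Longrightarrow> e j \<in> T N"
    "\<And>t. t \<in> T N \<Longrightarrow> \<exists>c. t - (\<Sum>j<s. const (c j) * e j) \<in> Q"
    using fin_dim_finite_generation[OF max_ideal_fin_dim[OF Q]] by blast
  have sub: "T n \<subseteq> T N" using T_mono[OF n] by blast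
  show P: "max_ideal (T n) (Q \<inter> T n)"
  proof (rule max_ideal_Int_finite[OF T_sub_ring T_sub_ring sub Q e(1)])
    fix t assume "t \<in> T N"
    then obtain c where "t - (\<Sum>j<s. const (c j) * e j) \<in> Q" using e(2) by blast
    then show "\<exists>r. (\<forall>j<s. r j \<in> T n) \<and> t - (\<Sum>j<s. r j * e j) \<in> Q"
      by (intro exI[of _ "\<lambda>j. const (c j)"]) simp
  qed
  have "abs_val n (Q \<inter> T n) (rho Q)"
    using rho_abs_val[OF Q] sub unfolding abs_val_def by (auto simp: subset_iff)
  then show "a \<in> T n \<Longrightarrow> rho Q a = rho (Q \<inter> T n) a" by (rule abs_val_unique[OF P])
qed

lemma cong_one_power:
  assumes I: "ideal_in R P" and R: "sub_ring R" and a: "a \<in> R" "a - 1 \<in> P"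
  shows "a ^ k - 1 \<in> P"
proof (induction k)
  case 0
  then show ?case using ideal_zero[OF I] by simp
next
  case (Suc k)
  have eq: "a ^ Suc k - 1 = a * (a ^ k - 1) + (a - 1)" by (simp add: algebra_simps)
  show ?case unfolding eq by (rule ideal_add[OF I ideal_mult[OF I a(1) Suc] a(2)])
qed

lemma rho_mult_eq:
  "max_ideal (T n) P \<Longrightarrow> a \<in> T n \<Longrightarrow> b \<in> T n \<Longrightarrow> rho P (a * b) = rho P a * rho P b"
  using abs_val_mult[OF rho_abs_val] by blast

lemma rho_prod:
  assumes "max_ideal (T n) P" "\<And>i. i \<in> S \<Longrightarrow> f i \<in> T n"
  shows "rho P (\<Prod>i\<in>S. f i) = (\<Prod>i\<in>S. rho P (f i))"
  using assms(2)
  by (induction S rule: infinite_finite_induct)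
    (auto simp: rho_one[OF assms(1)] rho_mult_eq[OF assms(1)] T_prod)

text \<open>The system of inequalities \<open>|h\<^sub>i| \<ge> \<gamma>\<^sub>i\<close> (if \<open>up i\<close>) or \<open>|h\<^sub>i| \<le> \<gamma>\<^sub>i\<close> (otherwise), where
  \<open>\<gamma>\<^sub>i ^ k\<^sub>i = |z\<^sub>i|\<close>, is encoded by the equations \<open>h\<^sub>i ^ k\<^sub>i * X = z\<^sub>i\<close> or \<open>h\<^sub>i ^ k\<^sub>i = z\<^sub>i * X\<close>
  with a new variable \<open>X\<close> for each \<open>i\<close>.\<close>

definition relation :: "bool \<Rightarrow> 'k mps \<Rightarrow> nat \<Rightarrow> 'k \<Rightarrow> 'k mps \<Rightarrow> 'k mps" where
  "relation up h k z x = (if up then h ^ k * x - const z else h ^ k - const z * x)"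

context
  fixes n r :: nat and I :: "'k mps set" and up :: "nat \<Rightarrow> bool" and h :: "nat \<Rightarrow> 'k mps"
    and k :: "nat \<Rightarrow> nat" and z :: "nat \<Rightarrow> 'k"
  assumes I: "ideal_in (T n) I" and h: "\<And>i. i < r \<Longrightarrow> h i \<in> T n"
begin

text \<open>A solution of the equations in the residue field of \<open>P\<close>, given by lifts to
  \<open>T n\<close>. The size of its coordinates is not restricted, so solutions of relaxed systems
  are included.\<close>

definition point :: "'k mps set \<Rightarrow> (nat \<Rightarrow> 'k mps) \<Rightarrow> bool" where
  "point P \<xi> \<longleftrightarrow> max_ideal (T n) P \<and> I \<subseteq> P \<and>
    (\<forall>i<r. \<xi> (n + i) \<in> T n \<and> relation (up i) (h i) (k i) (z i) (\<xi> (n + i)) \<in> P)"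

text \<open>This closed ideal contains \<open>I\<close> and the relations, and \<open>1 \<in> vanishing\<close> directly gives a bound
  uniform in all points, without cofactors of an ideal membership.\<close>

definition vanishing :: "'k mps set" where
  "vanishing = {x \<in> T (n + r). \<forall>\<delta>>0. \<exists>D. \<exists>x'\<in>T (n + r) \<inter> degb n (n + r) D.
    nm (x - x') \<le> \<delta> \<and> (\<forall>P \<xi>. point P \<xi> \<longrightarrow> theta n (n + r) \<xi> D x' \<in> P)}"

lemma theta_point_T: "point P \<xi> \<Longrightarrow> f \<in> T (n + r) \<Longrightarrow> theta n (n + r) \<xi> D f \<in> T n"
proof (rule theta_T)
  fix i assume "point P \<xi>" "i \<in> {n..<n + r}"
  then have "n + (i - n) = i" "i - n < r" "point P \<xi>" by auto
  then show "\<xi> i \<in> T n" unfolding point_def by metis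
qed auto

lemma vanishing_exact:
  assumes "x \<in> T (n + r)" "x \<in> degb n (n + r) D" "\<And>P \<xi>. point P \<xi> \<Longrightarrow> theta n (n + r) \<xi> D x \<in> P"
  shows "x \<in> vanishing"
  unfolding vanishing_def using assms by (auto intro!: exI[of _ D] bexI[of _ x])

lemma vanishing_ideal: "ideal_in (T (n + r)) vanishing"
  unfolding ideal_in_def
proof (intro conjI ballI)
  show "vanishing \<subseteq> T (n + r)" by (auto simp: vanishing_def)
  show "0 \<in> vanishing"
    by (rule vanishing_exact[of _ 0]) (auto simp: degb_def point_def intro: ideal_zero[OF max_ideal_ideal])
  show "x + y \<in> vanishing" if x: "x \<in> vanishing" and y: "y \<in> vanishing" for x y
  proof -
    have T: "x \<in> T (n + r)" "y \<in> T (n + r)" using x y by (auto simp: vanishing_def)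
    have "\<exists>D. \<exists>x'\<in>T (n + r) \<inter> degb n (n + r) D. nm (x + y - x') \<le> \<delta> \<and>
        (\<forall>P \<xi>. point P \<xi> \<longrightarrow> theta n (n + r) \<xi> D x' \<in> P)" if \<delta>: "\<delta> > 0" for \<delta>
    proof -
      obtain D x' where x': "x' \<in> T (n + r)" "x' \<in> degb n (n + r) D" "nm (x - x') \<le> \<delta>"
        "\<And>P \<xi>. point P \<xi> \<Longrightarrow> theta n (n + r) \<xi> D x' \<in> P"
        using x \<delta> unfolding vanishing_def by blast
      obtain D' y' where y': "y' \<in> T (n + r)" "y' \<in> degb n (n + r) D'" "nm (y - y') \<le> \<delta>"
        "\<And>P \<xi>. point P \<xi> \<Longrightarrow> theta n (n + r) \<xi> D' y' \<in> P"
        using y \<delta> unfolding vanishing_def by blast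
      let ?D = "max D D'"
      have d: "x' \<in> degb n (n + r) ?D" "y' \<in> degb n (n + r) ?D"
        using degb_mono x'(2) y'(2) by (meson max.cobounded1 max.cobounded2)+
      have "x' + y' \<in> degb n (n + r) ?D" using d unfolding degb_def by force
      moreover have "nm (x + y - (x' + y')) \<le> \<delta>"
        using nm_add_le[of "x - x'" "n + r" "y - y'" \<delta>] T x' y' by (simp add: algebra_simps)
      moreover have "theta n (n + r) \<xi> ?D (x' + y') \<in> P" if p: "point P \<xi>" for P \<xi>
      proof -
        have Id: "ideal_in (T n) P" using p by (simp add: point_def max_ideal_ideal)
        show ?thesis
          unfolding theta_add theta_mono[OF x'(2) max.cobounded1] theta_mono[OF y'(2) max.cobounded2]
          by (rule ideal_add[OF Id x'(4)[OF p] y'(4)[OF p]])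
      qed
      ultimately show ?thesis using x'(1) y'(1) by (intro exI[of _ ?D] bexI[of _ "x' + y'"]) auto
    qed
    then show ?thesis using T by (simp add: vanishing_def)
  qed
  show "y * x \<in> vanishing" if y: "y \<in> T (n + r)" and x: "x \<in> vanishing" for y x
  proof -
    have xT: "x \<in> T (n + r)" using x by (auto simp: vanishing_def)
    have "\<exists>D. \<exists>x'\<in>T (n + r) \<inter> degb n (n + r) D. nm (y * x - x') \<le> \<delta> \<and>
        (\<forall>P \<xi>. point P \<xi> \<longrightarrow> theta n (n + r) \<xi> D x' \<in> P)" if \<delta>: "\<delta> > 0" for \<delta>
    proof -
      let ?B = "nm x + nm y + 1"
      have B: "?B \<ge> 1" "?B > 0" "nm x \<le> ?B" "nm y \<le> ?B" using nm_nonneg[OF y] nm_nonneg[OF xT] by auto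
      \<comment> \<open>Precision at most 1 keeps the approximation of \<open>x\<close> within
        \<open>?B\<close>; precision at most \<open>\<delta> / ?B\<close> keeps both error products
        within \<delta>.\<close>
      define d where "d = min 1 (\<delta> / ?B)"
      have dB: "d * ?B \<le> \<delta>" unfolding pos_le_divide_eq[OF B(2), symmetric] d_def by simp
      have d: "d > 0" "d \<le> 1" "d * ?B \<le> \<delta>" "?B * d \<le> \<delta>"
        using \<delta> B dB unfolding mult.commute[of ?B] by (simp_all add: d_def)
      obtain D x' where x': "x' \<in> T (n + r)" "x' \<in> degb n (n + r) D" "nm (x - x') \<le> d"
        "\<And>P \<xi>. point P \<xi> \<Longrightarrow> theta n (n + r) \<xi> D x' \<in> P"
        using x d unfolding vanishing_def by blast
      \<comment> \<open>The multiplier has to be truncated too, since \<open>theta\<close> is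
        multiplicative only on series of bounded degree.\<close>
      obtain D' where D': "nm (y - trunc n (n + r) D' y) \<le> d" using trunc_close[OF y d(1)] by blast
      let ?y = "trunc n (n + r) D' y"
      have "nm x' \<le> ?B"
        using nm_diff[of x "n + r" "x - x'"] xT x' d B by simp
      have "y * x - ?y * x' = y * (x - x') + (y - ?y) * x'" by (simp add: algebra_simps)
      also have "nm \<dots> \<le> \<delta>"
      proof (rule nm_add_le)
        show "nm (y * (x - x')) \<le> \<delta>"
          using nm_mult_le[of y "n + r" "x - x'" ?B d] y xT x' B d by simp
        show "nm ((y - ?y) * x') \<le> \<delta>"
          using nm_mult_le[of "y - ?y" "n + r" x' d ?B] y xT x' D' d \<open>nm x' \<le> ?B\<close> by simp
      qed (use y xT x' in auto)
      finally have "nm (y * x - ?y * x') \<le> \<delta>" .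
      moreover have "theta n (n + r) \<xi> (D' + D) (?y * x') \<in> P" if p: "point P \<xi>" for P \<xi>
        using ideal_mult[OF max_ideal_ideal theta_point_T[OF p] x'(4)[OF p], of ?y D'] p y
        by (simp add: theta_mult[OF trunc_degb x'(2,1)] point_def)
      ultimately show ?thesis using x'(1,2) y degb_mult[OF trunc_degb x'(2)]
        by (intro exI[of _ "D' + D"] bexI[of _ "?y * x'"]) auto
    qed
    then show ?thesis using xT y by (simp add: vanishing_def)
  qed
qed

lemma base_degb:
  assumes "a \<in> T n" shows "a \<in> degb n N D"
  unfolding degb_def
proof (intro CollectI allI impI ballI)
  fix m i assume "coef a m \<noteq> 0" "i \<in> {n..<N}"
  then have "m \<in> multi_indices n" "n \<le> i" using T_coef[OF assms, of m] by auto
  then show "m i \<le> D" by (simp add: multi_indices_def)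
qed

lemma base_vanishing: "a \<in> I \<Longrightarrow> a \<in> vanishing"
proof -
  assume a: "a \<in> I"
  then have T: "a \<in> T n" by (rule ideal_sub[OF I])
  show ?thesis
    by (rule vanishing_exact[of a 0])
      (use a T T_mono[of n "n + r"] in \<open>auto simp: theta_base base_degb point_def\<close>)
qed

lemma relation_vanishing:
  assumes i: "i < r" shows "relation (up i) (h i) (k i) (z i) (var (n + i)) \<in> vanishing"
proof (rule vanishing_exact[of _ 1])
  note hi = h[OF i] and hN = T_mono[OF le_add1 h[OF i], of r]
  have deg1: "a * var j \<in> degb n (n + r) 1" if "a \<in> T n" for a j
    using degb_mult[OF base_degb[OF that, of "n + r" 0] degb_var[of j]] by simp
  show "relation (up i) (h i) (k i) (z i) (var (n + i)) \<in> T (n + r)"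
    using hN i by (auto simp: relation_def)
  have diff: "a - b \<in> degb n (n + r) 1" if "a \<in> degb n (n + r) 1" "b \<in> degb n (n + r) 1" for a b
    using that unfolding degb_def by force
  show "relation (up i) (h i) (k i) (z i) (var (n + i)) \<in> degb n (n + r) 1"
    unfolding relation_def
    using diff[OF deg1[of "h i ^ k i"] base_degb[OF T_const]] diff[OF base_degb deg1[OF T_const]] hi by simp
  fix P \<xi> assume "point P \<xi>"
  then have "relation (up i) (h i) (k i) (z i) (\<xi> (n + i)) \<in> P" using i by (simp add: point_def)
  then show "theta n (n + r) \<xi> 1 (relation (up i) (h i) (k i) (z i) (var (n + i))) \<in> P"
    using i hi theta_var[of n "n + i" "n + r" \<xi>]
    by (simp add: relation_def theta_diff theta_mult_base theta_base split: if_splits)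
qed

text \<open>A maximal ideal \<open>Q\<close> above \<open>vanishing\<close> contains all relations,
  and the new variables have \<open>rho Q\<close> at most 1. The relations therefore give the
  inequalities at \<open>Q\<close>, hence at its restriction to \<open>T n\<close>, contrary to
  \<open>none\<close>.\<close>

lemma no_common_point_imp_one_vanishing:
  assumes z: "\<And>i. i < r \<Longrightarrow> v (z i) = \<gamma> i ^ k i" and \<gamma>: "\<And>i. i < r \<Longrightarrow> 0 < \<gamma> i"
    and k: "\<And>i. i < r \<Longrightarrow> 1 \<le> k i"
    and none: "\<And>P. max_ideal (T n) P \<Longrightarrow> I \<subseteq> P \<Longrightarrow>
      \<exists>i<r. if up i then rho P (h i) < \<gamma> i else \<gamma> i < rho P (h i)"
  shows "1 \<in> vanishing"
proof (rule ccontr)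
  assume "1 \<notin> vanishing"
  then obtain Q where Q: "max_ideal (T (n + r)) Q" "vanishing \<subseteq> Q"
    using exists_max_ideal[OF T_sub_ring vanishing_ideal] by blast
  have nN: "n \<le> n + r" by simp
  note P = max_ideal_restrict[OF Q(1) nN]
  have "I \<subseteq> Q \<inter> T n" using base_vanishing Q(2) ideal_sub[OF I] by blast
  then obtain i where i: "i < r" "if up i then rho Q (h i) < \<gamma> i else \<gamma> i < rho Q (h i)"
    using none[OF P(1)] P(2) h by metis
  note A = rho_abs_val[OF Q(1)] and hN = T_mono[OF nN h[OF i(1)]]
  let ?x = "var (n + i) :: 'k mps"
  have xT: "?x \<in> T (n + r)" using i by simp
  have x: "0 \<le> rho Q ?x" "rho Q ?x \<le> 1" using rho_nonneg[OF Q(1) xT] rho_le_nm[OF Q(1) xT] by auto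
  have rel: "relation (up i) (h i) (k i) (z i) ?x \<in> Q" using relation_vanishing[OF i(1)] Q(2) by blast
  have h0: "0 \<le> rho Q (h i)" by (rule rho_nonneg[OF Q(1) hN])
  have pw: "rho Q (h i ^ k i) = rho Q (h i) ^ k i" by (rule abs_val_power[OF A hN])
  have cg: "rho Q a = rho Q b" if "a - b \<in> Q" "a \<in> T (n + r)" "b \<in> T (n + r)" for a b
    by (rule pm_cong[OF rho_pm_norm[OF Q(1)]]) (use that in auto)
  show False
  proof (cases "up i")
    case True
    then have "rho Q (h i ^ k i * ?x) = rho Q (const (z i))"
      using rel hN xT by (intro cg) (auto simp: relation_def)
    then have "rho Q (h i) ^ k i * rho Q ?x = \<gamma> i ^ k i"
      using rho_mult_eq[OF Q(1), of "h i ^ k i" ?x] hN xT pw abs_val_const[OF A] z[OF i(1)] by simp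
    moreover have "rho Q (h i) ^ k i * rho Q ?x \<le> rho Q (h i) ^ k i" using h0 x by (simp add: mult_left_le)
    moreover have "rho Q (h i) ^ k i < \<gamma> i ^ k i"
      using True i(2) h0 k[OF i(1)] by (intro power_strict_mono) auto
    ultimately show False by simp
  next
    case False
    then have "rho Q (h i ^ k i) = rho Q (const (z i) * ?x)"
      using rel hN xT by (intro cg) (auto simp: relation_def)
    then have "rho Q (h i) ^ k i = \<gamma> i ^ k i * rho Q ?x"
      using rho_mult_eq[OF Q(1), of "const (z i)" ?x] xT pw abs_val_const[OF A] z[OF i(1)] by simp
    also have "\<dots> \<le> \<gamma> i ^ k i" using \<gamma>[OF i(1)] x by (simp add: mult_left_le)
    also have "\<dots> < rho Q (h i) ^ k i"
      using False i(2) \<gamma>[OF i(1)] k[OF i(1)] by (intro power_strict_mono) auto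
    finally show False by simp
  qed
qed

text \<open>Take \<open>x\<close> of bounded degree with \<open>1 - x\<close> of norm at most 1/2
  and all values of \<open>x\<close> at points in \<open>P\<close>. The value of
  \<open>1 - x\<close> at a point then has absolute value 1. Each monomial in the coordinates is at
  most \<open>q ^ (D * r)\<close>, as each of the \<open>r\<close> exponents is at most
  \<open>D\<close>, and its coefficient contributes at most 1/2.\<close>

lemma one_vanishing_imp_bound:
  assumes "1 \<in> vanishing"
  shows "\<exists>m. \<forall>P \<xi> q. point P \<xi> \<longrightarrow> 1 \<le> q \<longrightarrow> (\<forall>i<r. rho P (\<xi> (n + i)) \<le> q) \<longrightarrow> 2 \<le> q ^ m"
proof -
  have "(1/2 :: real) > 0" by simp
  then obtain D x where x: "x \<in> T (n + r)" "x \<in> degb n (n + r) D" "nm (1 - x) \<le> 1/2"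
    "\<And>P \<xi>. point P \<xi> \<Longrightarrow> theta n (n + r) \<xi> D x \<in> P"
    using assms unfolding vanishing_def by blast
  have "2 \<le> q ^ (D * r)"
    if p: "point P \<xi>" and q: "1 \<le> q" and \<xi>: "\<And>i. i < r \<Longrightarrow> rho P (\<xi> (n + i)) \<le> q" for P \<xi> q
  proof -
    have P: "max_ideal (T n) P" using p by (simp add: point_def)
    note A = rho_abs_val[OF P] and Id = max_ideal_ideal[OF P]
    have \<xi>T: "\<xi> j \<in> T n" and \<xi>q: "rho P (\<xi> j) \<le> q" if "j \<in> {n..<n + r}" for j
    proof -
      have j: "n + (j - n) = j" "j - n < r" using that by auto
      show "\<xi> j \<in> T n" "rho P (\<xi> j) \<le> q"
        using p \<xi>[OF j(2)] j(2) unfolding point_def j(1) by (metis j(1), simp)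
    qed
    let ?u = "theta n (n + r) \<xi> D (1 - x)"
    have u: "?u = 1 - theta n (n + r) \<xi> D x" by (simp add: theta_diff)
    have "1 = rho P 1" by (simp add: rho_one[OF P])
    also have "\<dots> = rho P ?u"
      unfolding u by (rule pm_cong[OF rho_pm_norm[OF P]]) (use x theta_point_T[OF p] p in auto)
    also have "\<dots> \<le> 1/2 * q ^ (D * r)"
      unfolding theta_def
    proof (rule abs_val_sum_le[OF A])
      fix e assume e: "e \<in> exps n (n + r) D"
      have sT: "slice n (1 - x) e \<in> T n" and pT: "pw n (n + r) \<xi> e \<in> T n"
        using x \<xi>T by (auto intro!: slice_T[of _ "n + r"] pw_T)
      then show "slice n (1 - x) e * pw n (n + r) \<xi> e \<in> T n" by simp
      have "rho P (slice n (1 - x) e) \<le> nm (slice n (1 - x) e)" by (rule rho_le_nm[OF P sT])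
      also have "\<dots> \<le> nm (1 - x)" by (rule nm_slice[of _ "n + r"]) (use x in auto)
      finally have s: "rho P (slice n (1 - x) e) \<le> 1/2" using x(3) by simp
      have "rho P (pw n (n + r) \<xi> e) = (\<Prod>j\<in>{n..<n + r}. rho P (\<xi> j) ^ e j)"
        unfolding pw_def using \<xi>T by (subst rho_prod[OF P]) (auto simp: abs_val_power[OF A] intro!: prod.cong)
      also have "\<dots> \<le> (\<Prod>j\<in>{n..<n + r}. q ^ D)"
      proof (intro prod_mono conjI)
        fix j assume j: "j \<in> {n..<n + r}"
        show "0 \<le> rho P (\<xi> j) ^ e j" using rho_nonneg[OF P \<xi>T[OF j]] by simp
        have "rho P (\<xi> j) ^ e j \<le> q ^ e j" using rho_nonneg[OF P \<xi>T[OF j]] \<xi>q[OF j] by (intro power_mono)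
        also have "\<dots> \<le> q ^ D" using e j q by (intro power_increasing) (auto simp: exps_def)
        finally show "rho P (\<xi> j) ^ e j \<le> q ^ D" .
      qed
      also have "\<dots> = q ^ (D * r)" by (simp add: power_mult)
      finally have "rho P (pw n (n + r) \<xi> e) \<le> q ^ (D * r)" .
      then show "rho P (slice n (1 - x) e * pw n (n + r) \<xi> e) \<le> 1/2 * q ^ (D * r)"
        using s rho_nonneg[OF P pT] unfolding rho_mult_eq[OF P sT pT] by (intro mult_mono) auto
    qed (use q in auto)
    finally show ?thesis by simp
  qed
  then show ?thesis by (intro exI[of _ "D * r"]) blast
qed

text \<open>Each equation is linear in its new variable and can be solved in the residue field. The
  relaxed inequality says precisely that the quotient solving it is at most \<open>q ^ k i\<close>,
  where the original inequality would give 1.\<close>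

lemma approximate_point:
  assumes P: "max_ideal (T n) P" "I \<subseteq> P" and q: "1 \<le> q"
    and z: "\<And>i. i < r \<Longrightarrow> v (z i) = \<gamma> i ^ k i" and \<gamma>: "\<And>i. i < r \<Longrightarrow> 0 < \<gamma> i"
    and near: "\<And>i. i < r \<Longrightarrow> if up i then \<gamma> i \<le> rho P (h i) * q else rho P (h i) \<le> \<gamma> i * q"
  shows "\<exists>\<xi>. point P \<xi> \<and> (\<forall>i<r. rho P (\<xi> (n + i)) \<le> q ^ k i)"
proof -
  note A = rho_abs_val[OF P(1)] and Id = max_ideal_ideal[OF P(1)]
  have "\<exists>x\<in>T n. relation (up i) (h i) (k i) (z i) x \<in> P \<and> rho P x \<le> q ^ k i" if i: "i < r" for i
  proof (cases "up i")
    case True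
    note hi = h[OF i]
    have near': "\<gamma> i \<le> rho P (h i) * q" using near[OF i] True by simp
    then have "rho P (h i) \<noteq> 0" using \<gamma>[OF i] by auto
    then have pos: "rho P (h i) > 0" using rho_nonneg[OF P(1) hi] by simp
    then obtain b where b: "b \<in> T n" "h i * b - 1 \<in> P"
      using max_ideal_inverse[OF P(1) hi] rho_zero_iff[OF P(1) hi] by auto
    \<comment> \<open>\<open>b\<close> inverts \<open>h i\<close> modulo \<open>P\<close>, so this
      represents \<open>z i / h i ^ k i\<close>.\<close>
    let ?x = "const (z i) * b ^ k i"
    have hb: "(h i * b) ^ k i - 1 \<in> P" by (rule cong_one_power[OF Id T_sub_ring _ b(2)]) (use hi b in auto)
    have "h i ^ k i * ?x - const (z i) = const (z i) * ((h i * b) ^ k i - 1)"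
      by (simp add: power_mult_distrib algebra_simps)
    then have rel: "relation (up i) (h i) (k i) (z i) ?x \<in> P"
      using True ideal_mult[OF Id T_const hb] by (simp add: relation_def)
    have "rho P (h i * b) = rho P 1" by (rule pm_cong[OF rho_pm_norm[OF P(1)] _ _ b(2)]) (use hi b in auto)
    then have "rho P b = 1 / rho P (h i)"
      using pos rho_mult_eq[OF P(1) hi b(1)] rho_one[OF P(1)] by (simp add: field_simps)
    then have "rho P ?x = (\<gamma> i / rho P (h i)) ^ k i"
      using b(1) z[OF i] rho_mult_eq[OF P(1), of "const (z i)" "b ^ k i"] abs_val_power[OF A b(1)] abs_val_const[OF A]
      by (simp add: power_divide)
    also have "\<dots> \<le> q ^ k i"
      using pos \<gamma>[OF i] near' by (intro power_mono) (auto simp: field_simps)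
    finally show ?thesis using rel b(1) by (intro bexI[of _ ?x]) auto
  next
    case False
    note hi = h[OF i]
    have near': "rho P (h i) \<le> \<gamma> i * q" using near[OF i] False by simp
    have z0: "z i \<noteq> 0" using z[OF i] \<gamma>[OF i] by auto
    let ?x = "const (inverse (z i)) * h i ^ k i"
    have "const (z i) * ?x = h i ^ k i" using z0 by (simp add: const_mult flip: mult.assoc)
    then have rel: "relation (up i) (h i) (k i) (z i) ?x \<in> P"
      using False ideal_zero[OF Id] by (simp add: relation_def)
    have "rho P ?x = (rho P (h i) / \<gamma> i) ^ k i"
      using hi z[OF i] rho_mult_eq[OF P(1), of "const (inverse (z i))" "h i ^ k i"] abs_val_power[OF A hi] abs_val_const[OF A]
      by (simp add: power_divide v_inverse v_divide field_simps)
    also have "\<dots> \<le> q ^ k i"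
      using rho_nonneg[OF P(1) hi] \<gamma>[OF i] near' by (intro power_mono) (auto simp: field_simps)
    finally show ?thesis using rel hi by (intro bexI[of _ ?x]) auto
  qed
  then obtain x where x: "\<And>i. i < r \<Longrightarrow> x i \<in> T n \<and> relation (up i) (h i) (k i) (z i) (x i) \<in> P \<and> rho P (x i) \<le> q ^ k i"
    by metis
  show ?thesis
    by (rule exI[of _ "\<lambda>j. x (j - n)"]) (use P x in \<open>auto simp: point_def\<close>)
qed

end

text \<open>A solution of the system relaxed by \<open>q\<close> would give a point with coordinates
  at most \<open>q ^ K\<close>, which the bound from \<open>one_vanishing_imp_bound\<close> excludes
  once \<open>(q ^ K) ^ m < 2\<close>.\<close>

lemma strict_emptiness:
  fixes \<gamma> :: "nat \<Rightarrow> real"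
  assumes I: "ideal_in (T n) I" and h: "\<And>i. i < r \<Longrightarrow> h i \<in> T n"
    and \<gamma>: "\<And>i. i < r \<Longrightarrow> \<gamma> i \<in> sqrt_value_group v"
    and none: "\<And>P. max_ideal (T n) P \<Longrightarrow> I \<subseteq> P \<Longrightarrow>
      \<exists>i<r. if up i then rho P (h i) < \<gamma> i else \<gamma> i < rho P (h i)"
  obtains q where "q > 1" "\<And>P. max_ideal (T n) P \<Longrightarrow> I \<subseteq> P \<Longrightarrow>
      \<exists>i<r. if up i then rho P (h i) * q < \<gamma> i else \<gamma> i * q < rho P (h i)"
proof -
  have "\<exists>zk. 1 \<le> snd zk \<and> v (fst zk) = \<gamma> i ^ snd zk" if i: "i < r" for i
  proof -
    obtain z n where "1 \<le> n" "\<gamma> i ^ n = v z" using \<gamma>[OF i] by (auto simp: sqrt_value_group_def)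
    then show ?thesis by (intro exI[of _ "(z, n)"]) simp
  qed
  then obtain zk where zk: "\<And>i. i < r \<Longrightarrow> 1 \<le> snd (zk i) \<and> v (fst (zk i)) = \<gamma> i ^ snd (zk i)" by metis
  define z k where "z i = fst (zk i)" and "k i = snd (zk i)" for i
  have zk': "1 \<le> k i" "v (z i) = \<gamma> i ^ k i" if "i < r" for i using zk[OF that] by (auto simp: z_def k_def)
  have \<gamma>0: "0 < \<gamma> i" if "i < r" for i using \<gamma>[OF that] by (simp add: sqrt_value_group_def)
  have one: "1 \<in> vanishing n r I up h k z"
    by (rule no_common_point_imp_one_vanishing[OF I h, where \<gamma> = \<gamma>]) (use zk' \<gamma>0 none in auto)
  obtain m where m: "\<forall>P \<xi> q. point n r I up h k z P \<xi> \<longrightarrow> 1 \<le> q \<longrightarrow>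
      (\<forall>i<r. rho P (\<xi> (n + i)) \<le> q) \<longrightarrow> 2 \<le> q ^ m"
    using one_vanishing_imp_bound[where h = h, OF I h one] by blast
  \<comment> \<open>A single exponent dominating every \<open>k i\<close>.\<close>
  define K where "K = (\<Sum>i<r. k i)"
  \<comment> \<open>Any number strictly between 1 and 2 could stand for 3/2. The successor avoids a
    root of order 0.\<close>
  define q where "q = root (Suc (K * m)) (3/2)"
  have q: "q > 1" by (simp add: q_def real_root_gt_1_iff)
  have "q ^ (K * m) \<le> q ^ Suc (K * m)" using q by (intro power_increasing) auto
  also have "\<dots> = 3/2" unfolding q_def by (intro real_root_pow_pos2) auto
  finally have qm: "(q ^ K) ^ m < 2" by (simp add: power_mult)
  have "\<exists>i<r. if up i then rho P (h i) * q < \<gamma> i else \<gamma> i * q < rho P (h i)"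
    if P: "max_ideal (T n) P" "I \<subseteq> P" for P
  proof (rule ccontr)
    assume "\<not> ?thesis"
    then have near: "if up i then \<gamma> i \<le> rho P (h i) * q else rho P (h i) \<le> \<gamma> i * q" if "i < r" for i
      using that by (meson not_le)
    have "\<exists>\<xi>. point n r I up h k z P \<xi> \<and> (\<forall>i<r. rho P (\<xi> (n + i)) \<le> q ^ k i)"
      by (rule approximate_point[OF I h P less_imp_le[OF q] zk'(2) \<gamma>0 near])
    then obtain \<xi> where \<xi>: "point n r I up h k z P \<xi>" "\<And>i. i < r \<Longrightarrow> rho P (\<xi> (n + i)) \<le> q ^ k i"
      by blast
    have "2 \<le> (q ^ K) ^ m"
    proof (rule m[rule_format, OF \<xi>(1)])
      show "1 \<le> q ^ K" using q by simp
      fix i assume i: "i < r"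
      have "k i \<le> K" unfolding K_def using i by (intro member_le_sum) auto
      then have "q ^ k i \<le> q ^ K" using q by (intro power_increasing) auto
      then show "rho P (\<xi> (n + i)) \<le> q ^ K" using \<xi>(2)[OF i] by simp
    qed
    then show False using qm by simp
  qed
  then show ?thesis using that q by blast
qed

section \<open>Affinoid algebras\<close>

lemma coef_carrier_iff: "coef t \<in> carrier (tate_algebra v n) \<longleftrightarrow> t \<in> T n"
proof -
  have "{m \<in> multi_indices n. v (coef t m) \<ge> e} = {m. v (coef t m) \<ge> e}"
    if "\<forall>m. m \<notin> multi_indices n \<longrightarrow> coef t m = 0" "e > 0" for e
    using that by force
  then show ?thesis unfolding tate_algebra_def T_def by auto
qed

lemma carrier_tate: "carrier (tate_algebra v n) = coef ` T n"
proof (intro equalityI subsetI)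
  fix f assume f: "f \<in> carrier (tate_algebra v n)"
  have "f m = 0" if "infinite {i. m i \<noteq> 0}" for m
    using f that multi_indices_finite[of m n] by (auto simp: tate_algebra_def)
  then have "coef (Mps f) = f" by (rule coef_Mps)
  then show "f \<in> coef ` T n" using f coef_carrier_iff[of "Mps f" n] by (metis imageI)
qed (auto simp: coef_carrier_iff)

lemma coef_ops:
  "coef t \<otimes>\<^bsub>tate_algebra v n\<^esub> coef u = coef (t * u)"
  "coef t \<oplus>\<^bsub>tate_algebra v n\<^esub> coef u = coef (t + u)"
  "\<one>\<^bsub>tate_algebra v n\<^esub> = coef 1"
  by (auto simp: tate_algebra_def coef_mult fun_eq_iff const_series_def coef_one zero_fun_def)

lemma const_series_eq: "const_series c = coef (const c)"
  by (auto simp: const_series_def coef_const fun_eq_iff zero_fun_def)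

text \<open>Replaces the quotient by a surjection, so that points of \<open>A\<close> become maximal
  ideals of \<open>T n\<close> above the kernel.\<close>

definition presentation :: "nat \<Rightarrow> ('a, 'b) ring_scheme \<Rightarrow> ('k \<Rightarrow> 'a) \<Rightarrow> ('k mps \<Rightarrow> 'a) \<Rightarrow> bool" where
  "presentation n A \<iota> p \<longleftrightarrow> p ` T n = carrier A \<and>
    (\<forall>t\<in>T n. \<forall>u\<in>T n. p (t + u) = p t \<oplus>\<^bsub>A\<^esub> p u \<and> p (t * u) = p t \<otimes>\<^bsub>A\<^esub> p u) \<and>
    p 1 = \<one>\<^bsub>A\<^esub> \<and> (\<forall>c. p (const c) = \<iota> c)"

lemma affinoid_presentation:
  assumes "affinoid_algebra v A \<iota>"
  obtains n p where "cring A" "presentation n A \<iota> p"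
proof -
  obtain n I \<phi> where A: "cring A" and I: "ideal I (tate_algebra v n)"
    and \<phi>: "\<phi> \<in> ring_iso (tate_algebra v n Quot I) A"
    and \<phi>\<iota>: "\<And>c. \<phi> (I +>\<^bsub>tate_algebra v n\<^esub> const_series c) = \<iota> c"
    using assms unfolding affinoid_algebra_def by blast
  let ?R = "tate_algebra v n"
  let ?h = "\<lambda>f. I +>\<^bsub>?R\<^esub> f"
  let ?p = "\<lambda>t. \<phi> (?h (coef t))"
  have h: "?h \<in> ring_hom ?R (?R Quot I)" by (rule ideal.rcos_ring_hom[OF I])
  have \<phi>h: "\<phi> \<in> ring_hom (?R Quot I) A" and bij: "\<phi> ` carrier (?R Quot I) = carrier A"
    using \<phi> by (auto simp: ring_iso_def bij_betw_def)
  have car: "carrier (?R Quot I) = ?h ` carrier ?R"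
    by (auto simp: FactRing_def A_RCOSETS_def')
  note hc = ring_hom_closed[OF h]
  have "presentation n A \<iota> ?p"
    unfolding presentation_def
  proof (intro conjI ballI allI)
    show "?p ` T n = carrier A" unfolding bij[symmetric] car carrier_tate by (simp add: image_image)
    fix t u assume "t \<in> T n" "u \<in> T n"
    then have tu: "coef t \<in> carrier ?R" "coef u \<in> carrier ?R" by (simp_all add: coef_carrier_iff)
    show "?p (t + u) = ?p t \<oplus>\<^bsub>A\<^esub> ?p u"
      using ring_hom_add[OF h tu] ring_hom_add[OF \<phi>h hc[OF tu(1)] hc[OF tu(2)]] by (simp add: coef_ops(2))
    show "?p (t * u) = ?p t \<otimes>\<^bsub>A\<^esub> ?p u"
      using ring_hom_mult[OF h tu] ring_hom_mult[OF \<phi>h hc[OF tu(1)] hc[OF tu(2)]] by (simp add: coef_ops(1))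
  next
    show "?p 1 = \<one>\<^bsub>A\<^esub>" using ring_hom_one[OF h] ring_hom_one[OF \<phi>h] by (simp add: coef_ops(3)[of n])
    show "?p (const c) = \<iota> c" for c using \<phi>\<iota>[of c] by (simp add: const_series_eq)
  qed
  then show ?thesis using that A by blast
qed

context
  fixes n :: nat and A :: "('a, 'b) ring_scheme" (structure) and \<iota> :: "'k \<Rightarrow> 'a" and p :: "'k mps \<Rightarrow> 'a"
  assumes A: "cring A" and pres: "presentation n A \<iota> p"
begin

interpretation A: cring A by (rule A)

definition pull :: "'a set \<Rightarrow> 'k mps set" where
  "pull M = {t \<in> T n. p t \<in> M}"

lemma p_image: "p ` T n = carrier A" and p_closed: "t \<in> T n \<Longrightarrow> p t \<in> carrier A"
  and p_add: "t \<in> T n \<Longrightarrow> u \<in> T n \<Longrightarrow> p (t + u) = p t \<oplus> p u"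
  and p_mult: "t \<in> T n \<Longrightarrow> u \<in> T n \<Longrightarrow> p (t * u) = p t \<otimes> p u"
  and p_one: "p 1 = \<one>" and p_const: "p (const c) = \<iota> c"
  using pres by (auto simp: presentation_def)

lemma p_zero: "p 0 = \<zero>"
  using p_add[of 0 0] p_closed[of 0] by (metis A.add.l_cancel_one' T_zero add_0)

lemma p_diff:
  assumes "t \<in> T n" "u \<in> T n" shows "p (t - u) = p t \<ominus> p u"
proof -
  have "p t = p (t - u) \<oplus> p u" using p_add[of "t - u" u] assms by simp
  then show ?thesis using assms p_closed by (simp add: A.minus_eq A.add.m_assoc A.r_neg)
qed

lemma pull_ideal:
  assumes "ideal M A" shows "ideal_in (T n) (pull M)"
proof -
  interpret M: ideal M A by (rule assms)
  show ?thesis unfolding ideal_in_def pull_def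
    by (auto simp: p_zero p_add p_mult p_closed intro: M.I_l_closed)
qed

lemma pull_max_ideal:
  assumes "M \<in> Max_spec A" shows "max_ideal (T n) (pull M)" "pull {\<zero>} \<subseteq> pull M"
proof -
  interpret M: maximalideal M A using assms by (simp add: Max_spec_def)
  interpret F: field "A Quot M" by (rule M.quotient_is_field[OF A])
  note hom = M.rcos_ring_hom
  have "1 \<notin> pull M"
    using M.one_imp_carrier M.I_notcarr by (auto simp: pull_def p_one)
  moreover have "\<exists>u\<in>T n. t * u - 1 \<in> pull M" if t: "t \<in> T n - pull M" for t
  proof -
    have tT: "t \<in> T n" and tM: "p t \<notin> M" using t by (auto simp: pull_def)
    note pt = p_closed[OF tT]
    have "M +> p t \<noteq> \<zero>\<^bsub>A Quot M\<^esub>"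
      using tM M.a_rcos_self[OF pt] by (auto simp: FactRing_def)
    moreover have "M +> p t \<in> carrier (A Quot M)" using ring_hom_closed[OF hom pt] .
    ultimately obtain y where y: "y \<in> carrier (A Quot M)" "(M +> p t) \<otimes>\<^bsub>A Quot M\<^esub> y = \<one>\<^bsub>A Quot M\<^esub>"
      using F.field_Units F.Units_r_inv_ex[of "M +> p t"] by blast
    then obtain b where b: "b \<in> carrier A" "y = M +> b" by (auto simp: FactRing_def A_RCOSETS_def')
    then obtain u where u: "u \<in> T n" "b = p u" using p_image by blast
    have "M +> (p t \<otimes> p u) = M +> \<one>"
      using y(2) b u ring_hom_mult[OF hom pt, of "p u"] ring_hom_one[OF hom] by simp
    then have "p t \<otimes> p u \<ominus> \<one> \<in> M"
      using A.quotient_eq_iff_same_a_r_cos[OF M.ideal_axioms, of "p t \<otimes> p u" \<one>] pt b u by simp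
    then show ?thesis using tT u by (intro bexI[of _ u]) (auto simp: pull_def p_diff p_mult p_one)
  qed
  ultimately show "max_ideal (T n) (pull M)"
    unfolding max_ideal_def using pull_ideal[OF M.ideal_axioms] by blast
  show "pull {\<zero>} \<subseteq> pull M" using M.zero_closed by (auto simp: pull_def)
qed

text \<open>The converse of \<open>pull_max_ideal\<close>: as \<open>P\<close> contains the kernel,
  membership of \<open>p t\<close> in the image is decided by \<open>t\<close> alone, and inverses
  modulo \<open>P\<close> force any larger ideal to contain the unit element.\<close>

lemma image_max_ideal:
  assumes P: "max_ideal (T n) P" and ker: "pull {\<zero>} \<subseteq> P"
  shows "p ` P \<in> Max_spec A" "pull (p ` P) = P"
proof -
  note I = max_ideal_ideal[OF P]
  have PT: "t \<in> T n" if "t \<in> P" for t using ideal_sub[OF I that] .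
  have mem: "t \<in> P" if t: "t \<in> T n" "p t \<in> p ` P" for t
  proof -
    obtain u where u: "u \<in> P" "p t = p u" using t by blast
    have "p (t - u) = \<zero>" using t u PT p_closed by (simp add: p_diff A.r_neg A.minus_eq)
    then have "t - u \<in> P" using ker t u PT by (auto simp: pull_def)
    then show ?thesis using ideal_add[OF I, of "t - u" u] u by simp
  qed
  show "pull (p ` P) = P" using mem PT by (auto simp: pull_def)
  have id: "ideal (p ` P) A"
  proof (rule idealI[OF A.ring_axioms])
    show "subgroup (p ` P) (add_monoid A)"
    proof (rule A.add.subgroupI)
      show "p ` P \<subseteq> carrier A" using PT p_closed by auto
      show "p ` P \<noteq> {}" using ideal_zero[OF I] by blast
      fix a assume "a \<in> p ` P"
      then obtain t where t: "t \<in> P" "a = p t" by blast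
      have "p (- t) = \<ominus> a"
        using p_diff[of 0 t] PT[OF t(1)] p_closed[OF PT[OF t(1)]] by (simp add: p_zero t A.minus_eq)
      then show "\<ominus> a \<in> p ` P" using ideal_uminus[OF T_sub_ring I t(1)] by (metis imageI)
      fix b assume "b \<in> p ` P"
      then obtain u where u: "u \<in> P" "b = p u" by blast
      have "p (t + u) = a \<oplus> b" using t u PT p_add by simp
      then show "a \<oplus> b \<in> p ` P" using ideal_add[OF I t(1) u(1)] by (metis imageI)
    qed
    fix a x assume "a \<in> p ` P" "x \<in> carrier A"
    then obtain t u where tu: "t \<in> P" "a = p t" "u \<in> T n" "x = p u" using p_image by blast
    have "p (u * t) = x \<otimes> a" "p (u * t) = a \<otimes> x"
      using tu PT p_mult[of u t] p_closed by (simp_all add: A.m_comm)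
    then show "x \<otimes> a \<in> p ` P" "a \<otimes> x \<in> p ` P" using ideal_mult[OF I tu(3,1)] by (metis imageI)+
  qed
  have "maximalideal (p ` P) A"
  proof (rule maximalidealI[OF id])
    show "carrier A \<noteq> p ` P" using mem[of 1] max_ideal_one[OF P] p_closed[of 1] by auto
    fix J assume J: "ideal J A" "p ` P \<subseteq> J" "J \<subseteq> carrier A"
    interpret J: ideal J A by (rule J(1))
    show "J = p ` P \<or> J = carrier A"
    proof (cases "J \<subseteq> p ` P")
      case False
      then obtain a where a: "a \<in> J" "a \<notin> p ` P" by blast
      then have "a \<in> p ` T n" using J(3) p_image by blast
      then obtain t where "t \<in> T n" "a = p t" by blast
      then have t: "t \<in> T n" "p t \<in> J" "p t \<notin> p ` P" using a by simp_all
      then obtain u where u: "u \<in> T n" "t * u - 1 \<in> P" using max_ideal_inverse[OF P t(1)] by blast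
      have "1 = t * u - (t * u - 1)" by simp
      then have "p 1 = p t \<otimes> p u \<ominus> p (t * u - 1)"
        using p_diff[of "t * u" "t * u - 1"] p_mult[OF t(1) u(1)] t u by (metis PT T_mult)
      also have "\<dots> \<in> J"
      proof -
        have "p t \<otimes> p u \<in> J" by (rule J.I_r_closed[OF t(2) p_closed[OF u(1)]])
        moreover have "p (t * u - 1) \<in> J" using J(2) u by blast
        ultimately show ?thesis by (simp add: A.minus_eq J.a_closed J.a_inv_closed)
      qed
      finally show ?thesis using J.one_imp_carrier p_one by simp
    qed (use J in auto)
  qed
  then show "p ` P \<in> Max_spec A" by (simp add: Max_spec_def)
qed

text \<open>The definite description in \<open>residue_abs\<close> needs existence and uniqueness.
  \<open>rho (pull M)\<close> is constant on cosets and descends to the residue field; any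
  competitor, composed with the projection from \<open>T n\<close>, is an absolute value modulo
  \<open>pull M\<close> and so coincides with it.\<close>

lemma abs_at_eq_rho:
  assumes Mx: "M \<in> Max_spec A" and t: "t \<in> T n"
  shows "abs_at v A \<iota> (p t) M = rho (pull M) t"
proof -
  interpret M: maximalideal M A using Mx by (simp add: Max_spec_def)
  note P = pull_max_ideal(1)[OF Mx] and hom = M.rcos_ring_hom
  note R = rho_abs_val[OF P]
  let ?Q = "A Quot M" and ?c = "\<lambda>t. M +> p t"
  have car: "carrier ?Q = ?c ` T n"
    unfolding FactRing_def A_RCOSETS_def' p_image[symmetric] by auto
  have ceq: "?c t = ?c u \<longleftrightarrow> t - u \<in> pull M" if "t \<in> T n" "u \<in> T n" for t u
    using A.quotient_eq_iff_same_a_r_cos[OF M.ideal_axioms p_closed p_closed, of t u] that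
    by (auto simp: pull_def p_diff)
  have c_add: "?c t \<oplus>\<^bsub>?Q\<^esub> ?c u = ?c (t + u)" and c_mult: "?c t \<otimes>\<^bsub>?Q\<^esub> ?c u = ?c (t * u)"
    if "t \<in> T n" "u \<in> T n" for t u
    using ring_hom_add[OF hom p_closed p_closed, of t u] ring_hom_mult[OF hom p_closed p_closed, of t u] that
    by (simp_all add: p_add p_mult)
  have c_zero: "?c t = \<zero>\<^bsub>?Q\<^esub> \<longleftrightarrow> t \<in> pull M" if "t \<in> T n" for t
  proof -
    have "?c 0 = \<zero>\<^bsub>?Q\<^esub>" using M.a_rcos_const[OF M.zero_closed] by (simp add: p_zero FactRing_def)
    then show ?thesis using ceq[OF that, of 0] by simp
  qed
  \<comment> \<open>The choice of representative does not affect the value, by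
    \<open>pm_cong\<close>; the restriction provides the required extensionality.\<close>
  define w where "w = restrict (\<lambda>x. rho (pull M) (SOME t. t \<in> T n \<and> ?c t = x)) (carrier ?Q)"
  have w: "w (?c t) = rho (pull M) t" if t: "t \<in> T n" for t
  proof -
    let ?u = "SOME u. u \<in> T n \<and> ?c u = ?c t"
    have u: "?u \<in> T n \<and> ?c ?u = ?c t" by (rule someI[of _ t]) (use t in simp)
    then have "rho (pull M) ?u = rho (pull M) t"
      using ceq[of ?u t] t by (intro pm_cong[OF rho_pm_norm[OF P]]) auto
    then show ?thesis using t car by (simp add: w_def)
  qed
  have unique: "w' = w" if w': "w' \<in> extensional (carrier ?Q)" "nonarch_abs ?Q w'"
    "\<And>c. w' (M +> \<iota> c) = v c" for w'
  proof (rule extensionalityI[OF w'(1)])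
    show "w \<in> extensional (carrier ?Q)" by (simp add: w_def)
    have ccar: "?c t \<in> carrier ?Q" if "t \<in> T n" for t using car that by blast
    have "abs_val n (pull M) (\<lambda>t. w' (?c t))"
      unfolding abs_val_def
    proof (intro conjI ballI allI)
      fix a assume a: "a \<in> T n"
      show "0 \<le> w' (?c a)" "w' (?c a) = 0 \<longleftrightarrow> a \<in> pull M"
        using w'(2) ccar[OF a] c_zero[OF a] by (auto simp: nonarch_abs_def)
      fix b assume b: "b \<in> T n"
      show "w' (?c (a + b)) \<le> max (w' (?c a)) (w' (?c b))" "w' (?c (a * b)) = w' (?c a) * w' (?c b)"
        using w'(2) ccar[OF a] ccar[OF b] unfolding nonarch_abs_def
        by (simp_all flip: c_add[OF a b] c_mult[OF a b])
    next
      show "w' (?c (const c)) = v c" for c using w'(3) by (simp add: p_const)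
    qed
    then have "w' (?c t) = w (?c t)" if "t \<in> T n" for t
      using abs_val_unique[OF P, of "\<lambda>t. w' (?c t)"] w that by simp
    then show "w' x = w x" if "x \<in> carrier ?Q" for x using that car by auto
  qed
  have "residue_abs v A \<iota> M = w"
    unfolding residue_abs_def
  proof (rule the_equality)
    have "nonarch_abs ?Q w"
      unfolding nonarch_abs_def car
      using abs_val_nonneg[OF R] abs_val_zero_iff[OF R] abs_val_add[OF R] abs_val_mult[OF R]
      by (auto simp: w c_zero c_add c_mult)
    moreover have "w (M +> \<iota> c) = v c" for c
      using w[of "const c"] abs_val_const[OF R] by (simp add: p_const)
    ultimately show "w \<in> extensional (carrier ?Q) \<and> nonarch_abs ?Q w \<and> (\<forall>c. w (M +> \<iota> c) = v c)"
      by (simp add: w_def)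
  qed (use unique in blast)
  then show ?thesis using w[OF t] by (simp add: abs_at_def)
qed

lemma abs_at_nonneg:
  assumes "M \<in> Max_spec A" "f \<in> carrier A" shows "0 \<le> abs_at v A \<iota> f M"
proof -
  obtain t where "t \<in> T n" "f = p t" using assms p_image by blast
  then show ?thesis using abs_at_eq_rho[OF assms(1)] rho_nonneg[OF pull_max_ideal(1)[OF assms(1)]] by simp
qed

end

section \<open>Conditions defining Laurent domains\<close>

text \<open>A factor \<open>q > 1\<close> sharpens both kinds of inequality.\<close>

definition sat :: "('a, 'b) ring_scheme \<Rightarrow> ('k \<Rightarrow> 'a) \<Rightarrow> real \<Rightarrow> 'a \<times> real \<times> bool \<Rightarrow> 'a set \<Rightarrow> bool" where
  "sat A \<iota> q c x = (case c of (f, \<alpha>, b) \<Rightarrow>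
    if b then abs_at v A \<iota> f x * q < \<alpha> else \<alpha> * q < abs_at v A \<iota> f x)"

definition conds :: "('a, 'b) ring_scheme \<Rightarrow> ('a \<times> real \<times> bool) set" where
  "conds A = carrier A \<times> sqrt_value_group v \<times> UNIV"

text \<open>The conditions cover exactly when their negations, a system of non-strict inequalities,
  have no common solution. Relaxing the negations by \<open>q\<close> is the same as sharpening the
  conditions by \<open>q\<close>.\<close>

lemma strict_covering:
  assumes aff: "affinoid_algebra v A \<iota>" and \<Omega>: "finite \<Omega>" "\<Omega> \<subseteq> conds A"
    and cover: "\<And>x. x \<in> Max_spec A \<Longrightarrow> \<exists>c\<in>\<Omega>. sat A \<iota> 1 c x"
  shows "\<exists>q>1. \<forall>x\<in>Max_spec A. \<exists>c\<in>\<Omega>. sat A \<iota> q c x"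
proof -
  obtain n p where A: "cring A" and pres: "presentation n A \<iota> p" using affinoid_presentation[OF aff] by blast
  interpret A: cring A by (rule A)
  note im = image_max_ideal[OF A pres] and abs_eq = abs_at_eq_rho[OF A pres]
  obtain \<omega> where "bij_betw \<omega> {0..<card \<Omega>} \<Omega>" using ex_bij_betw_nat_finite[OF \<Omega>(1)] by blast
  then have \<omega>: "\<omega> ` {..<card \<Omega>} = \<Omega>" by (simp add: bij_betw_def atLeast0LessThan)
  have "\<exists>t. t \<in> T n \<and> p t = fst (\<omega> i)" if "i < card \<Omega>" for i
  proof -
    have "\<omega> i \<in> conds A" using that \<omega> \<Omega>(2) by blast
    then have "fst (\<omega> i) \<in> p ` T n" using p_image[OF A pres] by (auto simp: conds_def)
    then show ?thesis by force
  qed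
  then obtain h where h: "\<And>i. i < card \<Omega> \<Longrightarrow> h i \<in> T n \<and> p (h i) = fst (\<omega> i)" by metis
  let ?I = "pull n p {\<zero>\<^bsub>A\<^esub>}"
  have I: "ideal_in (T n) ?I" by (rule pull_ideal[OF A pres A.zeroideal])
  have sat_eq: "sat A \<iota> q (\<omega> i) (p ` P) \<longleftrightarrow>
      (if \<not> snd (snd (\<omega> i)) then fst (snd (\<omega> i)) * q < rho P (h i) else rho P (h i) * q < fst (snd (\<omega> i)))"
    if P: "max_ideal (T n) P" "?I \<subseteq> P" and i: "i < card \<Omega>" for P i q
    using abs_eq[OF im(1)[OF P], of "h i"] im(2)[OF P] h[OF i] by (cases "\<omega> i") (auto simp: sat_def)
  obtain q where q: "q > 1" "\<And>P. max_ideal (T n) P \<Longrightarrow> ?I \<subseteq> P \<Longrightarrow>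
      \<exists>i<card \<Omega>. if snd (snd (\<omega> i)) then rho P (h i) * q < fst (snd (\<omega> i)) else fst (snd (\<omega> i)) * q < rho P (h i)"
  proof (rule strict_emptiness[OF I, where h = h and r = "card \<Omega>"])
    show "h i \<in> T n" if "i < card \<Omega>" for i using h[OF that] by simp
    show "fst (snd (\<omega> i)) \<in> sqrt_value_group v" if "i < card \<Omega>" for i
    proof -
      have "\<omega> i \<in> conds A" using that \<omega> \<Omega>(2) by blast
      then show ?thesis by (auto simp: conds_def)
    qed
    fix P assume P: "max_ideal (T n) P" "?I \<subseteq> P"
    obtain c where c: "c \<in> \<Omega>" "sat A \<iota> 1 c (p ` P)" using cover[OF im(1)[OF P]] by blast
    then have "c \<in> \<omega> ` {..<card \<Omega>}" using \<omega> by simp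
    then obtain i where i: "i < card \<Omega>" "sat A \<iota> 1 (\<omega> i) (p ` P)" using c(2) by auto
    then show "\<exists>i<card \<Omega>. if snd (snd (\<omega> i)) then rho P (h i) < fst (snd (\<omega> i)) else fst (snd (\<omega> i)) < rho P (h i)"
      using sat_eq[OF P i(1), of 1] by (intro exI[of _ i]) auto
  qed blast
  have "\<exists>c\<in>\<Omega>. sat A \<iota> q c x" if x: "x \<in> Max_spec A" for x
  proof -
    note P = pull_max_ideal[OF A pres x]
    have "p ` pull n p x = x"
    proof -
      interpret x: maximalideal x A using x by (simp add: Max_spec_def)
      have "x \<subseteq> p ` T n" using x.Icarr p_image[OF A pres] by blast
      then show ?thesis unfolding pull_def[OF A pres] by blast
    qed
    moreover obtain i where i: "i < card \<Omega>" "if snd (snd (\<omega> i)) then rho (pull n p x) (h i) * q < fst (snd (\<omega> i))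
        else fst (snd (\<omega> i)) * q < rho (pull n p x) (h i)" using q(2)[OF P] by blast
    ultimately have "sat A \<iota> q (\<omega> i) x" using sat_eq[OF P i(1), of q] by auto
    then show ?thesis using i(1) \<omega> by blast
  qed
  then show ?thesis using q(1) by blast
qed

section \<open>Radii in the value group and closure properties of Laurent domains\<close>

lemma sqrt_value_group_dense:
  assumes "0 \<le> a" "a < b" obtains \<gamma> where "\<gamma> \<in> sqrt_value_group v" "a < \<gamma>" "\<gamma> < b"
proof -
  obtain x0 where x0: "x0 \<noteq> 0" "v x0 \<noteq> 1" using nontrivial by blast
  obtain x where x: "v x > 1"
  proof (cases "v x0 > 1")
    case False
    then have "v (inverse x0) > 1" using x0 v_pos[OF x0(1)] by (simp add: v_inverse one_less_inverse_iff)
    then show ?thesis using that by blast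
  qed (use that in blast)
  let ?c = "v x"
  \<comment> \<open>The maximum keeps the lower end positive when \<open>a\<close> is 0, so that a
    rational exponent can be found between two logarithms.\<close>
  define a' where "a' = max a (b / 2)"
  have a': "0 < a'" "a \<le> a'" "a' < b" using assms by (auto simp: a'_def)
  then have "log ?c a' < log ?c b" using x by simp
  then obtain s where s: "s \<in> \<rat>" "log ?c a' < s" "s < log ?c b" using Rats_dense_in_real by blast
  then obtain i m where im: "s = real_of_int i / real m" "m \<noteq> 0" unfolding Rats_eq_int_div_nat by blast
  let ?\<gamma> = "?c powr s"
  have "?\<gamma> ^ m = ?c powr (s * real m)" using x by (simp add: powr_powr flip: powr_realpow)
  also have "s * real m = real_of_int i" using im by simp
  also have "?c powr real_of_int i = v (if 0 \<le> i then x ^ nat i else inverse (x ^ nat (- i)))"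
    using x by (subst powr_real_of_int) (auto simp: v_power v_inverse)
  finally have "?\<gamma> \<in> sqrt_value_group v"
    unfolding sqrt_value_group_def using x im(2) by (auto intro!: exI[of _ m] simp: Suc_le_eq)
  moreover have "a < ?\<gamma>" "?\<gamma> < b"
    using s(2,3) x a' by (simp_all add: log_less_iff less_log_iff)
  ultimately show ?thesis using that by blast
qed

lemma open_laurent_domain_Max_spec: "open_laurent_domain v A \<iota> (Max_spec A)"
  unfolding open_laurent_domain_def by (intro exI[of _ "0::nat"]) auto

lemma open_laurent_domain_sat:
  assumes "c \<in> conds A" shows "open_laurent_domain v A \<iota> {x \<in> Max_spec A. sat A \<iota> 1 c x}"
proof (cases c)
  case (fields f \<alpha> b)
  then have f: "f \<in> carrier A" "\<alpha> \<in> sqrt_value_group v" using assms by (auto simp: conds_def)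
  show ?thesis
    unfolding open_laurent_domain_def
    by (rule exI[of _ "if b then 1 else 0"], rule exI[of _ "if b then 0 else 1"], rule exI[of _ "\<lambda>_. f"],
        rule exI[of _ "\<lambda>_. f"], rule exI[of _ "\<lambda>_. \<alpha>"], rule exI[of _ "\<lambda>_. \<alpha>"])
      (use f fields in \<open>auto simp: sat_def\<close>)
qed

lemma open_laurent_domain_INT:
  "finite S \<Longrightarrow> (\<And>c. c \<in> S \<Longrightarrow> open_laurent_domain v A \<iota> (U c)) \<Longrightarrow>
    open_laurent_domain v A \<iota> (Max_spec A \<inter> (\<Inter>c\<in>S. U c))"
proof (induction S rule: finite_induct)
  case (insert c S)
  have "Max_spec A \<inter> (\<Inter>c\<in>insert c S. U c) = U c \<inter> (Max_spec A \<inter> (\<Inter>c\<in>S. U c))" by auto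
  then show ?case using insert by (auto intro!: open_laurent_domain_Int)
qed (simp add: open_laurent_domain_Max_spec)

lemma open_laurent_domain_conds:
  assumes "open_laurent_domain v A \<iota> U"
  shows "\<exists>\<Omega>. finite \<Omega> \<and> \<Omega> \<subseteq> conds A \<and> U = {x \<in> Max_spec A. \<forall>c\<in>\<Omega>. sat A \<iota> 1 c x}"
proof -
  obtain s t :: nat and f g \<alpha> \<beta> where
    1: "\<forall>i\<in>{1..s}. f i \<in> carrier A \<and> \<alpha> i \<in> sqrt_value_group v"
       "\<forall>j\<in>{1..t}. g j \<in> carrier A \<and> \<beta> j \<in> sqrt_value_group v"
       "U = {x \<in> Max_spec A. (\<forall>i\<in>{1..s}. abs_at v A \<iota> (f i) x < \<alpha> i) \<and>
                             (\<forall>j\<in>{1..t}. abs_at v A \<iota> (g j) x > \<beta> j)}"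
    using assms unfolding open_laurent_domain_def by (elim exE conjE) (rule that)
  let ?\<Omega> = "(\<lambda>i. (f i, \<alpha> i, True)) ` {1..s} \<union> (\<lambda>j. (g j, \<beta> j, False)) ` {1..t}"
  show ?thesis
  proof (intro exI conjI)
    show "finite ?\<Omega>" by simp
    show "?\<Omega> \<subseteq> conds A" using 1(1,2) by (auto simp: conds_def)
    show "U = {x \<in> Max_spec A. \<forall>c\<in>?\<Omega>. sat A \<iota> 1 c x}" unfolding 1(3) by (simp add: ball_Un sat_def)
  qed
qed

lemma conds_Laurent: "f \<in> carrier A \<Longrightarrow> \<gamma> \<in> sqrt_value_group v \<Longrightarrow>
    open_laurent_domain v A \<iota> {x \<in> Max_spec A. abs_at v A \<iota> f x < \<gamma>} \<and>
    open_laurent_domain v A \<iota> {x \<in> Max_spec A. \<gamma> < abs_at v A \<iota> f x}"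
  using open_laurent_domain_sat[of "(f, \<gamma>, True)" A \<iota>] open_laurent_domain_sat[of "(f, \<gamma>, False)" A \<iota>]
  by (simp add: conds_def sat_def)

text \<open>A member of such a covering containing a point of the sharpened condition is \<open>I 0\<close>, and a
  member meeting \<open>I 0\<close> is \<open>I 0\<close> or \<open>I 1\<close>, hence lies in the domain of the original condition.\<close>

lemma three_set_covering:
  assumes c: "c \<in> conds A" and q: "q > 1"
  obtains I :: "nat \<Rightarrow> 'a set set" where
    "\<forall>j. open_laurent_domain v A \<iota> (I j)" "I 0 \<union> I 1 \<union> I 2 = Max_spec A"
    "I 0 \<union> I 1 \<subseteq> {x. sat A \<iota> 1 c x}" "I 0 \<inter> I 2 = {}"
    "\<forall>x\<in>Max_spec A. sat A \<iota> q c x \<longrightarrow> x \<notin> I 1 \<union> I 2"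
proof -
  obtain f \<alpha> b where fab: "c = (f, \<alpha>, b)" by (cases c)
  have f: "f \<in> carrier A" and \<alpha>: "\<alpha> \<in> sqrt_value_group v" using c by (auto simp: fab conds_def)
  have \<alpha>0: "\<alpha> > 0" using \<alpha> by (simp add: sqrt_value_group_def)
  let ?L = "\<lambda>\<gamma>. {x \<in> Max_spec A. abs_at v A \<iota> f x < \<gamma>}" and ?G = "\<lambda>\<gamma>. {x \<in> Max_spec A. \<gamma> < abs_at v A \<iota> f x}"
  show ?thesis
  proof (cases b)
    case True
    \<comment> \<open>Two radii with \<open>\<alpha> / q < \<beta> < a < \<alpha>\<close>. The disc
      and the exterior bounded by the circle of radius \<open>a\<close> are disjoint; the circle
      itself lies in the annulus between \<beta> and \<alpha>. The sharpened condition keeps a point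
      below \<beta>, outside annulus and exterior. The other case is the mirror image.\<close>
    have "0 \<le> \<alpha> / q" "\<alpha> / q < \<alpha>" using \<alpha>0 q by (auto simp: divide_less_eq)
    then obtain \<beta> where \<beta>: "\<beta> \<in> sqrt_value_group v" "\<alpha> / q < \<beta>" "\<beta> < \<alpha>" by (rule sqrt_value_group_dense)
    then have "0 \<le> \<beta>" by (simp add: sqrt_value_group_def)
    then obtain a where a: "a \<in> sqrt_value_group v" "\<beta> < a" "a < \<alpha>" using \<beta>(3) by (rule sqrt_value_group_dense)
    have less: "y < \<beta>" if "y * q < \<alpha>" for y
      using that \<beta>(2) q by (smt (verit, best) pos_less_divide_eq)
    show ?thesis
      by (rule that[of "\<lambda>j. if j = 0 then ?L a else if j = 1 then ?G \<beta> \<inter> ?L \<alpha> else ?G a"])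
        (use conds_Laurent[OF f] \<alpha> \<beta> a True less in
          \<open>fastforce simp: fab sat_def intro!: open_laurent_domain_Int dest: less\<close>)+
  next
    case False
    have "\<alpha> < \<alpha> * q" using \<alpha>0 q by simp
    with less_imp_le[OF \<alpha>0] obtain \<beta> where \<beta>: "\<beta> \<in> sqrt_value_group v" "\<alpha> < \<beta>" "\<beta> < \<alpha> * q"
      by (rule sqrt_value_group_dense)
    from less_imp_le[OF \<alpha>0] \<beta>(2) obtain a where a: "a \<in> sqrt_value_group v" "\<alpha> < a" "a < \<beta>"
      by (rule sqrt_value_group_dense)
    show ?thesis
      by (rule that[of "\<lambda>j. if j = 0 then ?G a else if j = 1 then ?G \<alpha> \<inter> ?L \<beta> else ?L a"])
        (use conds_Laurent[OF f] \<alpha> \<beta> a False in \<open>fastforce simp: fab sat_def intro!: open_laurent_domain_Int\<close>)+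
  qed
qed

section \<open>Star-refinements of Laurent coverings\<close>

lemma sat_mono:
  assumes aff: "affinoid_algebra v A \<iota>" and "c \<in> conds A" "x \<in> Max_spec A" "q \<le> q'" "sat A \<iota> q' c x"
  shows "sat A \<iota> q c x"
proof -
  obtain n p where A: "cring A" and pres: "presentation n A \<iota> p" using affinoid_presentation[OF aff] by blast
  obtain f \<alpha> b where c: "c = (f, \<alpha>, b)" by (cases c)
  then have "f \<in> carrier A" "0 \<le> \<alpha>" using assms(2) by (auto simp: conds_def sqrt_value_group_def)
  then have "abs_at v A \<iota> f x * q \<le> abs_at v A \<iota> f x * q'" "\<alpha> * q \<le> \<alpha> * q'"
    using abs_at_nonneg[OF A pres assms(3)] assms(4) by (auto intro: mult_left_mono)
  then show ?thesis using assms(5) by (auto simp: c sat_def split: if_splits)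
qed

text \<open>Since \<open>C\<close> is a covering, for every choice of one condition for each member of \<open>C\<close> the chosen
  conditions cover; by strictness they still do so after a slight sharpening, uniformly in the
  finitely many choices.\<close>

lemma shrink_covering:
  assumes aff: "affinoid_algebra v A \<iota>" and C: "finite C"
    and \<Omega>: "\<And>U. U \<in> C \<Longrightarrow> finite (\<Omega> U)" "\<And>U. U \<in> C \<Longrightarrow> \<Omega> U \<subseteq> conds A"
    and cover: "\<And>x. x \<in> Max_spec A \<Longrightarrow> \<exists>U\<in>C. \<forall>c\<in>\<Omega> U. sat A \<iota> 1 c x"
  shows "\<exists>q>1. \<forall>x\<in>Max_spec A. \<exists>U\<in>C. \<forall>c\<in>\<Omega> U. sat A \<iota> q c x"
proof -
  let ?\<Pi> = "PiE C \<Omega>"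
  have fin: "finite ?\<Pi>" by (rule finite_PiE[OF C \<Omega>(1)])
  have "\<exists>q>1. \<forall>x\<in>Max_spec A. \<exists>c\<in>\<tau> ` C. sat A \<iota> q c x" if \<tau>: "\<tau> \<in> ?\<Pi>" for \<tau>
  proof (rule strict_covering[OF aff])
    show "finite (\<tau> ` C)" using C by simp
    show "\<tau> ` C \<subseteq> conds A" using PiE_mem[OF \<tau>] \<Omega>(2) by blast
    fix x assume "x \<in> Max_spec A"
    then obtain U where "U \<in> C" "\<forall>c\<in>\<Omega> U. sat A \<iota> 1 c x" using cover by blast
    then show "\<exists>c\<in>\<tau> ` C. sat A \<iota> 1 c x" using \<tau> by (auto simp: PiE_iff)
  qed
  then obtain q where q: "\<And>\<tau>. \<tau> \<in> ?\<Pi> \<Longrightarrow> q \<tau> > 1 \<and> (\<forall>x\<in>Max_spec A. \<exists>c\<in>\<tau> ` C. sat A \<iota> (q \<tau>) c x)"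
    by metis
  \<comment> \<open>The value 2 is the default when there is no choice function, that is, when some
    member of \<open>C\<close> carries no condition.\<close>
  define q0 where "q0 = Min (insert 2 (q ` ?\<Pi>))"
  have "q0 > 1" unfolding q0_def using fin q by (subst Min_gr_iff) auto
  moreover have "\<exists>U\<in>C. \<forall>c\<in>\<Omega> U. sat A \<iota> q0 c x" if x: "x \<in> Max_spec A" for x
  proof (rule ccontr)
    assume "\<not> ?thesis"
    \<comment> \<open>If every member fails at \<open>x\<close>, picking a failing condition in each
      gives a choice whose conditions all fail at \<open>x\<close>, contrary to the sharpened
      covering for that choice.\<close>
    then obtain \<sigma> where \<sigma>: "\<And>U. U \<in> C \<Longrightarrow> \<sigma> U \<in> \<Omega> U \<and> \<not> sat A \<iota> q0 (\<sigma> U) x" by metis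
    let ?\<tau> = "restrict \<sigma> C"
    have \<tau>: "?\<tau> \<in> ?\<Pi>" using \<sigma> by auto
    then obtain U where U: "U \<in> C" "sat A \<iota> (q ?\<tau>) (\<sigma> U) x" using q[OF \<tau>] x by auto
    have "q0 \<le> q ?\<tau>" unfolding q0_def using fin \<tau> by (intro Min_le) auto
    moreover have "\<sigma> U \<in> conds A" using \<sigma>[OF U(1)] \<Omega>(2)[OF U(1)] by blast
    ultimately have "sat A \<iota> q0 (\<sigma> U) x" using sat_mono[OF aff _ x] U(2) by blast
    then show False using \<sigma>[OF U(1)] by blast
  qed
  ultimately show ?thesis by blast
qed

text \<open>The refinement is the common refinement of the three-set coverings of all conditions.
  Given a point \<open>x\<close> of a member \<open>W\<close>, let \<open>U\<close> satisfy its
  sharpened conditions at \<open>x\<close>. For each of these conditions \<open>W\<close> uses the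
  set with index 0, so every member meeting \<open>W\<close> uses index 0 or 1 and satisfies the
  original condition.\<close>

lemma laurent_star_refinement:
  fixes A :: "('a, 'b) ring_scheme"
  assumes aff: "affinoid_algebra v A \<iota>" and C: "finite C" "covering (Max_spec A) C"
    "\<And>U. U \<in> C \<Longrightarrow> open_laurent_domain v A \<iota> U"
  obtains C' where "finite C'" "covering (Max_spec A) C'" "\<forall>U\<in>C'. open_laurent_domain v A \<iota> U"
    "star_refines C' C"
proof -
  let ?X = "Max_spec A"
  have "\<forall>U\<in>C. \<exists>\<Omega>. finite \<Omega> \<and> \<Omega> \<subseteq> conds A \<and> U = {x \<in> ?X. \<forall>c\<in>\<Omega>. sat A \<iota> 1 c x}"
    using open_laurent_domain_conds[OF C(3)] by (rule ballI)
  from bchoice[OF this] obtain \<Omega> where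
    "\<forall>U\<in>C. finite (\<Omega> U) \<and> \<Omega> U \<subseteq> conds A \<and> U = {x \<in> ?X. \<forall>c\<in>\<Omega> U. sat A \<iota> 1 c x}" by (rule exE)
  then have \<Omega>: "finite (\<Omega> U) \<and> \<Omega> U \<subseteq> conds A \<and> U = {x \<in> ?X. \<forall>c\<in>\<Omega> U. sat A \<iota> 1 c x}" if "U \<in> C" for U
    using that by (rule bspec)
  have cov: "\<exists>U\<in>C. \<forall>c\<in>\<Omega> U. sat A \<iota> 1 c x" if x: "x \<in> ?X" for x
  proof -
    obtain U where "U \<in> C" "x \<in> U" using C(2) x by (auto simp: covering_def)
    then show ?thesis using \<Omega>[of U] by blast
  qed
  have "\<exists>q>1. \<forall>x\<in>?X. \<exists>U\<in>C. \<forall>c\<in>\<Omega> U. sat A \<iota> q c x"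
  proof (rule shrink_covering[OF aff C(1)])
    fix U assume "U \<in> C"
    then show "finite (\<Omega> U)" "\<Omega> U \<subseteq> conds A" using \<Omega>[of U] by simp_all
  qed (rule cov)
  then obtain q where q: "q > 1" "\<And>x. x \<in> ?X \<Longrightarrow> \<exists>U\<in>C. \<forall>c\<in>\<Omega> U. sat A \<iota> q c x" by blast
  let ?S = "\<Union>(\<Omega> ` C)"
  have S: "finite ?S" "?S \<subseteq> conds A" using C(1) \<Omega> by auto
  have "\<exists>I :: nat \<Rightarrow> 'a set set. (\<forall>j. open_laurent_domain v A \<iota> (I j)) \<and> I 0 \<union> I 1 \<union> I 2 = ?X \<and>
      I 0 \<union> I 1 \<subseteq> {x. sat A \<iota> 1 c x} \<and> I 0 \<inter> I 2 = {} \<and> (\<forall>x\<in>?X. sat A \<iota> q c x \<longrightarrow> x \<notin> I 1 \<union> I 2)"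
    if "c \<in> ?S" for c
  proof -
    have "c \<in> conds A" using that S(2) by blast
    from three_set_covering[OF this q(1), of \<iota>] show ?thesis by metis
  qed
  then obtain I :: "'a \<times> real \<times> bool \<Rightarrow> nat \<Rightarrow> 'a set set" where
    I: "\<And>c. c \<in> ?S \<Longrightarrow> (\<forall>j. open_laurent_domain v A \<iota> (I c j)) \<and> I c 0 \<union> I c 1 \<union> I c 2 = ?X \<and>
      I c 0 \<union> I c 1 \<subseteq> {x. sat A \<iota> 1 c x} \<and> I c 0 \<inter> I c 2 = {} \<and> (\<forall>x\<in>?X. sat A \<iota> q c x \<longrightarrow> x \<notin> I c 1 \<union> I c 2)"
    by metis
  let ?\<Pi> = "PiE ?S (\<lambda>_. {0, 1, 2 :: nat})"
  define V where "V \<tau> = ?X \<inter> (\<Inter>c\<in>?S. I c (\<tau> c))" for \<tau>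
  \<comment> \<open>Empty members are removed because the target \<open>U\<close> is found from a
    point of \<open>W\<close>.\<close>
  let ?C = "V ` ?\<Pi> - {{}}"
  show ?thesis
  proof (rule that[of ?C])
    show "finite ?C" using finite_PiE[OF S(1), of "\<lambda>_. {0, 1, 2 :: nat}"] by simp
    show "\<forall>U\<in>?C. open_laurent_domain v A \<iota> U"
    proof
      fix W assume "W \<in> ?C"
      then obtain \<tau> where W: "W = V \<tau>" by blast
      show "open_laurent_domain v A \<iota> W"
        unfolding W V_def by (rule open_laurent_domain_INT[OF S(1)]) (use I in blast)
    qed
    show "covering ?X ?C"
      unfolding covering_def
    proof
      show "\<Union>?C \<subseteq> ?X" by (auto simp: V_def)
      show "?X \<subseteq> \<Union>?C"
      proof
        fix x assume x: "x \<in> ?X"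
        have "\<exists>j\<in>{0, 1, 2}. x \<in> I c j" if "c \<in> ?S" for c using I[OF that] x by blast
        then obtain \<tau> where \<tau>: "\<And>c. c \<in> ?S \<Longrightarrow> \<tau> c \<in> {0, 1, 2} \<and> x \<in> I c (\<tau> c)" by metis
        have "x \<in> V (restrict \<tau> ?S)" unfolding V_def using \<tau> x by auto
        moreover have "restrict \<tau> ?S \<in> ?\<Pi>" using \<tau> by (intro restrict_PiE_iff[THEN iffD2]) blast
        ultimately show "x \<in> \<Union>?C" by blast
      qed
    qed
    show "star_refines ?C C"
      unfolding star_refines_def
    proof
      fix W assume "W \<in> ?C"
      then obtain \<tau> x where \<tau>: "\<tau> \<in> ?\<Pi>" "W = V \<tau>" "x \<in> W" by blast
      have x: "x \<in> ?X" using \<tau> by (simp add: V_def)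
      obtain U where U: "U \<in> C" "\<forall>c\<in>\<Omega> U. sat A \<iota> q c x" using q(2)[OF x] by blast
      have zero: "\<tau> c = 0" if c: "c \<in> \<Omega> U" for c
      proof -
        have cS: "c \<in> ?S" using c U by blast
        have "x \<in> I c (\<tau> c)" using \<tau> cS by (auto simp: V_def)
        moreover have "x \<notin> I c 1 \<union> I c 2" using I[OF cS] x U(2) c by blast
        moreover have "\<tau> c \<in> {0, 1, 2}" by (rule PiE_mem[OF \<tau>(1) cS])
        ultimately show ?thesis by auto
      qed
      have sub: "W' \<subseteq> U" if W': "W' \<in> ?C" "W' \<inter> W \<noteq> {}" for W'
      proof -
        obtain \<sigma> y where \<sigma>: "\<sigma> \<in> ?\<Pi>" "W' = V \<sigma>" "y \<in> W'" "y \<in> W" using W' by blast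
        have V_sat: "V \<sigma> \<subseteq> {x. sat A \<iota> 1 c x}" if c: "c \<in> \<Omega> U" for c
        proof -
          have cS: "c \<in> ?S" using c U by blast
          have "y \<in> I c (\<tau> c)" "y \<in> I c (\<sigma> c)" using \<sigma> \<tau>(2) cS by (auto simp: V_def)
          then have "\<sigma> c \<noteq> 2" using I[OF cS] zero[OF c] by auto
          moreover have "\<sigma> c \<in> {0, 1, 2}" by (rule PiE_mem[OF \<sigma>(1) cS])
          ultimately have "I c (\<sigma> c) \<subseteq> I c 0 \<union> I c 1" by auto
          moreover have "V \<sigma> \<subseteq> I c (\<sigma> c)" using cS by (auto simp: V_def)
          ultimately show ?thesis using I[OF cS] by blast
        qed
        have U_eq: "U = {x \<in> ?X. \<forall>c\<in>\<Omega> U. sat A \<iota> 1 c x}" using \<Omega>[OF U(1)] by (elim conjE)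
        show ?thesis
          unfolding \<sigma>(2)
        proof
          fix z assume z: "z \<in> V \<sigma>"
          then have "z \<in> ?X" by (simp add: V_def)
          moreover have "\<forall>c\<in>\<Omega> U. sat A \<iota> 1 c z" using V_sat z by blast
          ultimately show "z \<in> U" by (subst U_eq) simp
        qed
      qed
      have "\<Union>{W' \<in> ?C. W' \<inter> W \<noteq> {}} \<subseteq> U"
      proof (rule Union_least)
        fix W' assume "W' \<in> {W' \<in> ?C. W' \<inter> W \<noteq> {}}"
        then show "W' \<subseteq> U" by (elim CollectE conjE) (rule sub)
      qed
      then show "\<exists>U\<in>C. \<Union>{W' \<in> ?C. W' \<inter> W \<noteq> {}} \<subseteq> U" by (rule bexI[OF _ U(1)])
    qed
  qed
qed

section \<open>The uniform structure\<close>

lemma laurent_coveringsI: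
  "finite C \<Longrightarrow> covering (Max_spec A) C \<Longrightarrow> (\<And>U. U \<in> C \<Longrightarrow> open_laurent_domain v A \<iota> U) \<Longrightarrow>
    C \<in> laurent_coverings v A \<iota>"
  unfolding laurent_coverings_def cover_refines_def by blast

text \<open>For the second axiom, one star-refinement of the covering by pairwise intersections
  serves both coverings at once.\<close>

lemma laurent_uniform_structure:
  assumes aff: "affinoid_algebra v A \<iota>"
  shows "uniform_structure (Max_spec A) (laurent_coverings v A \<iota>)"
  unfolding uniform_structure_def
proof (intro conjI ballI allI impI)
  let ?X = "Max_spec A"
  show "covering ?X C" if "C \<in> laurent_coverings v A \<iota>" for C using that by (simp add: laurent_coverings_def)
  show "D \<in> laurent_coverings v A \<iota>"
    if C: "C \<in> laurent_coverings v A \<iota>" and D: "covering ?X D \<and> cover_refines C D" for C D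
  proof -
    obtain B where B: "finite B" "covering ?X B" "\<forall>U\<in>B. open_laurent_domain v A \<iota> U" "cover_refines B C"
      using C unfolding laurent_coverings_def by blast
    have "cover_refines B D" using B(4) D unfolding cover_refines_def by (meson order_trans)
    then show ?thesis using B D unfolding laurent_coverings_def by blast
  qed
  fix D1 D2 assume D: "D1 \<in> laurent_coverings v A \<iota>" "D2 \<in> laurent_coverings v A \<iota>"
  obtain C1 where C1: "finite C1" "covering ?X C1" "\<forall>U\<in>C1. open_laurent_domain v A \<iota> U" "cover_refines C1 D1"
    using D(1) unfolding laurent_coverings_def by blast
  obtain C2 where C2: "finite C2" "covering ?X C2" "\<forall>U\<in>C2. open_laurent_domain v A \<iota> U" "cover_refines C2 D2"
    using D(2) unfolding laurent_coverings_def by blast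
  let ?C = "(\<lambda>(U, V). U \<inter> V) ` (C1 \<times> C2)"
  have "\<Union>?C = \<Union>C1 \<inter> \<Union>C2" by auto
  then have cov: "covering ?X ?C" using C1(2) C2(2) by (simp add: covering_def)
  have fin: "finite ?C" using C1(1) C2(1) by simp
  have dom: "open_laurent_domain v A \<iota> W" if "W \<in> ?C" for W
    using that C1(3) C2(3) by (auto intro: open_laurent_domain_Int)
  obtain C where C: "finite C" "covering ?X C" "\<forall>U\<in>C. open_laurent_domain v A \<iota> U" "star_refines C ?C"
    by (rule laurent_star_refinement[OF aff fin cov dom])
  have star: "star_refines C D" if "cover_refines ?C D" for D
    using C(4) that unfolding star_refines_def cover_refines_def by (meson order_trans)
  have "cover_refines ?C C1" "cover_refines ?C C2" unfolding cover_refines_def by auto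
  then have "cover_refines ?C D1" "cover_refines ?C D2"
    using C1(4) C2(4) unfolding cover_refines_def by (meson order_trans)+
  then show "\<exists>C\<in>laurent_coverings v A \<iota>. star_refines C D1 \<and> star_refines C D2"
    using star laurent_coveringsI[OF C(1,2)] C(3) by blast
qed

lemma openin_uniform_imp_canonical:
  assumes U: "U \<subseteq> Max_spec A" "\<forall>x\<in>U. \<exists>C\<in>laurent_coverings v A \<iota>. \<Union>{V\<in>C. x \<in> V} \<subseteq> U"
  shows "openin (canonical_topology v A \<iota>) U"
proof -
  have "\<exists>B. open_laurent_domain v A \<iota> B \<and> x \<in> B \<and> B \<subseteq> U" if x: "x \<in> U" for x
  proof -
    obtain C where C: "C \<in> laurent_coverings v A \<iota>" "\<Union>{V\<in>C. x \<in> V} \<subseteq> U" using U(2) x by blast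
    then obtain C0 where C0: "covering (Max_spec A) C0" "\<forall>U\<in>C0. open_laurent_domain v A \<iota> U" "cover_refines C0 C"
      unfolding laurent_coverings_def by blast
    obtain B where B: "B \<in> C0" "x \<in> B" using C0(1) x U(1) unfolding covering_def by blast
    then obtain V where V: "V \<in> C" "B \<subseteq> V" using C0(3) unfolding cover_refines_def by blast
    then have "B \<subseteq> U" using B(2) C(2) by blast
    then show ?thesis using B C0(2) by blast
  qed
  then have "U = \<Union>{B. open_laurent_domain v A \<iota> B \<and> B \<subseteq> U}" by blast
  then show ?thesis unfolding openin_canonical_topology
    by (intro exI[of _ "{B. open_laurent_domain v A \<iota> B \<and> B \<subseteq> U}"]) blast
qed

text \<open>A Laurent domain \<open>B\<close> around \<open>x\<close> is completed to a finite
  covering by Laurent domains that all avoid \<open>x\<close>, one for each condition defining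
  \<open>B\<close>; then the star of \<open>x\<close> in this covering is \<open>B\<close>.\<close>

lemma openin_canonical_imp_uniform:
  assumes aff: "affinoid_algebra v A \<iota>" and U: "openin (canonical_topology v A \<iota>) U" and x: "x \<in> U"
  shows "U \<subseteq> Max_spec A \<and> (\<exists>C\<in>laurent_coverings v A \<iota>. \<Union>{V\<in>C. x \<in> V} \<subseteq> U)"
proof -
  let ?X = "Max_spec A"
  obtain \<B> where \<B>: "\<forall>B\<in>\<B>. open_laurent_domain v A \<iota> B" "U = \<Union>\<B>" using U unfolding openin_canonical_topology by blast
  have sub: "B \<subseteq> ?X" if "open_laurent_domain v A \<iota> B" for B
    using open_laurent_domain_conds[OF that] by blast
  obtain B where B: "B \<in> \<B>" "x \<in> B" using \<B>(2) x by blast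
  obtain \<Omega> where \<Omega>: "finite \<Omega>" "\<Omega> \<subseteq> conds A" "B = {x \<in> ?X. \<forall>c\<in>\<Omega>. sat A \<iota> 1 c x}"
    using open_laurent_domain_conds[OF bspec[OF \<B>(1) B(1)]] by (elim exE conjE) (rule that)
  \<comment> \<open>The set where \<open>c\<close> fails is given by a non-strict inequality. Since
    \<open>c\<close> holds strictly at \<open>x\<close>, a radius between the bound and the value at
    \<open>x\<close> encloses this set in a Laurent domain without \<open>x\<close>.\<close>
  have "\<exists>R. open_laurent_domain v A \<iota> R \<and> x \<notin> R \<and> (\<forall>y\<in>?X. sat A \<iota> 1 c y \<or> y \<in> R)" if c: "c \<in> \<Omega>" for c
  proof -
    obtain f \<alpha> b where fab: "c = (f, \<alpha>, b)" by (cases c)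
    have f: "f \<in> carrier A" and \<alpha>: "\<alpha> \<in> sqrt_value_group v" using c \<Omega>(2) by (auto simp: fab conds_def)
    have xX: "x \<in> ?X" and sx: "sat A \<iota> 1 c x" using B(2) \<Omega>(3) c by auto
    show ?thesis
    proof (cases b)
      case True
      obtain n p where A: "cring A" and pres: "presentation n A \<iota> p" using affinoid_presentation[OF aff] by blast
      have "0 \<le> abs_at v A \<iota> f x" by (rule abs_at_nonneg[OF A pres xX f])
      moreover have "abs_at v A \<iota> f x < \<alpha>" using sx True by (simp add: fab sat_def)
      ultimately obtain \<gamma> where \<gamma>: "\<gamma> \<in> sqrt_value_group v" "abs_at v A \<iota> f x < \<gamma>" "\<gamma> < \<alpha>"
        by (rule sqrt_value_group_dense)
      then show ?thesis using True conds_Laurent[OF f \<gamma>(1), of \<iota>]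
        by (intro exI[of _ "{y \<in> ?X. \<gamma> < abs_at v A \<iota> f y}"]) (auto simp: fab sat_def)
    next
      case False
      have "0 \<le> \<alpha>" using \<alpha> by (simp add: sqrt_value_group_def)
      moreover have "\<alpha> < abs_at v A \<iota> f x" using sx False by (simp add: fab sat_def)
      ultimately obtain \<gamma> where \<gamma>: "\<gamma> \<in> sqrt_value_group v" "\<alpha> < \<gamma>" "\<gamma> < abs_at v A \<iota> f x"
        by (rule sqrt_value_group_dense)
      then show ?thesis using False conds_Laurent[OF f \<gamma>(1), of \<iota>]
        by (intro exI[of _ "{y \<in> ?X. abs_at v A \<iota> f y < \<gamma>}"]) (auto simp: fab sat_def)
    qed
  qed
  then obtain R where R: "\<And>c. c \<in> \<Omega> \<Longrightarrow> open_laurent_domain v A \<iota> (R c) \<and> x \<notin> R c \<and> (\<forall>y\<in>?X. sat A \<iota> 1 c y \<or> y \<in> R c)"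
    by metis
  let ?C = "insert B (R ` \<Omega>)"
  have "\<Union>?C \<subseteq> ?X" using sub R \<B>(1) B(1) by blast
  moreover have "?X \<subseteq> \<Union>?C"
  proof
    fix y assume y: "y \<in> ?X"
    show "y \<in> \<Union>?C"
    proof (cases "\<forall>c\<in>\<Omega>. sat A \<iota> 1 c y")
      case True
      then show ?thesis using y \<Omega>(3) by simp
    next
      case False
      then obtain c where "c \<in> \<Omega>" "y \<in> R c" using R y by blast
      then show ?thesis by blast
    qed
  qed
  ultimately have "?C \<in> laurent_coverings v A \<iota>"
    using \<Omega>(1) R \<B>(1) B(1) by (intro laurent_coveringsI) (auto simp: covering_def)
  moreover have "\<Union>{V\<in>?C. x \<in> V} \<subseteq> U" using R \<B>(2) B(1) by blast
  moreover have "U \<subseteq> ?X" using \<B> sub by blast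
  ultimately show ?thesis by blast
qed

end

theorem corollary4p3:
  fixes v :: "'k::field \<Rightarrow> real"
    and A :: "('a, 'b) ring_scheme"
    and \<iota> :: "'k \<Rightarrow> 'a"
  assumes "complete_nonarch_field v"
    and "affinoid_algebra v A \<iota>"
  shows "uniform_structure (Max_spec A) (laurent_coverings v A \<iota>) \<and>
    uniform_topology (Max_spec A) (laurent_coverings v A \<iota>) = canonical_topology v A \<iota>"
proof
  interpret complete_nonarch_field v by (rule assms(1))
  show unif: "uniform_structure (Max_spec A) (laurent_coverings v A \<iota>)"
    by (rule laurent_uniform_structure[OF assms(2)])
  show "uniform_topology (Max_spec A) (laurent_coverings v A \<iota>) = canonical_topology v A \<iota>"
    unfolding topology_eq openin_uniform_topology[OF unif]
  proof (intro allI iffI)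
    fix U assume "U \<subseteq> Max_spec A \<and> (\<forall>x\<in>U. \<exists>C\<in>laurent_coverings v A \<iota>. \<Union>{V\<in>C. x \<in> V} \<subseteq> U)"
    then show "openin (canonical_topology v A \<iota>) U" by (intro openin_uniform_imp_canonical) auto
  next
    fix U assume U: "openin (canonical_topology v A \<iota>) U"
    show "U \<subseteq> Max_spec A \<and> (\<forall>x\<in>U. \<exists>C\<in>laurent_coverings v A \<iota>. \<Union>{V\<in>C. x \<in> V} \<subseteq> U)"
      using openin_canonical_imp_uniform[OF assms(2) U] by blast
  qed
qed

end
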